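(* There exists an $O(\log\log\bar{d})$-round MPC algorithm using $\tilde{O}(n)$ local memory and $O(m+n)$ global memory which, given an $n$-vertex, $m$-edge (unweighted) graph $G=(V,E)$ and positive integer budgets $(b_v)_{v\in V}$, computes a $\Theta(1)$-approximation of a maximum $b$-matching of $G$ with positive constant probability. Here $\bar{d}=2m/n$ is the average degree.
   Context: A $b$-matching of $G$ is a set $M\subseteq E$ such that every vertex $v$ is incident to at most $b_v$ edges of $M$; a $\Theta(1)$-approximation is a $b$-matching whose size is at least a constant fraction of the maximum size of a $b$-matching. MPC model: edges distributed among machines with local memory $S$ each; synchronous rounds of local computation followed by all-to-all communication in which each machine sends and receives at most $S$ words; global memory is total memory; complexity is the number of rounds. *)

theory Defs
  imports "HOL-Probability.Probability" "HOL-Probability.Product_PMF"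
begin

definition simple_graph :: "'v set \<Rightarrow> 'v set set \<Rightarrow> bool" where
  "simple_graph V E \<longleftrightarrow> finite V \<and> (\<forall>e\<in>E. e \<subseteq> V \<and> card e = 2)"

definition b_matching :: "'v set \<Rightarrow> 'v set set \<Rightarrow> ('v \<Rightarrow> nat) \<Rightarrow> 'v set set \<Rightarrow> bool" where
  "b_matching V E b M \<longleftrightarrow> M \<subseteq> E \<and> (\<forall>v\<in>V. card {e\<in>M. v \<in> e} \<le> b v)"

definition max_b_matching_size :: "'v set \<Rightarrow> 'v set set \<Rightarrow> ('v \<Rightarrow> nat) \<Rightarrow> nat" where
  "max_b_matching_size V E b = Max (card ` {M. b_matching V E b M})"

definition approx_b_matching ::
  "real \<Rightarrow> 'v set \<Rightarrow> 'v set set \<Rightarrow> ('v \<Rightarrow> nat) \<Rightarrow> 'v set set \<Rightarrow> bool" where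
  "approx_b_matching \<alpha> V E b M \<longleftrightarrow>
     b_matching V E b M \<and> real (card M) \<ge> \<alpha> * real (max_b_matching_size V E b)"

definition avg_degree :: "nat \<Rightarrow> nat \<Rightarrow> real" where
  "avg_degree n m = 2 * real m / real n"

text \<open>The truncations only matter for bounded arguments; they keep the logarithms at least 1, as
  is implicit in O-notation.\<close>

definition log_trunc :: "real \<Rightarrow> real" where
  "log_trunc x = log 2 (max 2 x)"

definition loglog_trunc :: "real \<Rightarrow> real" where
  "loglog_trunc x = log 2 (log 2 (max 4 x))"

text \<open>A word is a natural number; \<open>words_ok\<close> below bounds it polynomially in the number of
  vertices, so that a word has O(log n) bits. The input consists of one item per edge and one
  item per vertex (carrying its budget), each accounting for two words.\<close>

datatype item = Edge "nat set" | Budget nat nat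

text \<open>All components know the number \<open>n\<close> of vertices and the number \<open>m\<close> of edges, which are the
  first two arguments. \<open>load n m i\<close> is the way machine \<open>i\<close> stores its share of the input in its
  memory (budgets can be arbitrarily large, so they need not be words). \<open>step n m t i\<close> is the
  randomized local computation of machine \<open>i\<close> in round \<open>t\<close>: from the memory contents it
  produces the contents to be kept and, for each machine, the words to be sent to it.
  Local computation is unrestricted and the machines have private, independent randomness.\<close>

record mpc_algorithm =
  machines :: "nat \<Rightarrow> nat \<Rightarrow> nat"
  local_memory :: "nat \<Rightarrow> nat \<Rightarrow> nat"
  rounds :: "nat \<Rightarrow> nat \<Rightarrow> nat"
  load :: "nat \<Rightarrow> nat \<Rightarrow> nat \<Rightarrow> item list \<Rightarrow> nat list"
  step :: "nat \<Rightarrow> nat \<Rightarrow> nat \<Rightarrow> nat \<Rightarrow> nat list \<Rightarrow> (nat list \<times> (nat \<Rightarrow> nat list)) pmf"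

definition global_memory :: "mpc_algorithm \<Rightarrow> nat \<Rightarrow> nat \<Rightarrow> nat" where
  "global_memory A n m = machines A n m * local_memory A n m"

definition input_items :: "nat set \<Rightarrow> nat set set \<Rightarrow> (nat \<Rightarrow> nat) \<Rightarrow> item set" where
  "input_items V E b = Edge ` E \<union> (\<lambda>v. Budget v (b v)) ` V"

text \<open>Items can be placed arbitrarily, as long as no machine holds more than \<open>S\<close> words.\<close>

definition input_distribution ::
  "nat \<Rightarrow> nat \<Rightarrow> nat set \<Rightarrow> nat set set \<Rightarrow> (nat \<Rightarrow> nat) \<Rightarrow> (nat \<Rightarrow> item list) \<Rightarrow> bool" where
  "input_distribution P S V E b D \<longleftrightarrow>
     distinct (concat (map D [0..<P])) \<and>
     set (concat (map D [0..<P])) = input_items V E b \<and>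
     (\<forall>i<P. 2 * length (D i) \<le> S)"

definition local_computations ::
  "mpc_algorithm \<Rightarrow> nat \<Rightarrow> nat \<Rightarrow> nat \<Rightarrow> (nat \<Rightarrow> nat list) \<Rightarrow>
     (nat \<Rightarrow> nat list \<times> (nat \<Rightarrow> nat list)) pmf" where
  "local_computations A n m t \<sigma> =
     Pi_pmf {..<machines A n m} ([], \<lambda>_. []) (\<lambda>i. step A n m t i (\<sigma> i))"

definition inbox :: "nat \<Rightarrow> (nat \<Rightarrow> nat list \<times> (nat \<Rightarrow> nat list)) \<Rightarrow> nat \<Rightarrow> nat list" where
  "inbox P r i = concat (map (\<lambda>j. snd (r j) i) [0..<P])"

definition communicate ::
  "nat \<Rightarrow> (nat \<Rightarrow> nat list \<times> (nat \<Rightarrow> nat list)) \<Rightarrow> nat \<Rightarrow> nat list" where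
  "communicate P r = (\<lambda>i. if i < P then fst (r i) @ inbox P r i else [])"

primrec run ::
  "mpc_algorithm \<Rightarrow> nat \<Rightarrow> nat \<Rightarrow> (nat \<Rightarrow> item list) \<Rightarrow> nat \<Rightarrow> (nat \<Rightarrow> nat list) pmf" where
  "run A n m D 0 =
     return_pmf (\<lambda>i. if i < machines A n m then load A n m i (D i) else [])"
| "run A n m D (Suc t) =
     bind_pmf (run A n m D t)
       (\<lambda>\<sigma>. map_pmf (communicate (machines A n m)) (local_computations A n m t \<sigma>))"

definition words_ok :: "nat \<Rightarrow> nat \<Rightarrow> nat list \<Rightarrow> bool" where
  "words_ok c n ws \<longleftrightarrow> (\<forall>w\<in>set ws. w < (n + 1) ^ c)"

text \<open>The memory and communication limits are hard constraints of the model: they have to be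
  obeyed in every possible execution.\<close>

definition obeys_limits ::
  "nat \<Rightarrow> mpc_algorithm \<Rightarrow> nat \<Rightarrow> nat \<Rightarrow> (nat \<Rightarrow> item list) \<Rightarrow> bool" where
  "obeys_limits c A n m D \<longleftrightarrow>
     (let P = machines A n m; S = local_memory A n m; T = rounds A n m in
       (\<forall>t\<le>T. \<forall>\<sigma>\<in>set_pmf (run A n m D t). \<forall>i<P.
          length (\<sigma> i) \<le> S \<and> words_ok c n (\<sigma> i)) \<and>
       (\<forall>t<T. \<forall>\<sigma>\<in>set_pmf (run A n m D t). \<forall>r\<in>set_pmf (local_computations A n m t \<sigma>). \<forall>i<P.
          (\<Sum>j<P. length (snd (r i) j)) \<le> S \<and> length (inbox P r i) \<le> S))"

text \<open>At the end the memories hold the output, as a list of edges taking two words each.\<close>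

fun decode_edges :: "nat list \<Rightarrow> nat set set" where
  "decode_edges (u # v # ws) = insert {u, v} (decode_edges ws)"
| "decode_edges _ = {}"

definition mpc_output :: "mpc_algorithm \<Rightarrow> nat \<Rightarrow> nat \<Rightarrow> (nat \<Rightarrow> item list) \<Rightarrow> nat set set pmf" where
  "mpc_output A n m D =
     map_pmf (\<lambda>\<sigma>. \<Union>i<machines A n m. decode_edges (\<sigma> i)) (run A n m D (rounds A n m))"

end

theory Submission
  imports Defs "HOL-Algebra.Algebraic_Closure_Type" "HOL-Library.Z2" "HOL-Library.Nat_Bijection"
begin

text \<open>
  The algorithm grows a fractional \<open>b\<close>-matching. An edge stays active until its weight is a constant or
  one of its ends carries a constant fraction of its budget; once the active edges fit into one machine they are
  solved there exactly. Every edge is then heavy, has a saturated end, or was active at the end, so the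
  total weight is within a constant of the optimum. The fractional solution is rounded by sampling edges
  with a pairwise independent hash and discarding those at overloaded vertices. Since the output never exceeds the
  optimum, a bound on its expected size yields a constant success probability.

  To shrink the number \<open>n * d\<close> of active edges to \<open>n * d powr (15/16)\<close> in O(1) rounds, every vertex picks a random
  line of the affine plane over the field with about \<open>sqrt d\<close> elements. For each point a machine collects the
  edges whose ends both pass through it, about \<open>n\<close> of them, and computes an optimal \<open>c\<close>-matching where
  \<open>c = b div s\<close> for a scale \<open>s\<close>; the matched edges gain weight. Distinct lines meet at most once, so no edge is used
  twice. Conditioned on all other lines, the points of the line of \<open>v\<close> are pairwise independent; hence, by
  Chebyshev, \<open>v\<close> gains about the average over all points of what it could gain there, and in an optimal matching
  it gains at least the number of its free neighbours, up to \<open>c v\<close>. If that average is small,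
  few points offer free neighbours to \<open>v\<close>, although unsaturated neighbours are free at most points of their lines and
  any large set of lines is spread evenly over the plane; so \<open>v\<close> has few active neighbours left. Three scales
  cover all budgets, and O(log log d) phases suffice.
\<close>

section \<open>Orthogonal arrays from finite fields\<close>

text \<open>Two constraints shape the construction. Memory limits bind in every execution, so a
  point attracting too many edges forfeits its matching. And the edges of a vertex are scattered
  over the machines, so each random choice about an edge must be a function of one seed per end:
  machine 0 draws the seeds of a stage and all machines learn them. A plane has at most one point
  per machine. Let q = 2 ^ e, k = q ^ 8, with at most n q ^ 16 active edges. At scale s a vertex may
  keep about 16 k (\<beta> div s) of them. For budgets in [s, T) with T / s <= sqrt k this leaves
  O(n k sqrt k) = O(n q ^ 12) edges, so the scales 1 and sqrt k serve all budgets below k. Larger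
  budgets would leave too many, but scale k brings most degrees below 16 \<beta>, and then all these
  edges can be taken at once with constant weight. The other vertices either lose a factor q ^ 2 of
  their degree or are unlucky, which gives O(n q ^ 14) in expectation. Aiming only at n q ^ 15
  leaves a factor q for Markov's inequality, so the failure probabilities of the phases have a small
  sum.\<close>

lemma of_nat_bit: "(of_nat x :: bit) = (if even x then 0 else 1)"
  by (induction x) auto

lemma CHAR_bit: "CHAR(bit) = 2"
proof (rule CHAR_eqI)
  show "of_nat 2 = (0 :: bit)" unfolding of_nat_bit by simp
  show "2 dvd x" if "of_nat x = (0 :: bit)" for x
    using that unfolding of_nat_bit by (simp split: if_splits)
qed

text \<open>In characteristic 2 the derivative of x ^ N - x is the constant -1, so there is no
  double root; over the algebraic closure the polynomial therefore has exactly \<open>N\<close>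
  roots. They form the field with \<open>N\<close> elements.\<close>

lemma card_frobenius_roots:
  assumes N: "N = 2 ^ j" "j > 0"
  shows "card {x :: bit alg_closure. x ^ N = x} = N"
proof -
  have CH: "CHAR(bit alg_closure) = 2" by (simp add: CHAR_bit)
  have N2: "N \<ge> 2" using N by (metis One_nat_def Suc_leI numeral_2_eq_2 one_less_numeral_iff one_less_power semiring_norm(76))
  define p :: "bit alg_closure poly" where "p = Polynomial.monom 1 N - [:0, 1:]"
  have degp: "Polynomial.degree p = N"
  proof -
    have "Polynomial.degree [:0, 1 :: bit alg_closure:] < Polynomial.degree (Polynomial.monom (1 :: bit alg_closure) N)"
      using N2 by (simp add: Polynomial.degree_monom_eq)
    then show ?thesis
      unfolding p_def diff_conv_add_uminus by (subst Polynomial.degree_add_eq_left) (auto simp: Polynomial.degree_monom_eq)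
  qed
  have p0: "p \<noteq> 0" using degp N2 by auto
  have roots: "poly p x = 0 \<longleftrightarrow> x ^ N = x" for x
    by (simp add: p_def poly_monom)
  have N0: "of_nat N = (0 :: bit alg_closure)"
    unfolding of_nat_eq_0_iff_char_dvd CH using N by simp
  have pd: "pderiv p = [:-1:]"
    unfolding p_def using N0 by (simp add: pderiv_diff pderiv_monom pderiv_pCons)
  obtain A where A: "size A = Polynomial.degree p" "p = Polynomial.smult (Polynomial.lead_coeff p) (\<Prod>x\<in>#A. [:-x, 1:])"
    using alg_closed_imp_factorization[OF p0] by blast
  have fin: "finite {x. poly p x = 0}" using p0 by (rule poly_roots_finite)
  have cnt: "count A x \<le> 1" for x
  proof (rule ccontr)
    assume "\<not> count A x \<le> 1"
    then have "{#x, x#} \<subseteq># A" by (auto simp: subseteq_mset_def)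
    then obtain C where C: "A = {#x, x#} + C" by (metis subset_mset.add_diff_inverse)
    have "[:-x, 1:] * [:-x, 1:] dvd p"
    proof -
      have "(\<Prod>y\<in>#A. [:-y, 1:]) = [:-x, 1:] * [:-x, 1:] * (\<Prod>y\<in>#C. [:-y, 1:])"
        unfolding C by (simp only: image_mset_union prod_mset.union image_mset_add_mset
          image_mset_empty prod_mset.add_mset prod_mset.empty mult_1_right mult.assoc)
      then have "[:-x, 1:] * [:-x, 1:] dvd (\<Prod>y\<in>#A. [:-y, 1:])" by (simp only: dvd_triv_left)
      then show ?thesis by (subst A(2)) (rule dvd_smult)
    qed
    then obtain r where r: "p = [:-x, 1:] * [:-x, 1:] * r" by (elim dvdE)
    have "poly (pderiv p) x = 0"
      by (simp only: r pderiv_mult poly_add poly_mult) simp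
    then show False by (simp add: pd)
  qed
  have "set_mset A = {x. poly p x = 0}"
  proof -
    have "Polynomial.lead_coeff p \<noteq> 0" using p0 by simp
    then have "poly p x = 0 \<longleftrightarrow> x \<in># A" for x
      by (subst A(2)) (auto simp: poly_prod_mset)
    then show ?thesis by auto
  qed
  moreover have "size A = card (set_mset A)"
    unfolding size_multiset_overloaded_eq
    by (subst card_eq_sum, intro sum.cong refl) (metis One_nat_def count_greater_eq_one_iff cnt le_antisym)
  ultimately show ?thesis using A(1) degp roots by simp
qed

text \<open>The lines y = a x + b over the field with \<open>k = 2 ^ j\<close> elements, numbered arbitrarily.\<close>

lemma orthogonal_array_exists:
  assumes k: "k = (2::nat) ^ j" "j > 0"
  shows "\<exists>L :: nat \<Rightarrow> nat \<Rightarrow> nat. (\<forall>z<k * k. \<forall>x<k. L z x < k) \<and>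
    (\<forall>x<k. \<forall>x'<k. x \<noteq> x' \<longrightarrow> inj_on (\<lambda>z. (L z x, L z x')) {..<k * k})"
proof -
  define F where "F = {x :: bit alg_closure. x ^ k = x}"
  have CH: "CHAR(bit alg_closure) = 2" by (simp add: CHAR_bit)
  have cF: "card F = k" unfolding F_def using card_frobenius_roots[OF k] .
  have k0: "k > 0" using k by simp
  have fF: "finite F" using cF k0 by (metis card.infinite less_not_refl)
  \<comment> \<open>Closure under addition is the Frobenius identity: taking \<open>k\<close>-th
    powers is additive.\<close>
  have addF: "x + y \<in> F" if "x \<in> F" "y \<in> F" for x y
    using that freshmans_dream'[of k j x y] CH k unfolding F_def by auto
  have multF: "x * y \<in> F" if "x \<in> F" "y \<in> F" for x y
    using that unfolding F_def by (simp add: power_mult_distrib)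
  obtain h where h: "bij_betw h {..<k} F"
    using ex_bij_betw_nat_finite[OF fF] cF by (metis atLeast0LessThan)
  define g where "g = the_inv_into {..<k} h"
  have hF: "h x \<in> F" if "x < k" for x using h that by (auto simp: bij_betw_def)
  have g: "bij_betw g F {..<k}" unfolding g_def using h by (rule bij_betw_the_inv_into)
  have ginj: "x = y" if "g x = g y" "x \<in> F" "y \<in> F" for x y
    using g that by (auto simp: bij_betw_def inj_on_def)
  have hinj: "x = y" if "h x = h y" "x < k" "y < k" for x y
    using h that by (auto simp: bij_betw_def inj_on_def)
  \<comment> \<open>\<open>z div k\<close> codes the slope and \<open>z mod k\<close> the intercept;
    \<open>h\<close> and \<open>g\<close> translate between numbers and field elements.\<close>
  define L where "L = (\<lambda>z x. g (h (z div k) * h x + h (z mod k)))"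
  have dk: "z div k < k" "z mod k < k" if "z < k * k" for z
    using that k0 by (auto simp: less_mult_imp_div_less)
  have L1: "L z x < k" if "z < k * k" "x < k" for z x
  proof -
    have "h (z div k) * h x + h (z mod k) \<in> F"
      by (intro addF multF hF dk that)
    then show ?thesis using g by (auto simp: L_def bij_betw_def)
  qed
  have L2: "inj_on (\<lambda>z. (L z x, L z x')) {..<k * k}" if x: "x < k" "x' < k" "x \<noteq> x'" for x x'
  proof (rule inj_onI)
    fix z z' assume z: "z \<in> {..<k * k}" "z' \<in> {..<k * k}"
      and eq: "(L z x, L z x') = (L z' x, L z' x')"
    define a a' b b' where ab: "a = h (z div k)" "a' = h (z' div k)" "b = h (z mod k)" "b' = h (z' mod k)"
    note d = dk[of z] dk[of z']
    have e1: "a * h x + b = a' * h x + b'"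
      by (rule ginj) (use eq z d x in \<open>auto simp: L_def ab intro!: addF multF hF\<close>)
    have e2: "a * h x' + b = a' * h x' + b'"
      by (rule ginj) (use eq z d x in \<open>auto simp: L_def ab intro!: addF multF hF\<close>)
    have "(a - a') * (h x - h x') = 0"
    proof -
      have "(a - a') * h x = b' - b"
      proof -
        have "a * h x - a' * h x = (a * h x + b) - (a' * h x + b)" by simp
        also have "\<dots> = (a' * h x + b') - (a' * h x + b)" by (simp only: e1)
        finally show ?thesis by (simp add: left_diff_distrib)
      qed
      moreover have "(a - a') * h x' = b' - b"
      proof -
        have "a * h x' - a' * h x' = (a * h x' + b) - (a' * h x' + b)" by simp
        also have "\<dots> = (a' * h x' + b') - (a' * h x' + b)" by (simp only: e2)
        finally show ?thesis by (simp add: left_diff_distrib)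
      qed
      ultimately show ?thesis by (simp add: right_diff_distrib)
    qed
    moreover have "h x \<noteq> h x'" using hinj x by blast
    ultimately have "a = a'" by simp
    with e1 have "b = b'" by simp
    with \<open>a = a'\<close> have "z div k = z' div k" "z mod k = z' mod k"
      using hinj z d by (auto simp: ab)
    then show "z = z'" by (metis div_mult_mod_eq)
  qed
  show ?thesis using L1 L2 by (intro exI[of _ L]) auto
qed

text \<open>An orthogonal array of strength 2 and index 1. Rows are lines and columns are abscissas;
  no line is vertical, so every line has one point in each column.\<close>

definition is_oa :: "nat \<Rightarrow> (nat \<Rightarrow> nat \<Rightarrow> nat) \<Rightarrow> bool" where
  "is_oa k L \<longleftrightarrow> (\<forall>z<k * k. \<forall>x<k. L z x < k) \<and>
    (\<forall>x<k. \<forall>x'<k. x \<noteq> x' \<longrightarrow> inj_on (\<lambda>z. (L z x, L z x')) {..<k * k})"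

text \<open>The array is a fixed choice, the same for all machines, so it need not be
  communicated.\<close>

definition oa :: "nat \<Rightarrow> nat \<Rightarrow> nat \<Rightarrow> nat" where
  "oa k = (SOME L. is_oa k L)"

text \<open>The point (x, y) of the plane is coded as \<open>x * k + y\<close>.\<close>

definition on_line :: "nat \<Rightarrow> nat \<Rightarrow> nat \<Rightarrow> bool" where
  "on_line k z p \<longleftrightarrow> oa k z (p div k) = p mod k"

section \<open>Counting points on lines, and Chebyshev's inequality for a random line\<close>

lemma sum_points:
  fixes f :: "nat \<Rightarrow> 'a :: comm_monoid_add"
  assumes "k > 0"
  shows "(\<Sum>p<k * k. f p) = (\<Sum>x<k. \<Sum>y<k. f (x * k + y))"
proof -
  have "(\<Sum>x<k. \<Sum>y<k. f (x * k + y)) = (\<Sum>(x, y)\<in>{..<k} \<times> {..<k}. f (x * k + y))"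
    by (simp add: sum.cartesian_product)
  also have "\<dots> = (\<Sum>p<k * k. f p)"
  proof (rule sum.reindex_bij_witness[of _ "\<lambda>p. (p div k, p mod k)" "\<lambda>(x, y). x * k + y"])
    fix a assume "a \<in> {..<k} \<times> {..<k}"
    then show "(case a of (x, y) \<Rightarrow> x * k + y) \<in> {..<k * k}"
    proof -
      obtain x y where a: "a = (x, y)" "x < k" "y < k" using \<open>a \<in> _\<close> by auto
      have "x * k + y < (x + 1) * k" using a by simp
      also have "\<dots> \<le> k * k" using a by (intro mult_right_mono) auto
      finally show ?thesis using a by simp
    qed
  qed (use assms in \<open>auto simp: less_mult_imp_div_less\<close>)
  finally show ?thesis by simp
qed

context
  fixes k :: nat
  assumes ex: "\<exists>L. is_oa k L" and k0: "k > 0"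
begin

lemma is_oa_oa: "is_oa k (oa k)"
  unfolding oa_def using ex by (rule someI_ex)

lemma oa_less: "z < k * k \<Longrightarrow> x < k \<Longrightarrow> oa k z x < k"
  using is_oa_oa by (auto simp: is_oa_def)

lemma point_less: "x < k \<Longrightarrow> y < k \<Longrightarrow> x * k + y < k * k"
proof -
  assume a: "x < k" "y < k"
  have "x * k + y < (x + 1) * k" using a by simp
  also have "\<dots> \<le> k * k" using a by (intro mult_right_mono) auto
  finally show ?thesis .
qed

lemma sum_on_line:
  fixes f :: "nat \<Rightarrow> 'a :: comm_monoid_add"
  assumes z: "z < k * k"
  shows "(\<Sum>p | p < k * k \<and> on_line k z p. f p) = (\<Sum>x<k. f (x * k + oa k z x))"
  by (rule sum.reindex_bij_witness[of _ "\<lambda>x. x * k + oa k z x" "\<lambda>p. p div k"])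
     (use oa_less[OF z] point_less k0 in \<open>auto simp: on_line_def less_mult_imp_div_less\<close>)

lemma card_line:
  assumes z: "z < k * k"
  shows "card {p. p < k * k \<and> on_line k z p} = k"
  using sum_on_line[OF z, of "\<lambda>_. 1 :: nat"] by simp

text \<open>Two common points cannot share a column, since a line has one point per column; in two
  distinct columns they would determine the line by injectivity.\<close>

lemma card_lines_inter:
  assumes z: "z < k * k" "z' < k * k" "z \<noteq> z'"
  shows "card {p. p < k * k \<and> on_line k z p \<and> on_line k z' p} \<le> 1"
proof (rule ccontr)
  let ?S = "{p. p < k * k \<and> on_line k z p \<and> on_line k z' p}"
  assume "\<not> card ?S \<le> 1"
  moreover have "finite ?S" by simp
  ultimately obtain p q where pq: "p \<in> ?S" "q \<in> ?S" "p \<noteq> q"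
    using card_le_Suc0_iff_eq[of ?S] by auto
  have lt: "p div k < k" "q div k < k" using pq by (auto simp: less_mult_imp_div_less)
  have "p div k \<noteq> q div k"
  proof
    assume "p div k = q div k"
    with pq have "p mod k = q mod k" by (auto simp: on_line_def)
    with \<open>p div k = q div k\<close> pq show False by (metis div_mult_mod_eq)
  qed
  moreover have "(oa k z (p div k), oa k z (q div k)) = (oa k z' (p div k), oa k z' (q div k))"
    using pq by (auto simp: on_line_def)
  moreover have "inj_on (\<lambda>z. (oa k z (p div k), oa k z (q div k))) {..<k * k}"
    using is_oa_oa lt \<open>p div k \<noteq> q div k\<close> unfolding is_oa_def by blast
  ultimately show False using z by (auto dest: inj_onD)
qed

text \<open>Pairwise independence: an injection between sets of size \<open>k * k\<close> is a
  bijection, so the heights of a uniformly random line in two distinct columns are independent and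
  uniform.\<close>

lemma sum_two_columns:
  fixes f :: "nat \<Rightarrow> nat \<Rightarrow> 'a :: comm_monoid_add"
  assumes x: "x < k" "x' < k" "x \<noteq> x'"
  shows "(\<Sum>z<k * k. f (oa k z x) (oa k z x')) = (\<Sum>y<k. \<Sum>y'<k. f y y')"
proof -
  let ?h = "\<lambda>z. (oa k z x, oa k z x')"
  have inj: "inj_on ?h {..<k * k}" using is_oa_oa x by (auto simp: is_oa_def)
  have sub: "?h ` {..<k * k} \<subseteq> {..<k} \<times> {..<k}" using oa_less x by auto
  have "?h ` {..<k * k} = {..<k} \<times> {..<k}"
    by (rule card_subset_eq) (use sub in \<open>auto simp: card_image[OF inj]\<close>)
  then have "(\<Sum>(y, y')\<in>{..<k} \<times> {..<k}. f y y') = (\<Sum>z<k * k. f (oa k z x) (oa k z x'))"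
    using sum.reindex[OF inj, of "\<lambda>(y, y'). f y y'"] by (simp add: o_def)
  then show ?thesis by (simp add: sum.cartesian_product)
qed

lemma sum_column:
  fixes f :: "nat \<Rightarrow> real"
  assumes x: "x < k" and "k > 1"
  shows "(\<Sum>z<k * k. f (oa k z x)) = k * (\<Sum>y<k. f y)"
proof -
  obtain x' where "x' < k" "x \<noteq> x'" using assms by (metis gr0I less_one nat_neq_iff zero_less_one less_trans)
  then show ?thesis using sum_two_columns[of x x' "\<lambda>y _. f y"] x
    by (simp add: sum_distrib_left)
qed

text \<open>The sum of \<open>g\<close> along a random line has mean \<Gamma> / k and, by pairwise
  independence of its points, variance at most c \<Gamma> / k. Chebyshev's inequality limits the
  lines that reach less than half of the mean.\<close>

lemma chebyshev_lines:
  fixes g :: "nat \<Rightarrow> real" and c \<Gamma> :: real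
  defines "\<Gamma> \<equiv> \<Sum>p<k * k. g p"
  assumes k1: "k > 1" and g: "\<And>p. 0 \<le> g p" "\<And>p. g p \<le> c"
  shows "card {z. z < k * k \<and> (\<Sum>p | p < k * k \<and> on_line k z p. g p) < \<Gamma> / (2 * k)} * \<Gamma> \<le> 4 * c * k ^ 3"
proof -
  define G where "G z = (\<Sum>x<k. g (x * k + oa k z x))" for z
  define C where "C x = (\<Sum>y<k. g (x * k + y))" for x
  have \<Gamma>C: "\<Gamma> = (\<Sum>x<k. C x)" unfolding \<Gamma>_def C_def using k0 by (rule sum_points)
  have \<Gamma>0: "\<Gamma> \<ge> 0" unfolding \<Gamma>_def using g by (intro sum_nonneg) auto
  have c0: "c \<ge> 0" using g order_trans by blast
  have C0: "C x \<ge> 0" for x unfolding C_def using g by (intro sum_nonneg) auto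
  have S1: "(\<Sum>z<k * k. G z) = k * \<Gamma>"
  proof -
    have "(\<Sum>z<k * k. G z) = (\<Sum>x<k. \<Sum>z<k * k. g (x * k + oa k z x))"
      unfolding G_def by (rule sum.swap)
    also have "\<dots> = (\<Sum>x<k. k * C x)"
      unfolding C_def by (intro sum.cong refl sum_column[OF _ k1, of _ "\<lambda>y. g (_ * k + y)"]) auto
    finally show ?thesis by (simp add: \<Gamma>C sum_distrib_left)
  qed
  \<comment> \<open>Only the diagonal terms x = x' deviate from the product of the column sums;
    there one factor \<open>g\<close> is bounded by \<open>c\<close>.\<close>
  have S2: "(\<Sum>z<k * k. (G z)\<^sup>2) \<le> \<Gamma>\<^sup>2 + k * c * \<Gamma>"
  proof -
    have "(\<Sum>z<k * k. (G z)\<^sup>2) = (\<Sum>z<k * k. \<Sum>x<k. \<Sum>x'<k. g (x * k + oa k z x) * g (x' * k + oa k z x'))"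
      by (simp add: G_def power2_eq_square sum_product)
    also have "\<dots> = (\<Sum>x<k. \<Sum>x'<k. \<Sum>z<k * k. g (x * k + oa k z x) * g (x' * k + oa k z x'))"
      by (rule trans[OF sum.swap]) (intro sum.cong refl sum.swap)
    also have "\<dots> \<le> (\<Sum>x<k. \<Sum>x'<k. C x * C x' + (if x = x' then k * c * C x else 0))"
    proof (intro sum_mono)
      fix x x' assume x: "x \<in> {..<k}" "x' \<in> {..<k}"
      show "(\<Sum>z<k * k. g (x * k + oa k z x) * g (x' * k + oa k z x'))
        \<le> C x * C x' + (if x = x' then k * c * C x else 0)"
      proof (cases "x = x'")
        case True
        have "(\<Sum>z<k * k. g (x * k + oa k z x) * g (x' * k + oa k z x')) \<le> (\<Sum>z<k * k. c * g (x * k + oa k z x))"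
          unfolding True by (intro sum_mono mult_right_mono g)
        also have "\<dots> = c * (k * C x)"
          unfolding C_def using sum_column[OF _ k1, of x "\<lambda>y. g (x * k + y)"] x
          by (simp flip: sum_distrib_left)
        also have "\<dots> \<le> C x * C x' + (if x = x' then k * c * C x else 0)"
          using True C0[of x] by (simp add: mult_ac)
        finally show ?thesis .
      next
        case False
        then show ?thesis
          using sum_two_columns[of x x' "\<lambda>y y'. g (x * k + y) * g (x' * k + y')"] x
          by (simp add: C_def sum_product)
      qed
    qed
    also have "\<dots> = \<Gamma>\<^sup>2 + k * c * \<Gamma>"
    proof -
      have "(\<Sum>x<k. \<Sum>x'<k. C x * C x') = \<Gamma>\<^sup>2"
        by (simp add: \<Gamma>C power2_eq_square sum_product)
      moreover have "(\<Sum>x<k. \<Sum>x'<k. if x = x' then k * c * C x else 0) = k * c * \<Gamma>"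
        by (simp add: \<Gamma>C sum_distrib_left)
      ultimately show ?thesis by (simp only: sum.distrib)
    qed
    finally show ?thesis .
  qed
  define \<mu> where "\<mu> = \<Gamma> / k"
  have kk: "real k > 0" using k0 by simp
  have var: "(\<Sum>z<k * k. (G z - \<mu>)\<^sup>2) \<le> k * c * \<Gamma>"
  proof -
    have "(\<Sum>z<k * k. (G z - \<mu>)\<^sup>2) = (\<Sum>z<k * k. (G z)\<^sup>2) - 2 * \<mu> * (\<Sum>z<k * k. G z) + k * k * \<mu>\<^sup>2"
      by (simp add: power2_diff sum.distrib sum_subtractf sum_distrib_left mult_ac)
    also have "\<dots> = (\<Sum>z<k * k. (G z)\<^sup>2) - \<Gamma>\<^sup>2"
      unfolding S1 using kk by (simp add: \<mu>_def power2_eq_square)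
    finally show ?thesis using S2 by simp
  qed
  define Z where "Z = {z. z < k * k \<and> (\<Sum>p | p < k * k \<and> on_line k z p. g p) < \<Gamma> / (2 * k)}"
  have Z: "Z = {z. z < k * k \<and> G z < \<mu> / 2}"
    unfolding Z_def G_def \<mu>_def by (auto simp: sum_on_line)
  have "real (card Z) * (\<mu>\<^sup>2 / 4) = (\<Sum>z\<in>Z. \<mu>\<^sup>2 / 4)" by simp
  also have "\<dots> \<le> (\<Sum>z\<in>Z. (G z - \<mu>)\<^sup>2)"
  proof (rule sum_mono)
    fix z assume "z \<in> Z"
    then have "G z < \<mu> / 2" by (simp add: Z)
    moreover have "\<mu> \<ge> 0" using \<Gamma>0 by (simp add: \<mu>_def)
    ultimately have "(\<mu> / 2)\<^sup>2 \<le> (\<mu> - G z)\<^sup>2" by (intro power_mono) auto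
    then show "\<mu>\<^sup>2 / 4 \<le> (G z - \<mu>)\<^sup>2" by (simp add: power2_commute power_divide)
  qed
  also have "\<dots> \<le> (\<Sum>z<k * k. (G z - \<mu>)\<^sup>2)" by (rule sum_mono2) (auto simp: Z)
  finally have "real (card Z) * (\<mu>\<^sup>2 / 4) \<le> k * c * \<Gamma>" using var by simp
  then have "real (card Z) * \<Gamma>\<^sup>2 \<le> (4 * c * k ^ 3) * \<Gamma>"
    using kk by (simp add: \<mu>_def field_simps power2_eq_square power3_eq_cube)
  then have "(real (card Z) * \<Gamma>) * \<Gamma> \<le> (4 * c * k ^ 3) * \<Gamma>" by (simp add: power2_eq_square mult_ac)
  then show ?thesis unfolding Z_def[symmetric]
    using \<Gamma>0 c0 by (cases "\<Gamma> = 0") auto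
qed

text \<open>Here \<open>B p\<close> are candidate partners of a vertex at the point \<open>p\<close>; a line \<open>z\<close> collects the candidates
  of its points, except those lying on the very same line.\<close>

lemma few_bad_lines:
  fixes B :: "nat \<Rightarrow> nat set" and \<zeta> :: "nat \<Rightarrow> nat" and D :: "nat \<Rightarrow> nat" and c \<Gamma> :: nat
  defines "\<Gamma> \<equiv> \<Sum>p<k * k. card (B p)"
  assumes k1: "k > 1" and c: "c > 0" and B: "\<And>p. finite (B p)" "\<And>p. card (B p) \<le> c"
    and \<Gamma>: "16 * \<Gamma> \<ge> k * k * c"
    and D: "\<And>z. z < k * k \<Longrightarrow> (\<Sum>p | p < k * k \<and> on_line k z p. card {u \<in> B p. \<zeta> u \<noteq> z}) \<le> D z"
  shows "card {z. z < k * k \<and> 64 * D z < k * c} \<le> 68 * k"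
proof -
  define N where "N z = (\<Sum>p | p < k * k \<and> on_line k z p. card (B p))" for z
  define I where "I z = (\<Sum>p | p < k * k \<and> on_line k z p. card {u \<in> B p. \<zeta> u = z})" for z
  have split: "N z \<le> D z + I z" if "z < k * k" for z
  proof -
    have "N z = (\<Sum>p | p < k * k \<and> on_line k z p. card {u \<in> B p. \<zeta> u \<noteq> z} + card {u \<in> B p. \<zeta> u = z})"
      unfolding N_def
    proof (intro sum.cong refl)
      fix p
      have "B p = {u \<in> B p. \<zeta> u \<noteq> z} \<union> {u \<in> B p. \<zeta> u = z}" by auto
      then show "card (B p) = card {u \<in> B p. \<zeta> u \<noteq> z} + card {u \<in> B p. \<zeta> u = z}"
        using B by (subst card_Un_disjoint[symmetric]) auto
    qed
    then show ?thesis using D[OF that] by (simp add: sum.distrib I_def)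
  qed
  \<comment> \<open>A candidate is discounted only on its own line, so all lines together lose at
    most \<Gamma> candidates.\<close>
  have Isum: "(\<Sum>z<k * k. I z) \<le> \<Gamma>"
  proof -
    have "(\<Sum>z<k * k. I z) \<le> (\<Sum>z<k * k. \<Sum>p<k * k. card {u \<in> B p. \<zeta> u = z})"
      unfolding I_def by (intro sum_mono sum_mono2) auto
    also have "\<dots> = (\<Sum>p<k * k. \<Sum>z<k * k. card {u \<in> B p. \<zeta> u = z})" by (rule sum.swap)
    also have "\<dots> \<le> (\<Sum>p<k * k. card (B p))"
    proof (intro sum_mono)
      fix p
      have "(\<Sum>z<k * k. card {u \<in> B p. \<zeta> u = z}) = card (\<Union>z\<in>{..<k * k}. {u \<in> B p. \<zeta> u = z})"
        using B by (subst card_UN_disjoint) auto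
      also have "\<dots> \<le> card (B p)" by (rule card_mono) (use B in auto)
      finally show "(\<Sum>z<k * k. card {u \<in> B p. \<zeta> u = z}) \<le> card (B p)" .
    qed
    finally show ?thesis by (simp add: \<Gamma>_def)
  qed
  have \<Gamma>pos: "real \<Gamma> > 0" using \<Gamma> c k0 by (metis gr0I mult_is_0 not_le of_nat_0_less_iff mult_eq_0_iff)
  have kk: "real k > 0" using k0 by simp
  \<comment> \<open>Outside \<open>Z1\<close> a line collects at least \<Gamma> / (2 k), and outside
    \<open>Z2\<close> it loses less than \<Gamma> / (4 k); what remains is at least \<Gamma> / (4
    k), hence at least k c / 64. Chebyshev allows 64 k lines in \<open>Z1\<close>, Markov 4 k lines
    in \<open>Z2\<close>.\<close>
  define Z1 where "Z1 = {z. z < k * k \<and> real (N z) < real \<Gamma> / (2 * k)}"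
  define Z2 where "Z2 = {z. z < k * k \<and> real \<Gamma> \<le> 4 * k * real (I z)}"
  have "real (card Z1) * \<Gamma> \<le> 4 * c * k ^ 3"
    using chebyshev_lines[OF k1, of "\<lambda>p. real (card (B p))" "real c"] B
    unfolding Z1_def N_def \<Gamma>_def by simp
  also have "\<dots> \<le> 64 * k * real \<Gamma>"
  proof -
    have "real (k * k * c) \<le> real (16 * \<Gamma>)" using \<Gamma> of_nat_le_iff by blast
    then have "4 * real k * (k * k * c) \<le> 4 * real k * (16 * \<Gamma>)" by (intro mult_left_mono) auto
    then show ?thesis by (simp add: power3_eq_cube mult_ac)
  qed
  finally have Z1: "real (card Z1) \<le> 64 * k" using \<Gamma>pos by simp
  have "real (card Z2) * \<Gamma> = (\<Sum>z\<in>Z2. real \<Gamma>)" by simp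
  also have "\<dots> \<le> (\<Sum>z\<in>Z2. 4 * k * real (I z))" by (rule sum_mono) (auto simp: Z2_def)
  also have "\<dots> \<le> (\<Sum>z<k * k. 4 * k * real (I z))" by (rule sum_mono2) (auto simp: Z2_def)
  also have "\<dots> = 4 * k * real (\<Sum>z<k * k. I z)" by (simp add: sum_distrib_left)
  also have "\<dots> \<le> 4 * k * real \<Gamma>" using Isum by (intro mult_left_mono) (auto simp flip: of_nat_sum)
  finally have Z2: "real (card Z2) \<le> 4 * k" using \<Gamma>pos by simp
  have "{z. z < k * k \<and> 64 * D z < k * c} \<subseteq> Z1 \<union> Z2"
  proof
    fix z assume "z \<in> {z. z < k * k \<and> 64 * D z < k * c}"
    then have "z < k * k" and zD: "64 * D z < k * c" by auto
    moreover have "real (64 * D z) < real (k * c)" using zD by (simp only: of_nat_less_iff)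
    ultimately have z: "z < k * k" "64 * real (D z) < real k * real c" by simp_all
    show "z \<in> Z1 \<union> Z2"
    proof (rule ccontr)
      assume "z \<notin> Z1 \<union> Z2"
      then have a: "real \<Gamma> / (2 * k) \<le> real (N z)" "4 * k * real (I z) < real \<Gamma>"
        using z by (auto simp: Z1_def Z2_def)
      have "real (k * k * c) \<le> real (16 * \<Gamma>)" using \<Gamma> of_nat_le_iff by blast
      then have b: "real k * (real k * real c) \<le> 16 * real \<Gamma>" by (simp add: mult_ac)
      have "real \<Gamma> \<le> 2 * k * real (N z)" using a kk by (simp add: field_simps)
      also have "\<dots> \<le> 2 * k * (real (D z) + real (I z))"
        using split[OF z(1)] by (intro mult_left_mono) (auto simp flip: of_nat_add)
      finally have "real \<Gamma> \<le> 2 * k * real (D z) + 2 * k * real (I z)" by (simp add: algebra_simps)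
      with a(2) have "real \<Gamma> < 4 * k * real (D z)" by simp
      also have "16 * (4 * k * real (D z)) = k * (64 * real (D z))" by simp
      then have "16 * (4 * k * real (D z)) < real k * (real k * real c)" using z(2) kk by simp
      ultimately show False using b by simp
    qed
  qed
  then have "card {z. z < k * k \<and> 64 * D z < k * c} \<le> card (Z1 \<union> Z2)"
    by (intro card_mono) (auto simp: Z1_def Z2_def)
  also have "\<dots> \<le> card Z1 + card Z2" by (rule card_Un_le)
  finally have "real (card {z. z < k * k \<and> 64 * D z < k * c}) \<le> 64 * k + 4 * k"
    using Z1 Z2 by linarith
  then show ?thesis by linarith
qed

end

section \<open>Random assignments and optimal matchings\<close>

text \<open>The value 0 outside the range lets an assignment be recovered exactly, as a function,
  from the \<open>n\<close> seeds that are broadcast.\<close>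

definition assignments :: "nat \<Rightarrow> nat \<Rightarrow> (nat \<Rightarrow> nat) set" where
  "assignments n Q = PiE_dflt {..<n} 0 (\<lambda>_. {..<Q})"

lemma assignments_iff: "\<zeta> \<in> assignments n Q \<longleftrightarrow> (\<forall>v<n. \<zeta> v < Q) \<and> (\<forall>v\<ge>n. \<zeta> v = 0)"
  by (auto simp: assignments_def PiE_dflt_def not_less)

lemma finite_assignments: "finite (assignments n Q)"
  unfolding assignments_def by (intro finite_PiE_dflt) auto

lemma assignments_nonempty: "Q > 0 \<Longrightarrow> assignments n Q \<noteq> {}"
  by (auto simp: assignments_def)

lemma card_assignments_pos: "Q > 0 \<Longrightarrow> card (assignments n Q) > 0"
  using assignments_nonempty finite_assignments by (simp add: card_gt_0_iff)

text \<open>Swapping the value at \<open>v\<close> with \<open>z\<close> is an involution on pairs,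
  so redrawing one coordinate preserves the uniform distribution.\<close>

lemma sum_assignments_resample:
  fixes f :: "(nat \<Rightarrow> nat) \<Rightarrow> real"
  assumes v: "v < n"
  shows "(\<Sum>\<zeta>\<in>assignments n Q. \<Sum>z<Q. f (\<zeta>(v := z))) = Q * (\<Sum>\<zeta>\<in>assignments n Q. f \<zeta>)"
proof -
  have "(\<Sum>\<zeta>\<in>assignments n Q. \<Sum>z<Q. f (\<zeta>(v := z)))
      = (\<Sum>(\<zeta>, z)\<in>assignments n Q \<times> {..<Q}. f (\<zeta>(v := z)))"
    by (simp add: sum.cartesian_product)
  also have "\<dots> = (\<Sum>(\<zeta>, z)\<in>assignments n Q \<times> {..<Q}. f \<zeta>)"
    by (rule sum.reindex_bij_witness[of _ "\<lambda>(\<zeta>, z). (\<zeta>(v := z), \<zeta> v)" "\<lambda>(\<zeta>, z). (\<zeta>(v := z), \<zeta> v)"])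
       (use v in \<open>auto simp: assignments_iff\<close>)
  also have "\<dots> = Q * (\<Sum>\<zeta>\<in>assignments n Q. f \<zeta>)"
    by (subst sum.cartesian_product[symmetric]) (simp add: sum_distrib_left)
  finally show ?thesis .
qed

text \<open>Conditioning on all coordinates except \<open>v\<close>: a bound valid for every choice
  of the others carries over to the average.\<close>

lemma card_assignments_resample:
  assumes v: "v < n" and fiber: "\<And>\<zeta>. \<zeta> \<in> assignments n Q \<Longrightarrow> card {z. z < Q \<and> bad (\<zeta>(v := z))} \<le> a"
  shows "Q * card {\<zeta> \<in> assignments n Q. bad \<zeta>} \<le> a * card (assignments n Q)"
proof -
  let ?f = "\<lambda>\<zeta>. if bad \<zeta> then 1 else 0 :: real"
  have "Q * real (card {\<zeta> \<in> assignments n Q. bad \<zeta>}) = Q * (\<Sum>\<zeta>\<in>assignments n Q. ?f \<zeta>)"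
    using finite_assignments[of n Q] by (simp add: sum.If_cases Int_def)
  also have "\<dots> = (\<Sum>\<zeta>\<in>assignments n Q. \<Sum>z<Q. ?f (\<zeta>(v := z)))"
    using sum_assignments_resample[OF v, where f = ?f and Q = Q] by simp
  also have "\<dots> = (\<Sum>\<zeta>\<in>assignments n Q. real (card {z. z < Q \<and> bad (\<zeta>(v := z))}))"
    by (simp add: sum.If_cases Int_def lessThan_def)
  also have "\<dots> \<le> (\<Sum>\<zeta>\<in>assignments n Q. real a)" using fiber by (intro sum_mono) auto
  finally have "real (Q * card {\<zeta> \<in> assignments n Q. bad \<zeta>}) \<le> real (a * card (assignments n Q))"
    by (simp add: mult.commute)
  then show ?thesis by (simp only: of_nat_le_iff)
qed

lemma card_assignments_collision:
  assumes u: "u < n" "u \<noteq> u'" "u' < n"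
  shows "Q * card {\<zeta> \<in> assignments n Q. \<zeta> u = \<zeta> u'} \<le> card (assignments n Q)"
proof -
  have "card {z. z < Q \<and> (\<zeta>(u := z)) u = (\<zeta>(u := z)) u'} \<le> 1" for \<zeta>
  proof -
    have "card {z. z < Q \<and> (\<zeta>(u := z)) u = (\<zeta>(u := z)) u'} \<le> card {\<zeta> u'}"
      using u by (intro card_mono) auto
    then show ?thesis by simp
  qed
  then show ?thesis using card_assignments_resample[OF u(1), where Q = Q and bad = "\<lambda>\<zeta>. \<zeta> u = \<zeta> u'" and a = 1] by simp
qed

section \<open>Optimal matchings and the gain of an added vertex\<close>

lemma simple_graph_finite: "simple_graph V E \<Longrightarrow> finite E"
  unfolding simple_graph_def by (rule finite_subset[of _ "Pow V"]) auto

lemma simple_graph_subset: "simple_graph V E \<Longrightarrow> F \<subseteq> E \<Longrightarrow> simple_graph V F"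
  by (auto simp: simple_graph_def)

text \<open>A fixed choice among the optimal matchings, so that a host computes the very matching
  which the analysis speaks of.\<close>

definition opt_matching :: "nat \<Rightarrow> nat set set \<Rightarrow> (nat \<Rightarrow> nat) \<Rightarrow> nat set set" where
  "opt_matching n F c =
     (SOME M. b_matching {..<n} F c M \<and> card M = max_b_matching_size {..<n} F c)"

lemma finite_card_b_matchings: "finite F \<Longrightarrow> finite (card ` {M. b_matching V F c M})"
  by (rule finite_imageI, rule finite_subset[of _ "Pow F"]) (auto simp: b_matching_def)

lemma card_le_max_b_matching_size:
  assumes "finite F" "b_matching V F c M"
  shows "card M \<le> max_b_matching_size V F c"
  unfolding max_b_matching_size_def using assms finite_card_b_matchings by (intro Max_ge) auto

lemma opt_matching:
  assumes "finite F"
  shows "b_matching {..<n} F c (opt_matching n F c)"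
    and "card (opt_matching n F c) = max_b_matching_size {..<n} F c"
proof -
  have "b_matching {..<n} F c {}" by (simp add: b_matching_def)
  then have "max_b_matching_size {..<n} F c \<in> card ` {M. b_matching {..<n} F c M}"
    unfolding max_b_matching_size_def
    by (intro Max_in finite_card_b_matchings[OF assms]) auto
  then have "\<exists>M. b_matching {..<n} F c M \<and> card M = max_b_matching_size {..<n} F c" by auto
  from someI_ex[OF this] show "b_matching {..<n} F c (opt_matching n F c)"
    and "card (opt_matching n F c) = max_b_matching_size {..<n} F c"
    unfolding opt_matching_def by auto
qed

lemma opt_matching_maximal:
  assumes "finite F" "b_matching {..<n} F c M"
  shows "card M \<le> card (opt_matching n F c)"
  using opt_matching(2)[OF assms(1)] card_le_max_b_matching_size[OF assms] by simp

lemma opt_matching_subset: "finite F \<Longrightarrow> opt_matching n F c \<subseteq> F"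
  using opt_matching(1) by (auto simp: b_matching_def)

lemma opt_matching_degree: "finite F \<Longrightarrow> v < n \<Longrightarrow> card {e \<in> opt_matching n F c. v \<in> e} \<le> c v"
  using opt_matching(1) by (auto simp: b_matching_def)

text \<open>Adding a vertex to a graph gains as many edges as it has unsaturated neighbours, and deleting
  it from an optimal matching loses only its own edges.\<close>

lemma opt_matching_gain:
  assumes F: "simple_graph {..<n} F" and v: "v < n" and cB: "card B \<le> c v"
    and B: "\<And>u. u \<in> B \<Longrightarrow> {u, v} \<in> F \<and> u \<noteq> v \<and> card {e \<in> opt_matching n {e \<in> F. v \<notin> e} c. u \<in> e} < c u"
  shows "card B \<le> card {e \<in> opt_matching n F c. v \<in> e}"
proof -
  define H where "H = {e \<in> F. v \<notin> e}"
  define M' where "M' = opt_matching n H c"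
  define M where "M = opt_matching n F c"
  define K where "K = (\<lambda>u. {u, v}) ` B"
  have fF: "finite F" using F by (rule simple_graph_finite)
  then have fH: "finite H" by (simp add: H_def)
  have M'H: "M' \<subseteq> H" unfolding M'_def using fH by (rule opt_matching_subset)
  have MF: "M \<subseteq> F" unfolding M_def using fF by (rule opt_matching_subset)
  have fM: "finite M" "finite M'" using MF fF M'H fH by (auto intro: finite_subset)
  have inj: "inj_on (\<lambda>u. {u, v}) B" by (auto simp: inj_on_def doubleton_eq_iff)
  have KF: "K \<subseteq> F" using B by (auto simp: K_def)
  have fK: "finite K" using KF fF by (rule finite_subset)
  have disj: "M' \<inter> K = {}" using M'H by (auto simp: K_def H_def)
  have "b_matching {..<n} F c (M' \<union> K)"
    unfolding b_matching_def
  proof (intro conjI ballI)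
    show "M' \<union> K \<subseteq> F" using M'H KF by (auto simp: H_def)
    fix x assume "x \<in> {..<n}"
    then have x: "x < n" by simp
    have dx: "card {e \<in> M'. x \<in> e} \<le> c x" unfolding M'_def by (rule opt_matching_degree[OF fH x])
    have "{e \<in> M' \<union> K. x \<in> e} = {e \<in> M'. x \<in> e} \<union> {e \<in> K. x \<in> e}" by auto
    then have eq: "card {e \<in> M' \<union> K. x \<in> e} \<le> card {e \<in> M'. x \<in> e} + card {e \<in> K. x \<in> e}"
      using card_Un_le by metis
    show "card {e \<in> M' \<union> K. x \<in> e} \<le> c x"
    proof (cases "x = v")
      case True
      have "{e \<in> M' \<union> K. x \<in> e} \<subseteq> K" using M'H True by (auto simp: H_def)
      then have "card {e \<in> M' \<union> K. x \<in> e} \<le> card K" using fK by (rule card_mono[rotated])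
      also have "\<dots> = card B" by (simp add: K_def card_image[OF inj])
      finally show ?thesis using cB True by simp
    next
      case False
      show ?thesis
      proof (cases "x \<in> B")
        case True
        have "card {e \<in> K. x \<in> e} \<le> card {{x, v}}"
          using False by (intro card_mono) (auto simp: K_def)
        then show ?thesis using eq B[OF True] by (simp add: M'_def H_def)
      next
        case nB: False
        have "{e \<in> K. x \<in> e} = {}" using False nB by (auto simp: K_def)
        then have "card {e \<in> K. x \<in> e} = 0" by (simp only: card.empty)
        then show ?thesis using eq dx by linarith
      qed
    qed
  qed
  then have "card (M' \<union> K) \<le> card M" unfolding M_def using fF by (intro opt_matching_maximal)
  then have 1: "card M' + card B \<le> card M"
    using disj fM fK by (simp add: card_Un_disjoint K_def card_image[OF inj])
  have "b_matching {..<n} H c {e \<in> M. v \<notin> e}"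
    unfolding b_matching_def
  proof (intro conjI ballI)
    show "{e \<in> M. v \<notin> e} \<subseteq> H" using MF by (auto simp: H_def)
    fix x assume "x \<in> {..<n}"
    then have "card {e \<in> M. x \<in> e} \<le> c x" unfolding M_def by (intro opt_matching_degree[OF fF]) simp
    moreover have "card {e \<in> {e \<in> M. v \<notin> e}. x \<in> e} \<le> card {e \<in> M. x \<in> e}"
      using fM by (intro card_mono) auto
    ultimately show "card {e \<in> {e \<in> M. v \<notin> e}. x \<in> e} \<le> c x" by simp
  qed
  then have 2: "card {e \<in> M. v \<notin> e} \<le> card M'" unfolding M'_def using fH by (intro opt_matching_maximal)
  have "M = {e \<in> M. v \<notin> e} \<union> {e \<in> M. v \<in> e}" by auto
  then have "card M = card {e \<in> M. v \<notin> e} + card {e \<in> M. v \<in> e}"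
    using fM by (subst card_Un_disjoint[symmetric]) auto
  with 1 2 show ?thesis by (simp add: M_def)
qed

section \<open>Matchings at the points of a random plane\<close>

text \<open>Edges whose ends chose the same line are dropped because they would occur at all
  \<open>k\<close> points of that line.\<close>

definition line_edges :: "nat set set \<Rightarrow> nat \<Rightarrow> (nat \<Rightarrow> nat) \<Rightarrow> nat \<Rightarrow> nat set set" where
  "line_edges F k \<zeta> p = {e \<in> F. (\<forall>v\<in>e. on_line k (\<zeta> v) p) \<and> inj_on \<zeta> e}"

text \<open>An overfull point contributes nothing; this is what secures the memory limit in every
  execution.\<close>

definition capped_matching :: "nat \<Rightarrow> nat \<Rightarrow> nat set set \<Rightarrow> (nat \<Rightarrow> nat) \<Rightarrow> nat set set" where
  "capped_matching n cap F c = (if card F \<le> cap then opt_matching n F c else {})"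

lemma capped_matching_subset: "finite F \<Longrightarrow> capped_matching n cap F c \<subseteq> F"
  by (simp add: capped_matching_def opt_matching_subset)

lemma capped_matching_degree: "finite F \<Longrightarrow> v < n \<Longrightarrow> card {e \<in> capped_matching n cap F c. v \<in> e} \<le> c v"
  by (simp add: capped_matching_def opt_matching_degree)

text \<open>With \<open>k * k\<close> points a point receives at most \<open>n\<close> edges on
  average, so few points exceed a capacity of 64 n. The bound 100 on \<open>k\<close> makes a single
  line at most 1/100 of the plane.\<close>

locale plane_graph =
  fixes n :: nat and F :: "nat set set" and c :: "nat \<Rightarrow> nat" and k cap :: nat
  assumes graph: "simple_graph {..<n} F" and oa: "\<exists>L. is_oa k L" and k100: "k \<ge> 100"
    and cap: "cap \<ge> 64 * n" and few: "card F \<le> n * (k * k)" and n0: "n > 0"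
begin

abbreviation "LE \<equiv> line_edges F k"
abbreviation "LM \<zeta> p \<equiv> capped_matching n cap (LE \<zeta> p) c"

definition nbr :: "nat \<Rightarrow> nat set" where "nbr v = {u. {u, v} \<in> F}"
text \<open>The part of the situation at \<open>p\<close> that is settled before \<open>v\<close>
  picks its line.\<close>

definition rest :: "nat \<Rightarrow> (nat \<Rightarrow> nat) \<Rightarrow> nat \<Rightarrow> nat set set" where
  "rest v \<zeta> p = {e \<in> LE \<zeta> p. v \<notin> e}"
definition free :: "nat \<Rightarrow> (nat \<Rightarrow> nat) \<Rightarrow> nat \<Rightarrow> nat set" where
  "free v \<zeta> p = {u \<in> nbr v. on_line k (\<zeta> u) p \<and> card {e \<in> opt_matching n (rest v \<zeta> p) c. u \<in> e} < c u}"
text \<open>Free neighbours cut down to the capacity of \<open>v\<close>. The margin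
  \<open>n\<close> covers all edges that \<open>v\<close> itself could bring, so the point is not
  overfull whichever line \<open>v\<close> picks.\<close>

definition cand :: "nat \<Rightarrow> (nat \<Rightarrow> nat) \<Rightarrow> nat \<Rightarrow> nat set" where
  "cand v \<zeta> p = (if card (rest v \<zeta> p) + n \<le> cap
     then (SOME B. B \<subseteq> free v \<zeta> p \<and> card B = min (c v) (card (free v \<zeta> p))) else {})"
definition ldeg :: "nat \<Rightarrow> (nat \<Rightarrow> nat) \<Rightarrow> nat" where
  "ldeg v \<zeta> = (\<Sum>p<k * k. card {e \<in> LM \<zeta> p. v \<in> e})"
definition total :: "nat \<Rightarrow> (nat \<Rightarrow> nat) \<Rightarrow> nat" where
  "total v \<zeta> = (\<Sum>p<k * k. card (cand v \<zeta> p))"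
text \<open>Neighbours on the same line meet at \<open>k\<close> points instead of at most one;
  these pairs spoil the even spread of the lines.\<close>

definition twins :: "nat \<Rightarrow> (nat \<Rightarrow> nat) \<Rightarrow> nat" where
  "twins v \<zeta> = card {(u, u'). u \<in> nbr v \<and> u' \<in> nbr v \<and> u \<noteq> u' \<and> \<zeta> u = \<zeta> u'}"

lemma k0: "k > 0" "k > 1" using k100 by auto

lemma finF: "finite F" using graph by (rule simple_graph_finite)

lemma edge: "e \<in> F \<Longrightarrow> e \<subseteq> {..<n}" "e \<in> F \<Longrightarrow> card e = 2"
  using graph by (auto simp: simple_graph_def)

lemma nbrD: "u \<in> nbr v \<Longrightarrow> u < n \<and> v < n \<and> u \<noteq> v"
  using edge[of "{u, v}"] by (auto simp: nbr_def)

lemma nbr_sub: "nbr v \<subseteq> {..<n} - {v}"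
  using nbrD by auto

lemma finite_nbr: "finite (nbr v)"
  by (rule finite_subset[OF nbr_sub]) simp

lemma edges_at: "{e \<in> F. v \<in> e} = (\<lambda>u. {u, v}) ` nbr v"
proof
  show "{e \<in> F. v \<in> e} \<subseteq> (\<lambda>u. {u, v}) ` nbr v"
  proof
    fix e assume e: "e \<in> {e \<in> F. v \<in> e}"
    then obtain x y where xy: "e = {x, y}" "x \<noteq> y" using edge(2) by (metis (no_types, lifting) card_2_iff mem_Collect_eq)
    then show "e \<in> (\<lambda>u. {u, v}) ` nbr v"
      using e unfolding nbr_def by (cases "v = x") (auto simp: insert_commute)
  qed
qed (auto simp: nbr_def)

lemma card_edges_at: "card {e \<in> F. v \<in> e} = card (nbr v)"
  unfolding edges_at by (rule card_image) (auto simp: inj_on_def doubleton_eq_iff)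

lemma card_nbr_le: "card (nbr v) \<le> n"
  using card_mono[OF _ nbr_sub[of v]] by (metis Diff_subset card_lessThan card_mono finite_Diff finite_lessThan le_trans)

lemma finite_LE: "finite (LE \<zeta> p)" using finF by (simp add: line_edges_def)

text \<open>The independence on which resampling the line of \<open>v\<close> rests;
  \<open>free\<close>, \<open>cand\<close> and \<open>total\<close> inherit it.\<close>

lemma rest_upd: "rest v (\<zeta>(v := z)) p = rest v \<zeta> p"
proof -
  have "(\<forall>u\<in>e. on_line k ((\<zeta>(v := z)) u) p) \<and> inj_on (\<zeta>(v := z)) e \<longleftrightarrow>
    (\<forall>u\<in>e. on_line k (\<zeta> u) p) \<and> inj_on \<zeta> e" if "v \<notin> e" for e
    using that by (auto simp: inj_on_def)
  then show ?thesis unfolding rest_def line_edges_def by blast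
qed

lemma free_upd: "free v (\<zeta>(v := z)) p = free v \<zeta> p"
  using nbrD by (auto simp: free_def rest_upd)

lemma cand_upd: "cand v (\<zeta>(v := z)) p = cand v \<zeta> p"
  by (simp add: cand_def rest_upd free_upd)

lemma total_upd: "total v (\<zeta>(v := z)) = total v \<zeta>"
  by (simp add: total_def cand_upd)

lemma finite_free: "finite (free v \<zeta> p)"
  using finite_nbr[of v] by (simp add: free_def)

lemma cand:
  assumes "card (rest v \<zeta> p) + n \<le> cap"
  shows "cand v \<zeta> p \<subseteq> free v \<zeta> p" "card (cand v \<zeta> p) = min (c v) (card (free v \<zeta> p))"
proof -
  have "\<exists>B. B \<subseteq> free v \<zeta> p \<and> card B = min (c v) (card (free v \<zeta> p))"
    by (meson min.cobounded2 obtain_subset_with_card_n)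
  from someI_ex[OF this] show "cand v \<zeta> p \<subseteq> free v \<zeta> p" "card (cand v \<zeta> p) = min (c v) (card (free v \<zeta> p))"
    using assms by (auto simp: cand_def)
qed

lemma cand_free: "cand v \<zeta> p \<subseteq> free v \<zeta> p"
  using cand(1)[of v \<zeta> p] by (cases "card (rest v \<zeta> p) + n \<le> cap") (auto simp: cand_def)

lemma finite_cand: "finite (cand v \<zeta> p)"
  using cand_free finite_free by (rule finite_subset)

lemma card_cand_le: "card (cand v \<zeta> p) \<le> c v"
  using cand(2)[of v \<zeta> p] by (cases "card (rest v \<zeta> p) + n \<le> cap") (auto simp: cand_def)

lemma card_LE_le: "card (LE \<zeta> p) \<le> card (rest v \<zeta> p) + n"
proof -
  have "LE \<zeta> p \<subseteq> rest v \<zeta> p \<union> {e \<in> F. v \<in> e}" by (auto simp: rest_def line_edges_def)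
  then have "card (LE \<zeta> p) \<le> card (rest v \<zeta> p \<union> {e \<in> F. v \<in> e})"
    using finF finite_LE by (intro card_mono) (auto simp: rest_def)
  also have "\<dots> \<le> card (rest v \<zeta> p) + card {e \<in> F. v \<in> e}" by (rule card_Un_le)
  finally show ?thesis using card_nbr_le[of v] by (simp add: card_edges_at)
qed

text \<open>The edges at \<open>p\<close> avoiding \<open>v\<close> are the same for every
  \<open>z\<close>, so the candidates are unsaturated in their optimal matching and
  \<open>opt_matching_gain\<close> applies. Candidates that chose \<open>z\<close> themselves are
  excluded, since \<open>line_edges\<close> does not join them to \<open>v\<close>.\<close>

lemma join_gain:
  assumes v: "v < n" and z: "on_line k z p"
  shows "card {u \<in> cand v \<zeta> p. \<zeta> u \<noteq> z} \<le> card {e \<in> LM (\<zeta>(v := z)) p. v \<in> e}"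
proof (cases "card (rest v \<zeta> p) + n \<le> cap")
  case False
  then show ?thesis by (simp add: cand_def)
next
  case True
  let ?\<zeta> = "\<zeta>(v := z)"
  let ?B = "{u \<in> cand v \<zeta> p. \<zeta> u \<noteq> z}"
  have "card (LE ?\<zeta> p) \<le> cap" using card_LE_le[of ?\<zeta> p v] True by (simp add: rest_upd)
  then have LM: "LM ?\<zeta> p = opt_matching n (LE ?\<zeta> p) c" by (simp add: capped_matching_def)
  have H: "{e \<in> LE ?\<zeta> p. v \<notin> e} = rest v \<zeta> p" using rest_upd[of v \<zeta> z p] by (simp add: rest_def)
  show ?thesis unfolding LM
  proof (rule opt_matching_gain)
    show "simple_graph {..<n} (LE ?\<zeta> p)"
      using graph by (rule simple_graph_subset) (auto simp: line_edges_def)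
    have "card ?B \<le> card (cand v \<zeta> p)" using finite_cand by (intro card_mono) auto
    then show "card ?B \<le> c v" using card_cand_le[of v \<zeta> p] by simp
    fix u assume u: "u \<in> ?B"
    then have uf: "u \<in> free v \<zeta> p" using cand_free by auto
    then have un: "u \<in> nbr v" by (simp add: free_def)
    show "{u, v} \<in> LE ?\<zeta> p \<and> u \<noteq> v \<and> card {e \<in> opt_matching n {e \<in> LE ?\<zeta> p. v \<notin> e} c. u \<in> e} < c u"
      unfolding H using uf u nbrD[OF un] z by (auto simp: free_def line_edges_def nbr_def)
  qed (rule v)
qed

text \<open>With all other lines fixed, \<open>total v\<close> is constant. If the average offer per
  point is at least c v / 16, then \<open>few_bad_lines\<close> applies to the sets
  \<open>cand v \<zeta> p\<close>.\<close>

lemma few_unlucky: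
  assumes v: "v < n" and c: "c v > 0"
  shows "card {z. z < k * k \<and> (16 * total v (\<zeta>(v := z)) \<ge> k * k * c v \<and> 64 * ldeg v (\<zeta>(v := z)) < k * c v)} \<le> 68 * k"
proof (cases "16 * total v \<zeta> \<ge> k * k * c v")
  case False
  then show ?thesis by (simp add: total_upd)
next
  case True
  have "card {z. z < k * k \<and> 64 * ldeg v (\<zeta>(v := z)) < k * c v} \<le> 68 * k"
  proof (rule few_bad_lines[OF oa k0(1) k0(2) c, of "cand v \<zeta>" \<zeta> "\<lambda>z. ldeg v (\<zeta>(v := z))"])
    show "k * k * c v \<le> 16 * (\<Sum>p<k * k. card (cand v \<zeta> p))" using True by (simp add: total_def)
    fix z
    have "(\<Sum>p | p < k * k \<and> on_line k z p. card {u \<in> cand v \<zeta> p. \<zeta> u \<noteq> z})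
      \<le> (\<Sum>p | p < k * k \<and> on_line k z p. card {e \<in> LM (\<zeta>(v := z)) p. v \<in> e})"
      by (intro sum_mono join_gain v) auto
    also have "\<dots> \<le> ldeg v (\<zeta>(v := z))" unfolding ldeg_def by (rule sum_mono2) auto
    finally show "(\<Sum>p | p < k * k \<and> on_line k z p. card {u \<in> cand v \<zeta> p. \<zeta> u \<noteq> z}) \<le> ldeg v (\<zeta>(v := z))" .
  qed (auto intro: finite_cand card_cand_le)
  then show ?thesis using True by (simp add: total_upd)
qed

lemma card_unlucky:
  assumes v: "v < n" and c: "c v > 0"
  shows "k * card {\<zeta> \<in> assignments n (k * k). 16 * total v \<zeta> \<ge> k * k * c v \<and> 64 * ldeg v \<zeta> < k * c v}
    \<le> 68 * card (assignments n (k * k))"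
proof -
  have "k * k * card {\<zeta> \<in> assignments n (k * k). 16 * total v \<zeta> \<ge> k * k * c v \<and> 64 * ldeg v \<zeta> < k * c v}
    \<le> 68 * k * card (assignments n (k * k))"
    using card_assignments_resample[OF v, where Q = "k * k" and a = "68 * k"
      and bad = "\<lambda>\<zeta>. 16 * total v \<zeta> \<ge> k * k * c v \<and> 64 * ldeg v \<zeta> < k * c v", OF few_unlucky[OF v c]] by simp
  then have "k * (k * card {\<zeta> \<in> assignments n (k * k). 16 * total v \<zeta> \<ge> k * k * c v \<and> 64 * ldeg v \<zeta> < k * c v})
    \<le> k * (68 * card (assignments n (k * k)))"
    by (simp only: mult_ac)
  then show ?thesis using k0 by (simp only: nat_mult_le_cancel1)
qed

text \<open>Linearity of expectation: two given neighbours choose the same of the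
  \<open>k * k\<close> lines with probability at most 1 / k ^ 2.\<close>

lemma sum_twins:
  "k * k * (\<Sum>\<zeta>\<in>assignments n (k * k). twins v \<zeta>) \<le> (card (nbr v))\<^sup>2 * card (assignments n (k * k))"
proof -
  define W where "W = {(u, u'). u \<in> nbr v \<and> u' \<in> nbr v \<and> u \<noteq> u'}"
  have fW: "finite W" and cW: "card W \<le> (card (nbr v))\<^sup>2"
  proof -
    have "W \<subseteq> nbr v \<times> nbr v" by (auto simp: W_def)
    then show "finite W" "card W \<le> (card (nbr v))\<^sup>2"
      using finite_nbr[of v] card_mono[of "nbr v \<times> nbr v" W]
      by (auto simp: card_cartesian_product power2_eq_square intro: finite_subset)
  qed
  have tw: "twins v \<zeta> = (\<Sum>(u, u')\<in>W. if \<zeta> u = \<zeta> u' then 1 else 0)" for \<zeta>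
  proof -
    have "{(u, u'). u \<in> nbr v \<and> u' \<in> nbr v \<and> u \<noteq> u' \<and> \<zeta> u = \<zeta> u'} = W \<inter> {(u, u'). \<zeta> u = \<zeta> u'}"
      by (auto simp: W_def)
    then show ?thesis using fW by (simp add: twins_def sum.If_cases case_prod_unfold)
  qed
  have "k * k * (\<Sum>\<zeta>\<in>assignments n (k * k). twins v \<zeta>)
    = (\<Sum>(u, u')\<in>W. k * k * (\<Sum>\<zeta>\<in>assignments n (k * k). if \<zeta> u = \<zeta> u' then 1 else 0))"
    unfolding tw by (subst sum.swap) (simp add: case_prod_unfold sum_distrib_left)
  also have "\<dots> \<le> (\<Sum>(u, u')\<in>W. card (assignments n (k * k)))"
  proof (rule sum_mono)
    fix w assume "w \<in> W"
    then obtain u u' where w: "w = (u, u')" "u < n" "u' < n" "u \<noteq> u'" using nbrD by (auto simp: W_def)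
    have "k * k * card {\<zeta> \<in> assignments n (k * k). \<zeta> u = \<zeta> u'} \<le> card (assignments n (k * k))"
      using w by (intro card_assignments_collision)
    then show "(case w of (u, u') \<Rightarrow> k * k * (\<Sum>\<zeta>\<in>assignments n (k * k). if \<zeta> u = \<zeta> u' then 1 else 0))
      \<le> (case w of (u, u') \<Rightarrow> card (assignments n (k * k)))"
      using w finite_assignments[of n "k * k"] by (simp add: sum.If_cases Int_def)
  qed
  also have "\<dots> = card W * card (assignments n (k * k))" by (simp add: case_prod_unfold)
  finally show ?thesis using mult_right_mono[OF cW, of "card (assignments n (k * k))"] by linarith
qed

text \<open>Markov's inequality applied to \<open>sum_twins\<close>.\<close>

lemma card_many_twins:
  "k * card {\<zeta> \<in> assignments n (k * k). 16 * k * r * twins v \<zeta> > (card (nbr v))\<^sup>2}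
    \<le> 16 * r * card (assignments n (k * k))"
proof (cases "card (nbr v) = 0")
  case True
  then have "nbr v = {}" using finite_nbr by simp
  then show ?thesis by (simp add: twins_def)
next
  case False
  let ?Z = "assignments n (k * k)"
  let ?T = "{\<zeta> \<in> ?Z. 16 * k * r * twins v \<zeta> > (card (nbr v))\<^sup>2}"
  have "card ?T * (card (nbr v))\<^sup>2 = (\<Sum>\<zeta>\<in>?T. (card (nbr v))\<^sup>2)" by simp
  also have "\<dots> \<le> (\<Sum>\<zeta>\<in>?T. 16 * k * r * twins v \<zeta>)" by (rule sum_mono) auto
  also have "\<dots> \<le> (\<Sum>\<zeta>\<in>?Z. 16 * k * r * twins v \<zeta>)"
    using finite_assignments by (intro sum_mono2) auto
  also have "\<dots> = 16 * k * r * (\<Sum>\<zeta>\<in>?Z. twins v \<zeta>)" by (simp add: sum_distrib_left)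
  finally have "k * (card ?T * (card (nbr v))\<^sup>2) \<le> k * (16 * k * r * (\<Sum>\<zeta>\<in>?Z. twins v \<zeta>))" by (rule mult_left_mono) simp
  also have "\<dots> = 16 * r * (k * k * (\<Sum>\<zeta>\<in>?Z. twins v \<zeta>))" by (simp add: mult_ac)
  also have "\<dots> \<le> 16 * r * ((card (nbr v))\<^sup>2 * card ?Z)" using sum_twins by (intro mult_left_mono) auto
  finally have "(card (nbr v))\<^sup>2 * (k * card ?T) \<le> (card (nbr v))\<^sup>2 * (16 * r * card ?Z)" by (simp add: mult_ac)
  then show ?thesis using False by simp
qed

end

lemma sum_card_swap:
  assumes "finite A" "finite B"
  shows "(\<Sum>a\<in>A. card {b \<in> B. R a b}) = (\<Sum>b\<in>B. card {a \<in> A. R a b})"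
proof -
  have "(\<Sum>a\<in>A. card {b \<in> B. R a b}) = (\<Sum>a\<in>A. \<Sum>b\<in>B. if R a b then 1 else 0)"
    using assms by (simp add: sum.If_cases Int_def)
  also have "\<dots> = (\<Sum>b\<in>B. \<Sum>a\<in>A. if R a b then 1 else 0)" by (rule sum.swap)
  also have "\<dots> = (\<Sum>b\<in>B. card {a \<in> A. R a b})" using assms by (simp add: sum.If_cases Int_def)
  finally show ?thesis .
qed

section \<open>Incidences between the chosen lines and the points\<close>

context plane_graph
begin

lemma card_points_edge:
  assumes \<zeta>: "\<zeta> \<in> assignments n (k * k)" and e: "e \<in> F"
  shows "card {p \<in> {..<k * k}. e \<in> LE \<zeta> p} \<le> 1"
proof -
  obtain x y where xy: "e = {x, y}" "x \<noteq> y" using edge(2)[OF e] by (auto simp: card_2_iff)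
  have lt: "\<zeta> x < k * k" "\<zeta> y < k * k" using edge(1)[OF e] \<zeta> xy by (auto simp: assignments_iff)
  show ?thesis
  proof (cases "\<zeta> x = \<zeta> y")
    case True
    then have "{p \<in> {..<k * k}. e \<in> LE \<zeta> p} = {}" using xy by (auto simp: line_edges_def inj_on_def)
    then show ?thesis by (simp only: card.empty)
  next
    case False
    have "card {p \<in> {..<k * k}. e \<in> LE \<zeta> p} \<le> card {p. p < k * k \<and> on_line k (\<zeta> x) p \<and> on_line k (\<zeta> y) p}"
      by (rule card_mono) (auto simp: line_edges_def xy)
    then show ?thesis using card_lines_inter[OF oa k0(1) lt False] by simp
  qed
qed

lemma sum_card_LE:
  assumes \<zeta>: "\<zeta> \<in> assignments n (k * k)"
  shows "(\<Sum>p<k * k. card (LE \<zeta> p)) \<le> card F"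
proof -
  have "(\<Sum>p<k * k. card (LE \<zeta> p)) = (\<Sum>p\<in>{..<k * k}. card {e \<in> F. e \<in> LE \<zeta> p})"
    by (intro sum.cong refl arg_cong[where f = card]) (auto simp: line_edges_def)
  also have "\<dots> = (\<Sum>e\<in>F. card {p \<in> {..<k * k}. e \<in> LE \<zeta> p})"
    by (rule sum_card_swap) (use finF in auto)
  also have "\<dots> \<le> (\<Sum>e\<in>F. 1)"
    by (intro sum_mono card_points_edge \<zeta>)
  finally show ?thesis by simp
qed

text \<open>Counts ordered pairs of vertices by their common points: distinct lines contribute at
  most one, while a vertex paired with itself or with a twin contributes \<open>k\<close>.\<close>

lemma sum_sq_incidences:
  assumes \<zeta>: "\<zeta> \<in> assignments n (k * k)" and U: "U \<subseteq> nbr v"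
  shows "(\<Sum>p<k * k. (card {u \<in> U. on_line k (\<zeta> u) p})\<^sup>2) \<le> (card U)\<^sup>2 + k * card U + k * twins v \<zeta>"
proof -
  have fU: "finite U" using U finite_nbr by (rule finite_subset)
  have lt: "\<zeta> u < k * k" if "u \<in> U" for u using that U nbrD \<zeta> by (auto simp: assignments_iff)
  define on where "on = (\<lambda>w p. on_line k (\<zeta> (fst w)) p \<and> on_line k (\<zeta> (snd w)) p)"
  have "(\<Sum>p<k * k. (card {u \<in> U. on_line k (\<zeta> u) p})\<^sup>2) = (\<Sum>p\<in>{..<k * k}. card {w \<in> U \<times> U. on w p})"
  proof (rule sum.cong)
    fix p
    have "{w \<in> U \<times> U. on w p} = {u \<in> U. on_line k (\<zeta> u) p} \<times> {u \<in> U. on_line k (\<zeta> u) p}"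
      by (auto simp: on_def)
    then show "(card {u \<in> U. on_line k (\<zeta> u) p})\<^sup>2 = card {w \<in> U \<times> U. on w p}"
      by (simp add: card_cartesian_product power2_eq_square)
  qed simp
  also have "\<dots> = (\<Sum>w\<in>U \<times> U. card {p \<in> {..<k * k}. on w p})"
    by (rule sum_card_swap) (use fU in auto)
  also have "\<dots> \<le> (\<Sum>w\<in>U \<times> U. 1 + (if fst w = snd w then k else 0)
      + (if fst w \<noteq> snd w \<and> \<zeta> (fst w) = \<zeta> (snd w) then k else 0))"
  proof (rule sum_mono)
    fix w assume w: "w \<in> U \<times> U"
    have lw: "\<zeta> (fst w) < k * k" "\<zeta> (snd w) < k * k" using w lt by auto
    show "card {p \<in> {..<k * k}. on w p} \<le> 1 + (if fst w = snd w then k else 0)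
      + (if fst w \<noteq> snd w \<and> \<zeta> (fst w) = \<zeta> (snd w) then k else 0)"
    proof (cases "\<zeta> (fst w) = \<zeta> (snd w)")
      case True
      have "{p \<in> {..<k * k}. on w p} = {p. p < k * k \<and> on_line k (\<zeta> (fst w)) p}"
        using True by (auto simp: on_def)
      then have "card {p \<in> {..<k * k}. on w p} = k" using card_line[OF oa k0(1) lw(1)] by simp
      then show ?thesis using True by auto
    next
      case False
      have "{p \<in> {..<k * k}. on w p} = {p. p < k * k \<and> on_line k (\<zeta> (fst w)) p \<and> on_line k (\<zeta> (snd w)) p}"
        by (auto simp: on_def)
      then have "card {p \<in> {..<k * k}. on w p} \<le> 1"
        using card_lines_inter[OF oa k0(1) lw False] by (simp only:)
      then show ?thesis by simp
    qed
  qed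
  also have "\<dots> = card (U \<times> U) + k * card {w \<in> U \<times> U. fst w = snd w}
      + k * card {w \<in> U \<times> U. fst w \<noteq> snd w \<and> \<zeta> (fst w) = \<zeta> (snd w)}"
  proof -
    have "(\<Sum>w\<in>U \<times> U. if fst w = snd w then k else 0) = k * card {w \<in> U \<times> U. fst w = snd w}"
      using fU by (simp add: sum.If_cases Int_def)
    moreover have "(\<Sum>w\<in>U \<times> U. if fst w \<noteq> snd w \<and> \<zeta> (fst w) = \<zeta> (snd w) then k else 0)
        = k * card {w \<in> U \<times> U. fst w \<noteq> snd w \<and> \<zeta> (fst w) = \<zeta> (snd w)}"
      using fU by (simp add: sum.If_cases Int_def)
    moreover have "(\<Sum>w\<in>U \<times> U. 1) = card (U \<times> U)" by simp
    ultimately show ?thesis by (simp only: sum.distrib)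
  qed
  also have "\<dots> \<le> (card U)\<^sup>2 + k * card U + k * twins v \<zeta>"
  proof -
    have "{w \<in> U \<times> U. fst w = snd w} = (\<lambda>u. (u, u)) ` U" by auto
    then have 1: "card {w \<in> U \<times> U. fst w = snd w} \<le> card U" using card_image_le[OF fU] by metis
    have "finite {(u, u'). u \<in> nbr v \<and> u' \<in> nbr v \<and> u \<noteq> u' \<and> \<zeta> u = \<zeta> u'}"
      by (rule finite_subset[of _ "nbr v \<times> nbr v"]) (use finite_nbr in auto)
    then have 2: "card {w \<in> U \<times> U. fst w \<noteq> snd w \<and> \<zeta> (fst w) = \<zeta> (snd w)} \<le> twins v \<zeta>"
      unfolding twins_def by (rule card_mono) (use U in auto)
    show ?thesis using 1 2 by (simp add: card_cartesian_product power2_eq_square add_mono)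
  qed
  finally show ?thesis .
qed

text \<open>If \<open>v\<close> gains little, then few points offer it a free neighbour; but neighbours that are rarely
  saturated are free at most points of their lines, and lines spread over the whole plane.\<close>

lemma incidence_bound:
  assumes \<zeta>: "\<zeta> \<in> assignments n (k * k)" and v: "v < n" and c: "c v > 0" and U: "U \<subseteq> nbr v"
    and sat: "\<And>u. u \<in> U \<Longrightarrow>
      64 * card {p. p < k * k \<and> on_line k (\<zeta> u) p \<and> c u \<le> card {e \<in> LM \<zeta> p. u \<in> e}} \<le> k"
    and tot: "16 * total v \<zeta> < k * k * c v"
    and tw: "16 * k * (\<rho> * \<rho>) * twins v \<zeta> \<le> (card (nbr v))\<^sup>2"
    and big: "card (nbr v) \<le> card U * \<rho>" and \<rho>: "\<rho> > 0"
  shows "card U \<le> 16 * k * c v"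
proof (rule ccontr)
  assume "\<not> card U \<le> 16 * k * c v"
  then have cU: "card U > 16 * k * c v" by simp
  define P where "P = {..<k * k}"
  \<comment> \<open>\<open>Q\<close> gathers the exceptional points: those offering \<open>v\<close>
    at least half of its capacity, the possibly overfull ones, and those on the line of
    \<open>v\<close>. They are at most a fifth of the plane, as 1/8 + 1/63 + 1/100 < 1/5.\<close>
  define Q1 where "Q1 = {p \<in> P. c v \<le> 2 * card (cand v \<zeta> p)}"
  define Q2 where "Q2 = {p \<in> P. card (rest v \<zeta> p) + n > cap}"
  define Q3 where "Q3 = {p \<in> P. on_line k (\<zeta> v) p}"
  define Q where "Q = Q1 \<union> Q2 \<union> Q3"
  define N where "N p = card {u \<in> U. on_line k (\<zeta> u) p}" for p
  define s where "s u p \<longleftrightarrow> c u \<le> card {e \<in> LM \<zeta> p. u \<in> e}" for u p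
  have fP: "finite P" by (simp add: P_def)
  have fQ: "finite Q" "Q \<subseteq> P" using fP by (auto simp: Q_def Q1_def Q2_def Q3_def)
  have fU: "finite U" using U finite_nbr by (rule finite_subset)
  have lt: "\<zeta> u < k * k" if "u \<in> U" for u using that U nbrD \<zeta> by (auto simp: assignments_iff)
  have k1: "real k \<ge> 100" using k100 by simp
  have q1: "8 * card Q1 \<le> k * k"
  proof -
    have "card Q1 * c v = (\<Sum>p\<in>Q1. c v)" by simp
    also have "\<dots> \<le> (\<Sum>p\<in>Q1. 2 * card (cand v \<zeta> p))" by (rule sum_mono) (auto simp: Q1_def)
    also have "\<dots> \<le> (\<Sum>p\<in>P. 2 * card (cand v \<zeta> p))" by (rule sum_mono2) (auto simp: Q1_def P_def)
    also have "\<dots> = 2 * total v \<zeta>" by (simp add: total_def P_def sum_distrib_left)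
    finally have "8 * (card Q1 * c v) \<le> k * k * c v" using tot by linarith
    then have "c v * (8 * card Q1) \<le> c v * (k * k)" by (simp only: mult_ac)
    then show ?thesis using c by (simp only: nat_mult_le_cancel1)
  qed
  have q2: "63 * card Q2 \<le> k * k"
  proof -
    have "card Q2 * (63 * n) = (\<Sum>p\<in>Q2. 63 * n)" by simp
    also have "\<dots> \<le> (\<Sum>p\<in>Q2. card (LE \<zeta> p))"
    proof (rule sum_mono)
      fix p assume "p \<in> Q2"
      then have "63 * n \<le> card (rest v \<zeta> p)" using cap by (auto simp: Q2_def)
      also have "\<dots> \<le> card (LE \<zeta> p)" by (rule card_mono) (auto simp: rest_def finite_LE)
      finally show "63 * n \<le> card (LE \<zeta> p)" .
    qed
    also have "\<dots> \<le> (\<Sum>p<k * k. card (LE \<zeta> p))" by (rule sum_mono2) (auto simp: Q2_def P_def)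
    also have "\<dots> \<le> n * (k * k)" using sum_card_LE[OF \<zeta>] few by simp
    finally have "n * (63 * card Q2) \<le> n * (k * k)" by (simp add: mult_ac)
    then show ?thesis using n0 by (simp only: nat_mult_le_cancel1)
  qed
  have q3: "card Q3 = k"
  proof -
    have "\<zeta> v < k * k" using v \<zeta> by (auto simp: assignments_iff)
    from card_line[OF oa k0(1) this] show ?thesis by (simp add: Q3_def P_def)
  qed
  have Qcard: "5 * real (card Q) \<le> real k * real k"
  proof -
    have "card Q \<le> card Q1 + card Q2 + card Q3"
      unfolding Q_def by (meson add_mono_thms_linordered_semiring(3) card_Un_le le_trans)
    moreover have "8 * real (card Q1) \<le> real k * real k" using q1 by (metis of_nat_le_iff of_nat_mult of_nat_numeral)
    moreover have "63 * real (card Q2) \<le> real k * real k" using q2 by (metis of_nat_le_iff of_nat_mult of_nat_numeral)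
    moreover have "100 * real k \<le> real k * real k" using k1 by (intro mult_right_mono) auto
    ultimately show ?thesis using q3 by linarith
  qed
  \<comment> \<open>Fewer than c v / 2 candidates means that \<open>cand\<close> was not truncated
    and contains all free neighbours; and since \<open>v\<close> misses \<open>p\<close>, the
    matching actually computed at \<open>p\<close> is the one without \<open>v\<close>.\<close>
  have offQ: "2 * card {u \<in> U. on_line k (\<zeta> u) p \<and> \<not> s u p} \<le> c v" if p: "p \<in> P - Q" for p
  proof -
    have noline: "\<not> on_line k (\<zeta> v) p" and room: "card (rest v \<zeta> p) + n \<le> cap"
      and small: "2 * card (cand v \<zeta> p) < c v"
      using p by (auto simp: Q_def Q1_def Q2_def Q3_def)
    have LEr: "LE \<zeta> p = rest v \<zeta> p" using noline by (auto simp: rest_def line_edges_def)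
    then have LM: "LM \<zeta> p = opt_matching n (rest v \<zeta> p) c" using room by (simp add: capped_matching_def)
    have "{u \<in> U. on_line k (\<zeta> u) p \<and> \<not> s u p} \<subseteq> free v \<zeta> p"
      using U by (auto simp: s_def LM free_def)
    then have "card {u \<in> U. on_line k (\<zeta> u) p \<and> \<not> s u p} \<le> card (free v \<zeta> p)"
      by (rule card_mono[OF finite_free])
    then show ?thesis using cand(2)[OF room] small by linarith
  qed
  \<comment> \<open>Each of the k |U| incidences of a vertex with a point of its line is saturated,
    or lies on \<open>Q\<close>, or is unsaturated and off \<open>Q\<close>.\<close>
  have main: "k * card U \<le> (\<Sum>u\<in>U. card {p \<in> P. on_line k (\<zeta> u) p \<and> s u p}) + (\<Sum>p\<in>Q. N p)
      + (\<Sum>p\<in>P - Q. card {u \<in> U. on_line k (\<zeta> u) p \<and> \<not> s u p})"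
  proof -
    have "k * card U = (\<Sum>u\<in>U. card {p \<in> P. on_line k (\<zeta> u) p})"
      using card_line[OF oa k0(1) lt] by (simp add: P_def)
    also have "\<dots> \<le> (\<Sum>u\<in>U. card {p \<in> P. on_line k (\<zeta> u) p \<and> s u p} + card {p \<in> Q. on_line k (\<zeta> u) p}
        + card {p \<in> P - Q. on_line k (\<zeta> u) p \<and> \<not> s u p})"
    proof (rule sum_mono)
      fix u
      let ?a = "{p \<in> P. on_line k (\<zeta> u) p \<and> s u p}" and ?b = "{p \<in> Q. on_line k (\<zeta> u) p}"
        and ?d = "{p \<in> P - Q. on_line k (\<zeta> u) p \<and> \<not> s u p}"
      have "card {p \<in> P. on_line k (\<zeta> u) p} \<le> card (?a \<union> ?b \<union> ?d)"
        using fP fQ by (intro card_mono) auto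
      also have "\<dots> \<le> card ?a + card ?b + card ?d"
        by (meson add_mono_thms_linordered_semiring(3) card_Un_le le_trans)
      finally show "card {p \<in> P. on_line k (\<zeta> u) p} \<le> card ?a + card ?b + card ?d" .
    qed
    also have "\<dots> = (\<Sum>u\<in>U. card {p \<in> P. on_line k (\<zeta> u) p \<and> s u p})
        + (\<Sum>u\<in>U. card {p \<in> Q. on_line k (\<zeta> u) p}) + (\<Sum>u\<in>U. card {p \<in> P - Q. on_line k (\<zeta> u) p \<and> \<not> s u p})"
      by (simp only: sum.distrib)
    also have "(\<Sum>u\<in>U. card {p \<in> Q. on_line k (\<zeta> u) p}) = (\<Sum>p\<in>Q. N p)"
      unfolding N_def by (rule sum_card_swap) (use fU fQ in auto)
    also have "(\<Sum>u\<in>U. card {p \<in> P - Q. on_line k (\<zeta> u) p \<and> \<not> s u p})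
        = (\<Sum>p\<in>P - Q. card {u \<in> U. on_line k (\<zeta> u) p \<and> \<not> s u p})"
      by (rule sum_card_swap) (use fU fP in auto)
    finally show ?thesis .
  qed
  have m1: "64 * (\<Sum>u\<in>U. card {p \<in> P. on_line k (\<zeta> u) p \<and> s u p}) \<le> k * card U"
  proof -
    have "64 * (\<Sum>u\<in>U. card {p \<in> P. on_line k (\<zeta> u) p \<and> s u p})
        = (\<Sum>u\<in>U. 64 * card {p \<in> P. on_line k (\<zeta> u) p \<and> s u p})" by (rule sum_distrib_left)
    also have "\<dots> \<le> (\<Sum>u\<in>U. k)" using sat by (intro sum_mono) (auto simp: P_def s_def)
    finally show ?thesis by (simp add: mult.commute)
  qed
  have m3: "32 * (\<Sum>p\<in>P - Q. card {u \<in> U. on_line k (\<zeta> u) p \<and> \<not> s u p}) \<le> k * card U"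
  proof -
    have "32 * (\<Sum>p\<in>P - Q. card {u \<in> U. on_line k (\<zeta> u) p \<and> \<not> s u p})
        = (\<Sum>p\<in>P - Q. 16 * (2 * card {u \<in> U. on_line k (\<zeta> u) p \<and> \<not> s u p}))"
      by (simp add: sum_distrib_left)
    also have "\<dots> \<le> (\<Sum>p\<in>P - Q. 16 * c v)" using offQ by (intro sum_mono mult_left_mono) auto
    also have "\<dots> \<le> (\<Sum>p\<in>P. 16 * c v)" using fP by (intro sum_mono2) auto
    also have "\<dots> = k * (16 * k * c v)" by (simp add: P_def)
    also have "\<dots> \<le> k * card U" using cU by (intro mult_left_mono) auto
    finally show ?thesis .
  qed
  define x where "x = real k * real (card U)"
  have xpos: "x > 0" using k0 cU by (simp add: x_def)
  \<comment> \<open>Saturated incidences make up at most 1/64, unsaturated ones off \<open>Q\<close>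
    at most 1/32; so at least 61/64 of all incidences fall on \<open>Q\<close>.\<close>
  have S: "61 * x \<le> 64 * real (\<Sum>p\<in>Q. N p)"
  proof -
    have "64 * (k * card U) \<le> k * card U + 64 * (\<Sum>p\<in>Q. N p) + 2 * (k * card U)"
      using main m1 m3 by linarith
    then have "61 * (k * card U) \<le> 64 * (\<Sum>p\<in>Q. N p)" by linarith
    then have "real (61 * (k * card U)) \<le> real (64 * (\<Sum>p\<in>Q. N p))" by (simp only: of_nat_le_iff)
    then show ?thesis by (simp add: x_def)
  qed
  have sq: "8 * (\<Sum>p<k * k. (N p)\<^sup>2) \<le> 9 * (card U)\<^sup>2"
  proof -
    have "16 * (k * card U) \<le> card U * card U"
    proof -
      have "16 * k \<le> 16 * k * c v" using c by simp
      then have "16 * k \<le> card U" using cU by linarith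
      then show ?thesis using mult_right_mono[of "16 * k" "card U" "card U"] by simp
    qed
    moreover have "16 * (k * twins v \<zeta>) \<le> card U * card U"
    proof -
      have "\<rho> * \<rho> * (16 * (k * twins v \<zeta>)) \<le> (card (nbr v))\<^sup>2" using tw by (simp add: mult_ac)
      also have "\<dots> \<le> (card U * \<rho>)\<^sup>2" using big by (intro power_mono) auto
      also have "\<dots> = \<rho> * \<rho> * (card U * card U)" by (simp add: power2_eq_square mult_ac)
      finally show ?thesis using \<rho> by simp
    qed
    ultimately show ?thesis
      using sum_sq_incidences[OF \<zeta> U] unfolding N_def power2_eq_square by linarith
  qed
  \<comment> \<open>Cauchy-Schwarz: with |Q| at most k ^ 2 / 5 and second moment at most 9/8 |U| ^
    2, at most the fraction sqrt (9/40) of the incidences can fall on \<open>Q\<close>, and this is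
    less than 61/64.\<close>
  have "(real (\<Sum>p\<in>Q. N p))\<^sup>2 \<le> (\<Sum>p\<in>Q. (real (N p))\<^sup>2) * real (card Q)"
    using sum_squared_le_sum_of_squares[where I = Q and f = "\<lambda>p. real (N p)"] by simp
  also have "\<dots> \<le> (\<Sum>p<k * k. (real (N p))\<^sup>2) * real (card Q)"
    using fQ by (intro mult_right_mono sum_mono2) (auto simp: P_def)
  finally have "40 * (real (\<Sum>p\<in>Q. N p))\<^sup>2 \<le> (8 * (\<Sum>p<k * k. (real (N p))\<^sup>2)) * (5 * real (card Q))" by simp
  also have "\<dots> \<le> (9 * (real (card U))\<^sup>2) * (real k * real k)"
  proof (rule mult_mono)
    have "real (8 * (\<Sum>p<k * k. (N p)\<^sup>2)) \<le> real (9 * (card U)\<^sup>2)" using sq by (simp only: of_nat_le_iff)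
    then show "8 * (\<Sum>p<k * k. (real (N p))\<^sup>2) \<le> 9 * (real (card U))\<^sup>2" by simp
  qed (use Qcard in auto)
  also have "\<dots> = 9 * x\<^sup>2" by (simp add: x_def power2_eq_square)
  finally have up: "40 * (real (\<Sum>p\<in>Q. N p))\<^sup>2 \<le> 9 * x\<^sup>2" .
  have "(61 * x)\<^sup>2 \<le> (64 * real (\<Sum>p\<in>Q. N p))\<^sup>2" using S xpos by (intro power_mono) auto
  then have "3721 * x\<^sup>2 \<le> 4096 * (real (\<Sum>p\<in>Q. N p))\<^sup>2" by (simp only: power_mult_distrib) simp
  with up have "40 * 3721 * x\<^sup>2 \<le> 4096 * 9 * x\<^sup>2" by linarith
  then have "x\<^sup>2 \<le> 0" by simp
  with xpos show False by simp
qed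

lemma card_sat_points:
  assumes c: "c u > 0" and low: "64 * ldeg u \<zeta> < k * c u"
  shows "64 * card {p. p < k * k \<and> on_line k (\<zeta> u) p \<and> c u \<le> card {e \<in> LM \<zeta> p. u \<in> e}} \<le> k"
proof -
  let ?T = "{p. p < k * k \<and> on_line k (\<zeta> u) p \<and> c u \<le> card {e \<in> LM \<zeta> p. u \<in> e}}"
  have "card ?T * c u = (\<Sum>p\<in>?T. c u)" by simp
  also have "\<dots> \<le> (\<Sum>p\<in>?T. card {e \<in> LM \<zeta> p. u \<in> e})" by (rule sum_mono) auto
  also have "\<dots> \<le> ldeg u \<zeta>" unfolding ldeg_def by (rule sum_mono2) auto
  finally have "64 * (card ?T * c u) \<le> k * c u" using low by linarith
  then have "c u * (64 * card ?T) \<le> c u * k" by (simp only: mult_ac)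
  then show ?thesis using c by (simp only: nat_mult_le_cancel1)
qed

text \<open>No edge occurs at two points, so summing over the points counts distinct edges.\<close>

lemma ldeg_le:
  assumes \<zeta>: "\<zeta> \<in> assignments n (k * k)"
  shows "ldeg v \<zeta> \<le> card {e \<in> F. v \<in> e \<and> (\<exists>p<k * k. e \<in> LM \<zeta> p)}"
proof -
  have LMF: "LM \<zeta> p \<subseteq> LE \<zeta> p" for p by (rule capped_matching_subset[OF finite_LE])
  have LEF: "LE \<zeta> p \<subseteq> F" for p by (auto simp: line_edges_def)
  let ?G = "{e \<in> F. v \<in> e}"
  have "ldeg v \<zeta> = (\<Sum>p\<in>{..<k * k}. card {e \<in> ?G. e \<in> LM \<zeta> p})"
    unfolding ldeg_def by (intro sum.cong refl arg_cong[where f = card]) (use LMF LEF in blast)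
  also have "\<dots> = (\<Sum>e\<in>?G. card {p \<in> {..<k * k}. e \<in> LM \<zeta> p})"
    by (rule sum_card_swap) (use finF in auto)
  also have "\<dots> \<le> (\<Sum>e\<in>?G. if \<exists>p<k * k. e \<in> LM \<zeta> p then 1 else 0)"
  proof (rule sum_mono)
    fix e assume e: "e \<in> ?G"
    show "card {p \<in> {..<k * k}. e \<in> LM \<zeta> p} \<le> (if \<exists>p<k * k. e \<in> LM \<zeta> p then 1 else 0)"
    proof (cases "\<exists>p<k * k. e \<in> LM \<zeta> p")
      case True
      have "card {p \<in> {..<k * k}. e \<in> LM \<zeta> p} \<le> card {p \<in> {..<k * k}. e \<in> LE \<zeta> p}"
        using LMF by (intro card_mono) auto
      then show ?thesis using card_points_edge[OF \<zeta>, of e] e True by simp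
    next
      case False
      then have "{p \<in> {..<k * k}. e \<in> LM \<zeta> p} = {}" by auto
      then show ?thesis by (simp only: card.empty)
    qed
  qed
  also have "\<dots> = card (?G \<inter> {e. \<exists>p<k * k. e \<in> LM \<zeta> p})"
    using finF by (simp add: sum.If_cases)
  also have "?G \<inter> {e. \<exists>p<k * k. e \<in> LM \<zeta> p} = {e \<in> F. v \<in> e \<and> (\<exists>p<k * k. e \<in> LM \<zeta> p)}" by auto
  finally show ?thesis .
qed

end

section \<open>One stage\<close>

definition wload :: "nat set set \<Rightarrow> (nat set \<Rightarrow> nat) \<Rightarrow> nat \<Rightarrow> nat" where
  "wload E W v = (\<Sum>e | e \<in> E \<and> v \<in> e. W e)"

text \<open>Weights are integers in units of 1 / n: \<open>n\<close> stands for the value 1 and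
  \<open>n * \<beta> v\<close> for the full budget of \<open>v\<close>. This keeps them
  words.\<close>

definition active :: "nat \<Rightarrow> (nat \<Rightarrow> nat) \<Rightarrow> (nat \<Rightarrow> nat) \<Rightarrow> nat \<Rightarrow> nat set \<Rightarrow> bool" where
  "active n \<Lambda> \<beta> x e \<longleftrightarrow> x < n \<and> (\<forall>v\<in>e. 16 * \<Lambda> v < n * \<beta> v)"

definition act :: "nat \<Rightarrow> nat set set \<Rightarrow> (nat \<Rightarrow> nat) \<Rightarrow> (nat set \<Rightarrow> nat) \<Rightarrow> nat set set" where
  "act n E \<beta> W = {e \<in> E. active n (wload E W) \<beta> (W e) e}"

text \<open>For \<open>k = 1\<close> there is one line and one point. The exemption sends every edge
  to that point, which makes the last stage an exact computation.\<close>

definition at_point :: "nat \<Rightarrow> nat \<Rightarrow> (nat \<Rightarrow> nat) \<Rightarrow> (nat \<Rightarrow> nat) \<Rightarrow> nat \<Rightarrow> nat set \<Rightarrow> bool" where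
  "at_point k s \<beta> \<zeta> p e \<longleftrightarrow> (\<forall>v\<in>e. s \<le> \<beta> v \<and> on_line k (\<zeta> v) p) \<and> (k = 1 \<or> inj_on \<zeta> e)"

definition deg :: "nat set set \<Rightarrow> (nat \<Rightarrow> nat) \<Rightarrow> nat \<Rightarrow> nat \<Rightarrow> nat" where
  "deg A \<beta> s v = card {e \<in> A. v \<in> e \<and> (\<forall>u\<in>e. s \<le> \<beta> u)}"

text \<open>The phases stop at exponent 16, where the target is n 2 ^ (16 * 16) active edges; in the
  last stage all of these have to fit at one point.\<close>

definition cap :: "nat \<Rightarrow> nat" where "cap n = 2 ^ 256 * n"

definition point_edges :: "nat set set \<Rightarrow> (nat \<Rightarrow> nat) \<Rightarrow> nat \<Rightarrow> nat \<Rightarrow> (nat \<Rightarrow> nat) \<Rightarrow> nat \<Rightarrow> nat set set" where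
  "point_edges A \<beta> k s \<zeta> p = {e \<in> A. at_point k s \<beta> \<zeta> p e}"

definition point_matching :: "nat \<Rightarrow> nat set set \<Rightarrow> (nat \<Rightarrow> nat) \<Rightarrow> nat \<Rightarrow> nat \<Rightarrow> (nat \<Rightarrow> nat) \<Rightarrow> nat \<Rightarrow> nat set set" where
  "point_matching n A \<beta> k s \<zeta> p = capped_matching n (cap n) (point_edges A \<beta> k s \<zeta> p) (\<lambda>v. \<beta> v div s)"

text \<open>Edges passing this test can all be completed at once: since degrees are at most 16
  \<beta> u, the load of \<open>u\<close> grows by at most 16 n \<beta> u.\<close>

definition finished :: "(nat \<Rightarrow> nat) \<Rightarrow> (nat \<Rightarrow> nat) \<Rightarrow> nat \<Rightarrow> nat set \<Rightarrow> bool" where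
  "finished d \<beta> k e \<longleftrightarrow> (\<forall>u\<in>e. k \<le> \<beta> u \<and> d u \<le> 16 * \<beta> u)"

text \<open>A vertex has at most k (\<beta> v div s) matched edges, so this weight adds at most 16 n
  \<beta> v to its load.\<close>

definition weight :: "nat \<Rightarrow> nat \<Rightarrow> nat \<Rightarrow> nat" where "weight n k s = 16 * n * s div k"

text \<open>The finishing test reads the degrees at the start of the stage, so it exploits the
  reduction achieved by the stage before.\<close>

definition stage :: "nat \<Rightarrow> nat set set \<Rightarrow> (nat \<Rightarrow> nat) \<Rightarrow> nat \<Rightarrow> nat \<Rightarrow> (nat set \<Rightarrow> nat) \<Rightarrow> (nat \<Rightarrow> nat) \<Rightarrow> nat set \<Rightarrow> nat" where
  "stage n E \<beta> k s W \<zeta> e = W e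
     + (if e \<in> act n E \<beta> W \<and> finished (deg (act n E \<beta> W) \<beta> k) \<beta> k e then n else 0)
     + (if \<exists>p<k * k. e \<in> point_matching n (act n E \<beta> W) \<beta> k s \<zeta> p then weight n k s else 0)"

text \<open>The threshold is the bound of \<open>incidence_bound\<close> for the capacities
  \<open>\<beta> v div s\<close>.\<close>

definition heavy :: "nat \<Rightarrow> nat set set \<Rightarrow> (nat \<Rightarrow> nat) \<Rightarrow> nat \<Rightarrow> nat \<Rightarrow> nat" where
  "heavy n A \<beta> k s = (\<Sum>v | v < n \<and> 16 * k * (\<beta> v div s) < deg A \<beta> s v. deg A \<beta> s v)"

locale bgraph =
  fixes n :: nat and E :: "nat set set" and \<beta> :: "nat \<Rightarrow> nat"
  assumes n0: "n > 0" and graph: "simple_graph {..<n} E" and \<beta>0: "\<And>v. v < n \<Longrightarrow> \<beta> v > 0"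
begin

abbreviation "ld \<equiv> wload E"
abbreviation "ac \<equiv> act n E \<beta>"
abbreviation "stg \<equiv> stage n E \<beta>"

lemma finE: "finite E" using graph by (rule simple_graph_finite)

lemma ac_sub: "ac W \<subseteq> E" by (auto simp: act_def)

lemma fin_ac: "finite (ac W)" using ac_sub finE by (rule finite_subset)

lemma edgeE: "e \<in> E \<Longrightarrow> e \<subseteq> {..<n}" "e \<in> E \<Longrightarrow> card e = 2"
  using graph by (auto simp: simple_graph_def)

lemma fin_point: "finite (point_edges (ac W) \<beta> k s \<zeta> p)"
  using fin_ac by (simp add: point_edges_def)

lemma pm_sub: "point_matching n (ac W) \<beta> k s \<zeta> p \<subseteq> point_edges (ac W) \<beta> k s \<zeta> p"
  unfolding point_matching_def by (rule capped_matching_subset[OF fin_point])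

lemma pm_ac: "e \<in> point_matching n (ac W) \<beta> k s \<zeta> p \<Longrightarrow> e \<in> ac W \<and> at_point k s \<beta> \<zeta> p e"
  using pm_sub by (fastforce simp: point_edges_def)

lemma stage_ge: "W e \<le> stg k s W \<zeta> e" by (simp add: stage_def)

lemma stage_inactive: "e \<notin> ac W \<Longrightarrow> stg k s W \<zeta> e = W e"
  using pm_ac by (auto simp: stage_def)

lemma wload_mono: "(\<And>e. W e \<le> Y e) \<Longrightarrow> ld W v \<le> ld Y v"
  unfolding wload_def by (intro sum_mono)

lemma ac_mono:
  assumes "\<And>e. W e \<le> Y e" shows "ac Y \<subseteq> ac W"
proof
  fix e assume e: "e \<in> ac Y"
  have "16 * ld W v < n * \<beta> v" if "v \<in> e" for v
    using e that wload_mono[of W Y v] assms by (fastforce simp: act_def active_def)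
  then show "e \<in> ac W" using e assms[of e] by (auto simp: act_def active_def)
qed

lemma ac_stage: "ac (stg k s W \<zeta>) \<subseteq> ac W"
  by (rule ac_mono) (rule stage_ge)

lemma sum_deg_le: "A \<subseteq> E \<Longrightarrow> (\<Sum>v<n. deg A \<beta> s v) \<le> 2 * card A"
proof -
  assume A: "A \<subseteq> E"
  have fA: "finite A" using A finE by (rule finite_subset)
  have "(\<Sum>v<n. deg A \<beta> s v) \<le> (\<Sum>v\<in>{..<n}. card {e \<in> A. v \<in> e})"
    unfolding deg_def using fA by (intro sum_mono card_mono) auto
  also have "\<dots> = (\<Sum>e\<in>A. card {v \<in> {..<n}. v \<in> e})" by (rule sum_card_swap) (use fA in auto)
  also have "\<dots> \<le> (\<Sum>e\<in>A. 2)"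
  proof (rule sum_mono)
    fix e assume "e \<in> A"
    then have "{v \<in> {..<n}. v \<in> e} = e" "card e = 2" using A edgeE by blast+
    then show "card {v \<in> {..<n}. v \<in> e} \<le> 2" by simp
  qed
  finally show ?thesis by simp
qed

text \<open>Each integer division loses at most a factor 2: 16 n s / k is at least 2 and b / s is at
  least 1. This translates a small load into a small number of matched edges.\<close>

lemma weight_bound:
  assumes k: "0 < k" "k \<le> 8 * n * s" and s: "s > 0" and b: "s \<le> b"
  shows "4 * n * b \<le> weight n k s * (k * (b div s))" and "weight n k s > 0"
proof -
  have kw: "8 * n * s \<le> k * weight n k s"
  proof -
    have "16 * n * s < k * weight n k s + k"
      using k(1) unfolding weight_def by (metis add.commute dividend_less_times_div)
    then show ?thesis using k by linarith
  qed
  have sb: "b \<le> 2 * s * (b div s)"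
  proof -
    have "b < s * (b div s) + s" using s by (metis add.commute dividend_less_times_div)
    moreover have "s \<le> s * (b div s)" using b s div_greater_zero_iff[of b s] by simp
    ultimately have "b \<le> s * (b div s) + s * (b div s)" by linarith
    then show ?thesis by (simp add: mult.assoc)
  qed
  have "(8 * n * s) * b \<le> (k * weight n k s) * (2 * s * (b div s))" using kw sb by (rule mult_mono) auto
  then have "(2 * s) * (4 * n * b) \<le> (2 * s) * (weight n k s * (k * (b div s)))" by (simp add: mult_ac)
  then show "4 * n * b \<le> weight n k s * (k * (b div s))" using s by (simp only: nat_mult_le_cancel1)
  have "8 * n * s > 0" using n0 s by simp
  then show "weight n k s > 0" using kw by (metis gr0I mult_0_right not_le)
qed

definition big_edges :: "nat set set \<Rightarrow> nat \<Rightarrow> nat set set" where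
  "big_edges A s = {e \<in> A. \<forall>u\<in>e. s \<le> \<beta> u}"

lemma deg_big: "deg A \<beta> s v = card {e \<in> big_edges A s. v \<in> e}"
  unfolding deg_def big_edges_def by (rule arg_cong[where f = card]) auto

lemma point_edges_big: "k \<noteq> 1 \<Longrightarrow> point_edges A \<beta> k s \<zeta> p = line_edges (big_edges A s) k \<zeta> p"
  by (auto simp: point_edges_def line_edges_def big_edges_def at_point_def)

text \<open>Suppose none of the three events occurs. The still active neighbours \<open>U\<close>
  are then a large share of all neighbours and, having small loads, gained little in this stage; so
  \<open>incidence_bound\<close> puts the degree below the threshold.\<close>

lemma heavy_vertex:
  assumes oa: "\<exists>L. is_oa k L" and k: "k \<ge> 100" "k \<le> 8 * n * s" and s: "s > 0"
    and few: "card (ac W) \<le> n * (k * k)" and \<zeta>: "\<zeta> \<in> assignments n (k * k)"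
    and v: "v < n" and \<rho>: "\<rho> > 0"
    and hv: "16 * k * (\<beta> v div s) < deg (ac (stg k s W \<zeta>)) \<beta> s v"
  defines "F \<equiv> big_edges (ac W) s" and "c \<equiv> \<lambda>v. \<beta> v div s"
  shows "deg (ac (stg k s W \<zeta>)) \<beta> s v * \<rho> \<le> deg (ac W) \<beta> s v
    \<or> (16 * plane_graph.total n F c k (cap n) v \<zeta> \<ge> k * k * c v
        \<and> 64 * plane_graph.ldeg n F c k (cap n) v \<zeta> < k * c v)
    \<or> 16 * k * (\<rho> * \<rho>) * plane_graph.twins F v \<zeta> > (deg (ac W) \<beta> s v)\<^sup>2"
proof (rule ccontr)
  assume neg: "\<not> ?thesis"
  have FE: "F \<subseteq> ac W" by (auto simp: F_def big_edges_def)
  interpret pg: plane_graph n F c k "cap n"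
  proof
    show "simple_graph {..<n} F" using graph FE ac_sub[of W] by (meson simple_graph_subset subset_trans)
    show "card F \<le> n * (k * k)" using card_mono[OF fin_ac FE] few by simp
  qed (use oa k n0 in \<open>auto simp: cap_def\<close>)
  let ?W = "stg k s W \<zeta>"
  have k1: "k \<noteq> 1" "k > 0" using k by auto
  have PM: "point_matching n (ac W) \<beta> k s \<zeta> p = capped_matching n (cap n) (line_edges F k \<zeta> p) c" for p
    by (simp add: point_matching_def point_edges_big[OF k1(1)] F_def c_def)
  have low: "64 * pg.ldeg x \<zeta> < k * c x" if x: "16 * ld ?W x < n * \<beta> x" "s \<le> \<beta> x" for x
  proof -
    have "weight n k s * pg.ldeg x \<zeta> \<le> weight n k s * card {e \<in> F. x \<in> e \<and> (\<exists>p<k * k. e \<in> pg.LM \<zeta> p)}"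
      using pg.ldeg_le[OF \<zeta>] by (rule mult_left_mono) simp
    also have "\<dots> = (\<Sum>e | e \<in> F \<and> x \<in> e \<and> (\<exists>p<k * k. e \<in> pg.LM \<zeta> p). weight n k s)" by simp
    also have "\<dots> \<le> (\<Sum>e | e \<in> F \<and> x \<in> e \<and> (\<exists>p<k * k. e \<in> pg.LM \<zeta> p). ?W e)"
      by (rule sum_mono) (auto simp: stage_def PM)
    also have "\<dots> \<le> ld ?W x" unfolding wload_def
      using finE FE ac_sub[of W] by (intro sum_mono2) auto
    finally have "64 * (weight n k s * pg.ldeg x \<zeta>) \<le> 64 * ld ?W x" by simp
    also have "\<dots> < 4 * n * \<beta> x" using x(1) by simp
    also have "\<dots> \<le> weight n k s * (k * c x)"
      unfolding c_def using weight_bound(1)[OF k1(2) k(2) s x(2)] .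
    finally have "weight n k s * (64 * pg.ldeg x \<zeta>) < weight n k s * (k * c x)" by (simp only: mult_ac)
    then show ?thesis by simp
  qed
  define U where "U = {u. {u, v} \<in> big_edges (ac ?W) s}"
  have sub: "big_edges (ac ?W) s \<subseteq> F" using ac_stage[of k s W \<zeta>] by (auto simp: F_def big_edges_def)
  have Un: "U \<subseteq> pg.nbr v" using sub by (auto simp: U_def pg.nbr_def)
  have dX: "deg (ac W) \<beta> s v = card (pg.nbr v)" by (simp add: deg_big pg.card_edges_at flip: F_def)
  have dU: "deg (ac ?W) \<beta> s v = card U"
  proof -
    have "{e \<in> big_edges (ac ?W) s. v \<in> e} = (\<lambda>u. {u, v}) ` U"
    proof -
      have "e \<in> (\<lambda>u. {u, v}) ` U" if "e \<in> big_edges (ac ?W) s" "v \<in> e" for e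
      proof -
        have "e \<in> (\<lambda>u. {u, v}) ` pg.nbr v" using that sub pg.edges_at[of v] by blast
        then show ?thesis using that by (auto simp: U_def)
      qed
      then show ?thesis by (auto simp: U_def)
    qed
    moreover have "inj_on (\<lambda>u. {u, v}) U" by (auto simp: inj_on_def doubleton_eq_iff)
    ultimately show ?thesis by (simp add: deg_big card_image)
  qed
  have "card U > 0" using hv dU by linarith
  then obtain u0 where u0: "u0 \<in> U" by (metis card.empty equals0I less_not_refl)
  have uU: "s \<le> \<beta> u \<and> s \<le> \<beta> v \<and> 16 * ld ?W u < n * \<beta> u \<and> 16 * ld ?W v < n * \<beta> v" if "u \<in> U" for u
    using that by (auto simp: U_def big_edges_def act_def active_def)
  have cpos: "c u > 0" if "s \<le> \<beta> u" for u using that s by (simp add: c_def div_greater_zero_iff)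
  have "card U \<le> 16 * k * c v"
  proof (rule pg.incidence_bound[OF \<zeta> v _ Un])
    show "0 < c v" using uU[OF u0] cpos by blast
    show "64 * card {p. p < k * k \<and> on_line k (\<zeta> u) p \<and> c u \<le> card {e \<in> pg.LM \<zeta> p. u \<in> e}} \<le> k" if "u \<in> U" for u
      using uU[OF that] cpos low by (intro pg.card_sat_points) auto
    show "16 * pg.total v \<zeta> < k * k * c v" using neg low[of v] uU[OF u0] by auto
    show "16 * k * (\<rho> * \<rho>) * pg.twins v \<zeta> \<le> (card (pg.nbr v))\<^sup>2" using neg dX by auto
    show "card (pg.nbr v) \<le> card U * \<rho>" using neg dX dU by auto
  qed (rule \<rho>)
  then show False using hv dU by (simp add: c_def)
qed

text \<open>Sums the alternatives of \<open>heavy_vertex\<close>: a degree reduced by \<rho>, or the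
  full degree charged with probability 68 / k for an unlucky line and 16 \<rho> ^ 2 / k for many
  twins. The degrees add up to at most twice the active edges.\<close>

lemma sum_heavy:
  fixes \<rho> :: nat
  assumes oa: "\<exists>L. is_oa k L" and k: "k \<ge> 100" "k \<le> 8 * n * s" and s: "s > 0"
    and few: "card (ac W) \<le> n * (k * k)" and \<rho>: "\<rho> > 0"
  shows "(\<Sum>\<zeta>\<in>assignments n (k * k). real (heavy n (ac (stg k s W \<zeta>)) \<beta> k s))
    \<le> 2 * real (card (ac W)) * (1 / \<rho> + 68 / k + 16 * \<rho>\<^sup>2 / k) * card (assignments n (k * k))"
proof -
  define F where "F = big_edges (ac W) s"
  define c where "c = (\<lambda>v. \<beta> v div s)"
  have FE: "F \<subseteq> ac W" by (auto simp: F_def big_edges_def)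
  interpret pg: plane_graph n F c k "cap n"
  proof
    show "simple_graph {..<n} F" using graph FE ac_sub[of W] by (meson simple_graph_subset subset_trans)
    show "card F \<le> n * (k * k)" using card_mono[OF fin_ac FE] few by simp
  qed (use oa k n0 in \<open>auto simp: cap_def\<close>)
  let ?Z = "assignments n (k * k)"
  define d where "d v = deg (ac W) \<beta> s v" for v
  have dn: "d v = card (pg.nbr v)" for v by (simp add: d_def deg_big pg.card_edges_at flip: F_def)
  define b1 where "b1 v \<zeta> \<longleftrightarrow> 16 * pg.total v \<zeta> \<ge> k * k * c v \<and> 64 * pg.ldeg v \<zeta> < k * c v" for v \<zeta>
  define b2 where "b2 v \<zeta> \<longleftrightarrow> 16 * k * (\<rho> * \<rho>) * pg.twins v \<zeta> > (d v)\<^sup>2" for v \<zeta>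
  have kr: "real k > 0" using k by simp
  have \<rho>r: "real \<rho> > 0" using \<rho> by simp
  have pt: "real (heavy n (ac (stg k s W \<zeta>)) \<beta> k s)
    \<le> (\<Sum>v<n. d v * (1 / \<rho> + (if b1 v \<zeta> then 1 else 0) + (if b2 v \<zeta> then 1 else 0)))"
    if \<zeta>: "\<zeta> \<in> ?Z" for \<zeta>
  proof -
    let ?d = "deg (ac (stg k s W \<zeta>)) \<beta> s"
    have "real (heavy n (ac (stg k s W \<zeta>)) \<beta> k s) = (\<Sum>v | v < n \<and> 16 * k * (\<beta> v div s) < ?d v. real (?d v))"
      by (simp add: heavy_def)
    also have "\<dots> \<le> (\<Sum>v | v < n \<and> 16 * k * (\<beta> v div s) < ?d v.
        d v * (1 / \<rho> + (if b1 v \<zeta> then 1 else 0) + (if b2 v \<zeta> then 1 else 0)))"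
    proof (rule sum_mono)
      fix v assume "v \<in> {v. v < n \<and> 16 * k * (\<beta> v div s) < ?d v}"
      then have v: "v < n" "16 * k * (\<beta> v div s) < ?d v" by auto
      have le: "?d v \<le> d v" unfolding d_def deg_def
        using fin_ac ac_stage[of k s W \<zeta>] by (intro card_mono) auto
      have "?d v * \<rho> \<le> d v \<or> b1 v \<zeta> \<or> b2 v \<zeta>"
        using heavy_vertex[OF oa k s few \<zeta> v(1) \<rho> v(2)] unfolding b1_def b2_def d_def F_def c_def .
      then consider "?d v * \<rho> \<le> d v" | "b1 v \<zeta>" | "b2 v \<zeta>" by blast
      then show "real (?d v) \<le> d v * (1 / \<rho> + (if b1 v \<zeta> then 1 else 0) + (if b2 v \<zeta> then 1 else 0))"
      proof cases
        case 1
        then have "real (?d v) * real \<rho> \<le> real (d v)" by (metis of_nat_le_iff of_nat_mult)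
        then have "real (?d v) \<le> d v * (1 / \<rho>)" using \<rho>r by (simp add: field_simps)
        also have "\<dots> \<le> d v * (1 / \<rho> + (if b1 v \<zeta> then 1 else 0) + (if b2 v \<zeta> then 1 else 0))"
          by (intro mult_left_mono) auto
        finally show ?thesis .
      next
        case 2
        have "real (?d v) \<le> real (d v) * 1" using le by simp
        also have "\<dots> \<le> d v * (1 / \<rho> + (if b1 v \<zeta> then 1 else 0) + (if b2 v \<zeta> then 1 else 0))"
          using 2 by (intro mult_left_mono) auto
        finally show ?thesis .
      next
        case 3
        have "real (?d v) \<le> real (d v) * 1" using le by simp
        also have "\<dots> \<le> d v * (1 / \<rho> + (if b1 v \<zeta> then 1 else 0) + (if b2 v \<zeta> then 1 else 0))"
          using 3 by (intro mult_left_mono) auto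
        finally show ?thesis .
      qed
    qed
    also have "\<dots> \<le> (\<Sum>v<n. d v * (1 / \<rho> + (if b1 v \<zeta> then 1 else 0) + (if b2 v \<zeta> then 1 else 0)))"
      by (rule sum_mono2) auto
    finally show ?thesis .
  qed
  have "(\<Sum>\<zeta>\<in>?Z. real (heavy n (ac (stg k s W \<zeta>)) \<beta> k s))
    \<le> (\<Sum>\<zeta>\<in>?Z. \<Sum>v<n. d v * (1 / \<rho> + (if b1 v \<zeta> then 1 else 0) + (if b2 v \<zeta> then 1 else 0)))"
    by (rule sum_mono) (rule pt)
  also have "\<dots> = (\<Sum>v<n. \<Sum>\<zeta>\<in>?Z. d v * (1 / \<rho> + (if b1 v \<zeta> then 1 else 0) + (if b2 v \<zeta> then 1 else 0)))"
    by (rule sum.swap)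
  also have "\<dots> \<le> (\<Sum>v<n. d v * ((1 / \<rho> + 68 / k + 16 * \<rho>\<^sup>2 / k) * card ?Z))"
  proof (rule sum_mono)
    fix v assume "v \<in> {..<n}"
    then have v: "v < n" by simp
    have eq: "(\<Sum>\<zeta>\<in>?Z. d v * (1 / \<rho> + (if b1 v \<zeta> then 1 else 0) + (if b2 v \<zeta> then 1 else 0)))
      = d v * (card ?Z / \<rho> + card {\<zeta> \<in> ?Z. b1 v \<zeta>} + card {\<zeta> \<in> ?Z. b2 v \<zeta>})"
    proof -
      have "(\<Sum>\<zeta>\<in>?Z. 1 / \<rho> + (if b1 v \<zeta> then 1 else 0) + (if b2 v \<zeta> then 1 else 0))
        = (\<Sum>\<zeta>\<in>?Z. 1 / \<rho>) + (\<Sum>\<zeta>\<in>?Z. if b1 v \<zeta> then 1 else 0) + (\<Sum>\<zeta>\<in>?Z. if b2 v \<zeta> then 1 else (0::real))"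
        by (simp only: sum.distrib)
      also have "(\<Sum>\<zeta>\<in>?Z. if b1 v \<zeta> then 1 else 0) = real (card {\<zeta> \<in> ?Z. b1 v \<zeta>})"
        using finite_assignments[of n "k * k"] by (simp add: sum.If_cases Int_def)
      also have "(\<Sum>\<zeta>\<in>?Z. if b2 v \<zeta> then 1 else 0) = real (card {\<zeta> \<in> ?Z. b2 v \<zeta>})"
        using finite_assignments[of n "k * k"] by (simp add: sum.If_cases Int_def)
      finally show ?thesis by (simp flip: sum_distrib_left)
    qed
    show "(\<Sum>\<zeta>\<in>?Z. d v * (1 / \<rho> + (if b1 v \<zeta> then 1 else 0) + (if b2 v \<zeta> then 1 else 0)))
      \<le> d v * ((1 / \<rho> + 68 / k + 16 * \<rho>\<^sup>2 / k) * card ?Z)"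
    proof (cases "d v = 0")
      case False
      then have "{e \<in> F. v \<in> e} \<noteq> {}" unfolding d_def deg_big F_def by (metis card.empty)
      then have "s \<le> \<beta> v" by (auto simp: F_def big_edges_def)
      then have c0: "c v > 0" using s by (simp add: c_def div_greater_zero_iff)
      have "k * card {\<zeta> \<in> ?Z. b1 v \<zeta>} \<le> 68 * card ?Z" unfolding b1_def by (rule pg.card_unlucky[OF v c0])
      then have "real (k * card {\<zeta> \<in> ?Z. b1 v \<zeta>}) \<le> real (68 * card ?Z)" by (simp only: of_nat_le_iff)
      then have 1: "card {\<zeta> \<in> ?Z. b1 v \<zeta>} \<le> (68 / k) * card ?Z" using kr by (simp add: field_simps)
      have "k * card {\<zeta> \<in> ?Z. b2 v \<zeta>} \<le> 16 * (\<rho> * \<rho>) * card ?Z"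
        unfolding b2_def dn by (rule pg.card_many_twins)
      then have "real (k * card {\<zeta> \<in> ?Z. b2 v \<zeta>}) \<le> real (16 * (\<rho> * \<rho>) * card ?Z)" by (simp only: of_nat_le_iff)
      then have 2: "card {\<zeta> \<in> ?Z. b2 v \<zeta>} \<le> (16 * \<rho>\<^sup>2 / k) * card ?Z"
        using kr by (simp add: field_simps power2_eq_square)
      have "card ?Z / \<rho> + card {\<zeta> \<in> ?Z. b1 v \<zeta>} + card {\<zeta> \<in> ?Z. b2 v \<zeta>}
        \<le> (1 / \<rho> + 68 / k + 16 * \<rho>\<^sup>2 / k) * card ?Z"
        using 1 2 by (simp add: algebra_simps)
      then show ?thesis unfolding eq by (intro mult_left_mono) auto
    qed simp
  qed
  also have "\<dots> = real (\<Sum>v<n. d v) * ((1 / \<rho> + 68 / k + 16 * \<rho>\<^sup>2 / k) * card ?Z)"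
    by (simp add: sum_distrib_right)
  also have "\<dots> \<le> (2 * real (card (ac W))) * ((1 / \<rho> + 68 / k + 16 * \<rho>\<^sup>2 / k) * card ?Z)"
  proof (rule mult_right_mono)
    have "real (\<Sum>v<n. d v) \<le> real (2 * card (ac W))"
      unfolding d_def using sum_deg_le[OF ac_sub] by (simp only: of_nat_le_iff)
    then show "real (\<Sum>v<n. d v) \<le> 2 * real (card (ac W))" by simp
  qed auto
  finally show ?thesis by (simp add: mult.assoc)
qed

end

section \<open>Feasibility, certificate and rounding\<close>

context bgraph
begin

text \<open>Bounds that every stage preserves: an active edge weighs less than \<open>n\<close> and
  gains at most n + 16 n; a vertex with an active edge carries less than n \<beta> v / 16 and gains
  at most 32 n \<beta> v. Nothing else changes.\<close>

definition feasible :: "(nat set \<Rightarrow> nat) \<Rightarrow> bool" where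
  "feasible W \<longleftrightarrow> (\<forall>v<n. ld W v \<le> 48 * n * \<beta> v) \<and> (\<forall>e. W e \<le> 18 * n)"

lemma card_matched_at:
  assumes oa: "\<exists>L. is_oa k L" "k > 0" and \<zeta>: "\<zeta> \<in> assignments n (k * k)" and v: "v < n"
  shows "card {e \<in> E. v \<in> e \<and> (\<exists>p<k * k. e \<in> point_matching n (ac W) \<beta> k s \<zeta> p)} \<le> k * (\<beta> v div s)"
proof -
  let ?PM = "\<lambda>p. point_matching n (ac W) \<beta> k s \<zeta> p"
  let ?P = "{p. p < k * k \<and> on_line k (\<zeta> v) p}"
  have "{e \<in> E. v \<in> e \<and> (\<exists>p<k * k. e \<in> ?PM p)} \<subseteq> (\<Union>p\<in>?P. {e \<in> ?PM p. v \<in> e})"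
    using pm_ac by (fastforce simp: at_point_def)
  moreover have "finite (\<Union>p\<in>?P. {e \<in> ?PM p. v \<in> e})"
    using finite_subset[OF pm_sub fin_point] by auto
  ultimately have "card {e \<in> E. v \<in> e \<and> (\<exists>p<k * k. e \<in> ?PM p)} \<le> card (\<Union>p\<in>?P. {e \<in> ?PM p. v \<in> e})"
    by (rule card_mono[rotated])
  also have "\<dots> \<le> (\<Sum>p\<in>?P. card {e \<in> ?PM p. v \<in> e})" by (rule card_UN_le) simp
  also have "\<dots> \<le> (\<Sum>p\<in>?P. \<beta> v div s)"
    unfolding point_matching_def by (intro sum_mono capped_matching_degree[OF fin_point v])
  also have "\<dots> = k * (\<beta> v div s)"
    using card_line[OF oa, of "\<zeta> v"] \<zeta> v by (simp add: assignments_iff)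
  finally show ?thesis .
qed

lemma stage_feasible:
  assumes oa: "\<exists>L. is_oa k L" "k > 0" and s: "0 < s" "s \<le> k" and \<zeta>: "\<zeta> \<in> assignments n (k * k)"
    and W: "feasible W"
  shows "feasible (stg k s W \<zeta>)"
  unfolding feasible_def
proof (intro conjI allI impI)
  fix e
  have "weight n k s \<le> 16 * n"
  proof -
    have "16 * n * s div k \<le> 16 * n * k div k" using s by (intro div_le_mono) auto
    then show ?thesis using oa(2) by (simp add: weight_def)
  qed
  show "stg k s W \<zeta> e \<le> 18 * n"
  proof (cases "e \<in> ac W")
    case True
    then have "W e < n" by (simp add: act_def active_def)
    then show ?thesis using \<open>weight n k s \<le> 16 * n\<close> by (simp add: stage_def)
  next
    case False
    then show ?thesis using W by (simp add: stage_inactive feasible_def)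
  qed
next
  fix v assume v: "v < n"
  show "ld (stg k s W \<zeta>) v \<le> 48 * n * \<beta> v"
  proof (cases "\<exists>e\<in>ac W. v \<in> e")
    case False
    then have "ld (stg k s W \<zeta>) v = ld W v"
      unfolding wload_def by (intro sum.cong refl stage_inactive) auto
    then show ?thesis using W v by (simp add: feasible_def)
  next
    case True
    let ?S = "{e. e \<in> E \<and> v \<in> e}"
    let ?f = "\<lambda>e. e \<in> ac W \<and> finished (deg (ac W) \<beta> k) \<beta> k e"
    let ?m = "\<lambda>e. \<exists>p<k * k. e \<in> point_matching n (ac W) \<beta> k s \<zeta> p"
    have fS: "finite ?S" using finE by simp
    have lX: "16 * ld W v < n * \<beta> v" using True by (auto simp: act_def active_def)
    have "ld (stg k s W \<zeta>) v = ld W v + (\<Sum>e\<in>?S. if ?f e then n else 0) + (\<Sum>e\<in>?S. if ?m e then weight n k s else 0)"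
      unfolding wload_def stage_def by (simp only: sum.distrib)
    also have "(\<Sum>e\<in>?S. if ?f e then n else 0) = n * card {e \<in> ?S. ?f e}"
      using fS by (simp add: sum.If_cases Int_def)
    also have "(\<Sum>e\<in>?S. if ?m e then weight n k s else 0) = weight n k s * card {e \<in> ?S. ?m e}"
      using fS by (simp add: sum.If_cases Int_def)
    also have "card {e \<in> ?S. ?f e} \<le> 16 * \<beta> v"
    proof (cases "\<exists>e\<in>?S. ?f e")
      case True
      then have d: "deg (ac W) \<beta> k v \<le> 16 * \<beta> v" by (auto simp: finished_def)
      have "card {e \<in> ?S. ?f e} \<le> deg (ac W) \<beta> k v"
        unfolding deg_def using fin_ac by (intro card_mono) (auto simp: finished_def)
      then show ?thesis using d by simp
    next
      case False
      then have "{e \<in> ?S. ?f e} = {}" by auto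
      then show ?thesis by (simp only: card.empty)
    qed
    also have "weight n k s * card {e \<in> ?S. ?m e} \<le> 16 * n * \<beta> v"
    proof -
      have "card {e \<in> ?S. ?m e} \<le> k * (\<beta> v div s)"
        using card_matched_at[OF oa \<zeta> v, of W s] by (simp add: conj_assoc)
      then have "weight n k s * card {e \<in> ?S. ?m e} \<le> weight n k s * (k * (\<beta> v div s))" by (rule mult_left_mono) simp
      also have "\<dots> = (weight n k s * k) * (\<beta> v div s)" by simp
      also have "\<dots> \<le> (16 * n * s) * (\<beta> v div s)" unfolding weight_def by (intro mult_right_mono) auto
      also have "\<dots> = 16 * n * (s * (\<beta> v div s))" by simp
      also have "\<dots> \<le> 16 * n * \<beta> v" by (intro mult_left_mono) auto
      finally show ?thesis .
    qed
    finally have "ld (stg k s W \<zeta>) v \<le> ld W v + n * (16 * \<beta> v) + 16 * n * \<beta> v" by simp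
    then have "ld (stg k s W \<zeta>) v \<le> ld W v + 32 * (n * \<beta> v)" by simp
    then have "ld (stg k s W \<zeta>) v \<le> 48 * (n * \<beta> v)" using lX by linarith
    then show ?thesis by (simp add: mult.assoc)
  qed
qed

lemma sum_ld: "(\<Sum>v<n. ld W v) = 2 * (\<Sum>e\<in>E. W e)"
proof -
  have "(\<Sum>v<n. ld W v) = (\<Sum>v<n. \<Sum>e\<in>E. if v \<in> e then W e else 0)"
    unfolding wload_def using finE by (simp add: sum.If_cases Int_def)
  also have "\<dots> = (\<Sum>e\<in>E. \<Sum>v<n. if v \<in> e then W e else 0)" by (rule sum.swap)
  also have "\<dots> = (\<Sum>e\<in>E. 2 * W e)"
  proof (rule sum.cong)
    fix e assume "e \<in> E"
    then have e: "e \<subseteq> {..<n}" "card e = 2" using edgeE by auto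
    then have "{..<n} \<inter> {v. v \<in> e} = e" by auto
    then show "(\<Sum>v<n. if v \<in> e then W e else 0) = 2 * W e" using e by (simp add: sum.If_cases)
  qed simp
  finally show ?thesis by (simp add: sum_distrib_left)
qed

text \<open>An optimal matching consists of edges at loaded vertices (\<open>R\<close>), edges of
  value at least 1 (\<open>L\<close>) and edges still active. The single host solved the active
  edges exactly and gave its matching weight 16 n, so the last kind has at most |L| members. Loads
  sum to twice the weights, whence the constant 16 * 2 + 2 = 34.\<close>

lemma final_certificate:
  assumes oa: "\<exists>L. is_oa 1 L" and small: "card (ac W) \<le> cap n" and \<zeta>: "\<zeta> \<in> assignments n 1"
  defines "Y \<equiv> stg 1 1 W \<zeta>"
  shows "n * max_b_matching_size {..<n} E \<beta> \<le> 34 * (\<Sum>e\<in>E. Y e)"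
proof -
  define M where "M = opt_matching n E \<beta>"
  define R where "R = {v. v < n \<and> 16 * ld Y v \<ge> n * \<beta> v}"
  define L where "L = {e \<in> E. Y e \<ge> n}"
  have ME: "M \<subseteq> E" and Md: "\<And>v. v < n \<Longrightarrow> card {e \<in> M. v \<in> e} \<le> \<beta> v"
    unfolding M_def using opt_matching_subset[OF finE] opt_matching_degree[OF finE] by auto
  have fM: "finite M" using ME finE by (rule finite_subset)
  have PM: "point_matching n (ac W) \<beta> 1 1 \<zeta> 0 = opt_matching n (ac W) \<beta>"
  proof -
    have on: "on_line 1 (\<zeta> v) 0" if "v < n" for v
      using oa_less[OF oa, of "\<zeta> v" 0] \<zeta> that by (simp add: on_line_def assignments_iff)
    have "at_point 1 1 \<beta> \<zeta> 0 e" if "e \<in> ac W" for e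
    proof -
      have "e \<subseteq> {..<n}" using that ac_sub edgeE by blast
      then show ?thesis using on \<beta>0 by (fastforce simp: at_point_def)
    qed
    then have "point_edges (ac W) \<beta> 1 1 \<zeta> 0 = ac W" by (auto simp: point_edges_def)
    then show ?thesis using small by (simp add: point_matching_def capped_matching_def)
  qed
  have 3: "card (M \<inter> ac Y) \<le> card L"
  proof -
    have "b_matching {..<n} (ac W) \<beta> (M \<inter> ac Y)"
      unfolding b_matching_def
    proof (intro conjI ballI)
      show "M \<inter> ac Y \<subseteq> ac W" using ac_stage[of 1 1 W \<zeta>] by (auto simp: Y_def)
      fix v assume v: "v \<in> {..<n}"
      have "card {e \<in> M \<inter> ac Y. v \<in> e} \<le> card {e \<in> M. v \<in> e}" using fM by (intro card_mono) auto
      then show "card {e \<in> M \<inter> ac Y. v \<in> e} \<le> \<beta> v" using Md[of v] v by simp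
    qed
    then have "card (M \<inter> ac Y) \<le> card (opt_matching n (ac W) \<beta>)" by (rule opt_matching_maximal[OF fin_ac])
    also have "\<dots> \<le> card L"
    proof (rule card_mono)
      show "finite L" using finE by (simp add: L_def)
      show "opt_matching n (ac W) \<beta> \<subseteq> L"
      proof
        fix e assume e: "e \<in> opt_matching n (ac W) \<beta>"
        then have "e \<in> E" using opt_matching_subset[OF fin_ac] ac_sub by blast
        moreover have "Y e \<ge> weight n 1 1" using e PM by (auto simp: Y_def stage_def)
        ultimately show "e \<in> L" by (simp add: L_def weight_def)
      qed
    qed
    finally show ?thesis .
  qed
  have "M \<subseteq> (\<Union>v\<in>R. {e \<in> M. v \<in> e}) \<union> L \<union> (M \<inter> ac Y)"
  proof
    fix e assume e: "e \<in> M"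
    then have "e \<in> E" "e \<subseteq> {..<n}" using ME edgeE by auto
    then show "e \<in> (\<Union>v\<in>R. {e \<in> M. v \<in> e}) \<union> L \<union> (M \<inter> ac Y)"
    proof (cases "n \<le> Y e \<or> (\<exists>v\<in>e. n * \<beta> v \<le> 16 * ld Y v)")
      case True
      then show ?thesis using e \<open>e \<in> E\<close> \<open>e \<subseteq> {..<n}\<close> by (auto simp: R_def L_def)
    next
      case False
      then have "e \<in> ac Y" using \<open>e \<in> E\<close> by (auto simp: act_def active_def not_le)
      then show ?thesis using e by simp
    qed
  qed
  moreover have fR: "finite R" by (simp add: R_def)
  moreover have fL: "finite L" using finE by (simp add: L_def)
  ultimately have "card M \<le> card ((\<Union>v\<in>R. {e \<in> M. v \<in> e}) \<union> L \<union> (M \<inter> ac Y))"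
    using fM by (intro card_mono) auto
  also have "\<dots> \<le> card (\<Union>v\<in>R. {e \<in> M. v \<in> e}) + card L + card (M \<inter> ac Y)"
    by (meson add_mono_thms_linordered_semiring(3) card_Un_le le_trans)
  also have "card (\<Union>v\<in>R. {e \<in> M. v \<in> e}) \<le> (\<Sum>v\<in>R. card {e \<in> M. v \<in> e})" by (rule card_UN_le[OF fR])
  also have "(\<Sum>v\<in>R. card {e \<in> M. v \<in> e}) \<le> (\<Sum>v\<in>R. \<beta> v)" by (rule sum_mono) (auto simp: R_def Md)
  finally have "card M \<le> (\<Sum>v\<in>R. \<beta> v) + 2 * card L" using 3 by simp
  then have "n * card M \<le> n * ((\<Sum>v\<in>R. \<beta> v) + 2 * card L)" by (rule mult_left_mono) simp
  also have "\<dots> = (\<Sum>v\<in>R. n * \<beta> v) + 2 * (n * card L)" by (simp add: algebra_simps sum_distrib_left)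
  also have "(\<Sum>v\<in>R. n * \<beta> v) \<le> (\<Sum>v\<in>R. 16 * ld Y v)" by (rule sum_mono) (auto simp: R_def)
  also have "\<dots> \<le> (\<Sum>v<n. 16 * ld Y v)" by (rule sum_mono2) (auto simp: R_def)
  also have "\<dots> = 32 * (\<Sum>e\<in>E. Y e)" by (simp add: sum_ld flip: sum_distrib_left)
  also have "n * card L \<le> (\<Sum>e\<in>E. Y e)"
  proof -
    have "n * card L = (\<Sum>e\<in>L. n)" by simp
    also have "\<dots> \<le> (\<Sum>e\<in>L. Y e)" by (rule sum_mono) (auto simp: L_def)
    also have "\<dots> \<le> (\<Sum>e\<in>E. Y e)" using finE by (intro sum_mono2) (auto simp: L_def)
    finally show ?thesis .
  qed
  finally show ?thesis using opt_matching(2)[OF finE] by (simp add: M_def)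
qed

end

section \<open>Rounding with a pairwise independent hash of the edges\<close>

definition picked :: "nat \<Rightarrow> (nat \<Rightarrow> nat) \<Rightarrow> nat \<Rightarrow> nat set \<Rightarrow> bool" where
  "picked H r x e \<longleftrightarrow> (\<Sum>v\<in>e. r v) mod H < x"

definition candidates :: "nat \<Rightarrow> nat set set \<Rightarrow> (nat set \<Rightarrow> nat) \<Rightarrow> (nat \<Rightarrow> nat) \<Rightarrow> nat set set" where
  "candidates H E W r = {e \<in> E. picked H r (W e) e}"

text \<open>The test needs only the number of candidates at each end, a sum that the machines can
  compute jointly, and it makes the result a \<open>b\<close>-matching in every outcome.\<close>

definition pruned :: "nat \<Rightarrow> nat set set \<Rightarrow> (nat \<Rightarrow> nat) \<Rightarrow> (nat set \<Rightarrow> nat) \<Rightarrow> (nat \<Rightarrow> nat) \<Rightarrow> nat set set" where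
  "pruned H E \<beta> W r = {e \<in> candidates H E W r. \<forall>v\<in>e. card {f \<in> candidates H E W r. v \<in> f} \<le> \<beta> v}"

lemma card_shift_mod:
  assumes "x \<le> H"
  shows "card {z. z < H \<and> (z + a) mod H < (x :: nat)} = x"
proof (cases "H = 0")
  case False
  let ?f = "\<lambda>z. (z + a) mod H"
  have inj: "inj_on ?f {..<H}"
  proof (rule inj_onI)
    fix y z assume yz: "y \<in> {..<H}" "z \<in> {..<H}" "(y + a) mod H = (z + a) mod H"
    have "a \<le> H * a" using False by simp
    \<comment> \<open>Adding H a - a turns the shift by \<open>a\<close> into a multiple of
      \<open>H\<close>, so the shift cancels modulo \<open>H\<close> without subtraction.\<close>
    then have *: "u + a + (H * a - a) = u + H * a" for u by simp
    have "(y + a + (H * a - a)) mod H = (z + a + (H * a - a)) mod H"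
      using yz(3) by (rule mod_add_cong) (rule refl)
    then have "y mod H = z mod H" unfolding * by simp
    then show "y = z" using yz by simp
  qed
  have im: "?f ` {..<H} = {..<H}"
    by (rule card_subset_eq) (use False in \<open>auto simp: card_image[OF inj]\<close>)
  have "?f ` {z. z < H \<and> ?f z < x} = {..<x}"
  proof
    show "{..<x} \<subseteq> ?f ` {z. z < H \<and> ?f z < x}"
    proof
      fix y assume y: "y \<in> {..<x}"
      then have "y \<in> ?f ` {..<H}" using im assms by auto
      then show "y \<in> ?f ` {z. z < H \<and> ?f z < x}" using y by auto
    qed
  qed auto
  moreover have "card (?f ` {z. z < H \<and> ?f z < x}) = card {z. z < H \<and> ?f z < x}"
    by (rule card_image, rule inj_on_subset[OF inj]) auto
  ultimately show ?thesis by (simp only: card_lessThan)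
qed (use assms in simp)

context bgraph
begin

text \<open>Four times the load bound 48 n per unit of budget, so a vertex expects at most \<beta> v
  / 4 picked edges.\<close>

definition hash_size :: nat where "hash_size = 192 * n"

abbreviation "HS \<equiv> hash_size"
abbreviation "pick W r e \<equiv> picked hash_size r (W e) e"

text \<open>The seed of one end \<open>u\<close> alone makes the hash of \<open>e\<close> uniform.
  Hence \<open>e\<close> is picked with probability W e / H, independently of any \<open>g\<close>
  that ignores the seed of \<open>u\<close>.\<close>

lemma sum_assignments_picked:
  fixes g :: "(nat \<Rightarrow> nat) \<Rightarrow> real"
  assumes W: "W e \<le> HS" and u: "u \<in> e" "e \<in> E" and g: "\<And>r z. g (r(u := z)) = g r"
  shows "HS * (\<Sum>r\<in>assignments n HS. g r * of_bool (pick W r e)) = W e * (\<Sum>r\<in>assignments n HS. g r)"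
proof -
  have e: "e \<subseteq> {..<n}" "finite e" using edgeE(1)[OF u(2)] finite_subset by auto
  have un: "u < n" using e u by auto
  have "HS * (\<Sum>r\<in>assignments n HS. g r * of_bool (pick W r e))
      = (\<Sum>r\<in>assignments n HS. \<Sum>z<HS. g (r(u := z)) * of_bool (pick W (r(u := z)) e))"
    using sum_assignments_resample[OF un, where f = "\<lambda>r. g r * of_bool (pick W r e)" and Q = HS] by simp
  also have "\<dots> = (\<Sum>r\<in>assignments n HS. g r * W e)"
  proof (rule sum.cong)
    fix r :: "nat \<Rightarrow> nat"
    have "(\<Sum>v\<in>e. (r(u := z)) v) = z + (\<Sum>v\<in>e - {u}. r v)" for z
      using e u by (simp add: sum.remove)
    then have "(\<Sum>z<HS. of_bool (pick W (r(u := z)) e)) = real (card {z. z < HS \<and> (z + (\<Sum>v\<in>e - {u}. r v)) mod HS < W e})"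
      by (simp add: picked_def of_bool_def sum.If_cases Int_def)
    then show "(\<Sum>z<HS. g (r(u := z)) * of_bool (pick W (r(u := z)) e)) = g r * W e"
      using card_shift_mod[OF W] by (simp add: g flip: sum_distrib_left)
  qed simp
  finally show ?thesis by (simp add: mult.commute flip: sum_distrib_right)
qed

text \<open>Given that \<open>e\<close> is picked, each end expects at most \<beta> v / 4 other
  picked edges, so by Markov's inequality it is overloaded with conditional probability at most 1/4.
  With two ends, \<open>e\<close> survives with probability at least W e / (2 H).\<close>

lemma sum_pruned:
  assumes W: "feasible W"
  shows "real (\<Sum>e\<in>E. W e) * card (assignments n HS) \<le> 2 * real HS * (\<Sum>r\<in>assignments n HS. real (card (pruned HS E \<beta> W r)))"
proof -
  let ?R = "assignments n HS"
  have fR: "finite ?R" by (rule finite_assignments)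
  have XH: "W e \<le> HS" for e using W by (auto simp: feasible_def hash_size_def intro: order_trans)
  have HS0: "HS > 0" using n0 by (simp add: hash_size_def)
  define N where "N e = (\<Sum>r\<in>?R. of_bool (pick W r e) :: real)" for e
  define N2 where "N2 f e = (\<Sum>r\<in>?R. of_bool (pick W r f) * of_bool (pick W r e) :: real)" for f e
  have N0: "N e \<ge> 0" for e unfolding N_def by (intro sum_nonneg) auto
  have ne: "\<exists>u. u \<in> e" if "e \<in> E" for e using edgeE(2)[OF that] by (metis card.empty equals0I zero_neq_numeral)
  have N1: "HS * N e = W e * card ?R" if e: "e \<in> E" for e
  proof -
    obtain u where "u \<in> e" using ne[OF e] by blast
    from sum_assignments_picked[where g = "\<lambda>_. 1", OF XH this e] show ?thesis by (simp add: N_def)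
  qed
  have N2: "HS * N2 f e = W f * N e" if e: "e \<in> E" and f: "f \<in> E" "e \<noteq> f" for e f
  proof -
    have "\<not> f \<subseteq> e"
    proof
      assume "f \<subseteq> e"
      moreover have "finite e" using edgeE(1)[OF e] finite_subset by auto
      ultimately have "f = e" using edgeE(2)[OF e] edgeE(2)[OF f(1)] by (intro card_subset_eq) auto
      with f show False by simp
    qed
    then obtain u where u: "u \<in> f" "u \<notin> e" by auto
    have g: "of_bool (pick W (r(u := z)) e) = (of_bool (pick W r e) :: real)" for r z
    proof -
      have "(\<Sum>v\<in>e. (r(u := z)) v) = (\<Sum>v\<in>e. r v)" using u by (intro sum.cong) auto
      then show ?thesis by (simp add: picked_def)
    qed
    from sum_assignments_picked[where g = "\<lambda>r. of_bool (pick W r e)", OF XH u(1) f(1) g]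
    show ?thesis by (simp add: N2_def N_def mult.commute)
  qed
  \<comment> \<open>If a picked edge is discarded, one of its ends sees at least \<beta> v other
    picked edges, so the term of that end is at least 1.\<close>
  have over: "real (of_bool (pick W r e)) - (\<Sum>v\<in>e. (\<Sum>f | f \<in> E \<and> v \<in> f \<and> f \<noteq> e. of_bool (pick W r f) * of_bool (pick W r e)) / \<beta> v)
     \<le> of_bool (e \<in> pruned HS E \<beta> W r)" if e: "e \<in> E" for r e
  proof -
    let ?C = "candidates HS E W r"
    have fC: "finite ?C" using finE by (simp add: candidates_def)
    have fe: "finite e" "e \<subseteq> {..<n}" using edgeE(1)[OF e] finite_subset by auto
    have nn: "0 \<le> (\<Sum>f | f \<in> E \<and> v \<in> f \<and> f \<noteq> e. of_bool (pick W r f) * of_bool (pick W r e)) / real (\<beta> v)" for v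
      by (intro divide_nonneg_nonneg sum_nonneg) auto
    show ?thesis
    proof (cases "pick W r e \<and> e \<notin> pruned HS E \<beta> W r")
      case False
      have "0 \<le> (\<Sum>v\<in>e. (\<Sum>f | f \<in> E \<and> v \<in> f \<and> f \<noteq> e. of_bool (pick W r f) * of_bool (pick W r e)) / real (\<beta> v))"
        by (intro sum_nonneg nn)
      then show ?thesis using False by (auto simp: of_bool_def split: if_splits)
    next
      case True
      then have eC: "e \<in> ?C" using e by (simp add: candidates_def)
      then obtain v where v: "v \<in> e" "card {f \<in> ?C. v \<in> f} > \<beta> v"
        using True by (auto simp: pruned_def not_le)
      then have b0: "\<beta> v > 0" using \<beta>0 fe by auto
      have "{f \<in> ?C. v \<in> f} = insert e {f \<in> ?C. v \<in> f \<and> f \<noteq> e}" using eC v by auto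
      then have "card {f \<in> ?C. v \<in> f} = Suc (card {f \<in> ?C. v \<in> f \<and> f \<noteq> e})" using fC by simp
      then have ge: "card {f \<in> ?C. v \<in> f \<and> f \<noteq> e} \<ge> \<beta> v" using v by simp
      have "(\<Sum>f | f \<in> E \<and> v \<in> f \<and> f \<noteq> e. of_bool (pick W r f) * of_bool (pick W r e))
          = real (card {f \<in> ?C. v \<in> f \<and> f \<noteq> e})"
      proof -
        have "{f \<in> ?C. v \<in> f \<and> f \<noteq> e} = {f. f \<in> E \<and> v \<in> f \<and> f \<noteq> e} \<inter> {f. pick W r f}"
          by (auto simp: candidates_def)
        then show ?thesis using True finE by (simp add: of_bool_def sum.If_cases)
      qed
      then have "1 \<le> (\<Sum>f | f \<in> E \<and> v \<in> f \<and> f \<noteq> e. of_bool (pick W r f) * of_bool (pick W r e)) / real (\<beta> v)"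
        using ge b0 by simp
      also have "\<dots> \<le> (\<Sum>v\<in>e. (\<Sum>f | f \<in> E \<and> v \<in> f \<and> f \<noteq> e. of_bool (pick W r f) * of_bool (pick W r e)) / real (\<beta> v))"
        using member_le_sum[of v e "\<lambda>v. (\<Sum>f | f \<in> E \<and> v \<in> f \<and> f \<noteq> e. of_bool (pick W r f) * of_bool (pick W r e)) / real (\<beta> v)"]
          v fe nn by auto
      finally show ?thesis using True by simp
    qed
  qed
  have one: "W e * real (card ?R) \<le> 2 * real HS * (\<Sum>r\<in>?R. (of_bool (e \<in> pruned HS E \<beta> W r) :: real))" if e: "e \<in> E" for e
  proof -
    have fe: "finite e" "e \<subseteq> {..<n}" using edgeE(1)[OF e] finite_subset by auto
    have load: "(\<Sum>f | f \<in> E \<and> v \<in> f \<and> f \<noteq> e. real (W f)) / \<beta> v \<le> HS / 4" if "v \<in> e" for v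
    proof -
      have vn: "v < n" using that fe by auto
      have "(\<Sum>f | f \<in> E \<and> v \<in> f \<and> f \<noteq> e. W f) \<le> ld W v"
        unfolding wload_def using finE by (intro sum_mono2) auto
      also have "\<dots> \<le> 48 * n * \<beta> v" using W vn by (simp add: feasible_def)
      finally have "real (\<Sum>f | f \<in> E \<and> v \<in> f \<and> f \<noteq> e. W f) \<le> real (48 * n * \<beta> v)" by (simp only: of_nat_le_iff)
      then show ?thesis using \<beta>0[OF vn] by (simp add: field_simps hash_size_def)
    qed
    have "HS * (\<Sum>v\<in>e. (\<Sum>f | f \<in> E \<and> v \<in> f \<and> f \<noteq> e. N2 f e) / \<beta> v)
        = (\<Sum>v\<in>e. (\<Sum>f | f \<in> E \<and> v \<in> f \<and> f \<noteq> e. HS * N2 f e) / \<beta> v)"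
      by (simp add: sum_distrib_left)
    also have "\<dots> = (\<Sum>v\<in>e. (\<Sum>f | f \<in> E \<and> v \<in> f \<and> f \<noteq> e. W f * N e) / \<beta> v)"
      using N2[OF e] by (intro sum.cong arg_cong2[where f = "(/)"] refl) auto
    also have "\<dots> = (\<Sum>v\<in>e. N e * ((\<Sum>f | f \<in> E \<and> v \<in> f \<and> f \<noteq> e. W f) / \<beta> v))"
      by (simp add: mult.commute flip: sum_distrib_left)
    also have "\<dots> \<le> (\<Sum>v\<in>e. N e * (HS / 4))"
      using load N0 by (intro sum_mono mult_left_mono) auto
    also have "\<dots> = HS * (N e / 2)" using edgeE(2)[OF e] by simp
    finally have half: "(\<Sum>v\<in>e. (\<Sum>f | f \<in> E \<and> v \<in> f \<and> f \<noteq> e. N2 f e) / \<beta> v) \<le> N e / 2"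
      using HS0 by simp
    have "N e - (\<Sum>v\<in>e. (\<Sum>f | f \<in> E \<and> v \<in> f \<and> f \<noteq> e. N2 f e) / \<beta> v)
      = (\<Sum>r\<in>?R. real (of_bool (pick W r e)) - (\<Sum>v\<in>e. (\<Sum>f | f \<in> E \<and> v \<in> f \<and> f \<noteq> e. of_bool (pick W r f) * of_bool (pick W r e)) / \<beta> v))"
    proof -
      have "(\<Sum>r\<in>?R. \<Sum>v\<in>e. (\<Sum>f | f \<in> E \<and> v \<in> f \<and> f \<noteq> e. of_bool (pick W r f) * of_bool (pick W r e)) / real (\<beta> v))
        = (\<Sum>v\<in>e. (\<Sum>f | f \<in> E \<and> v \<in> f \<and> f \<noteq> e. N2 f e) / \<beta> v)"
        unfolding N2_def
        by (subst sum.swap, intro sum.cong refl, subst sum.swap) (simp add: sum_divide_distrib)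
      then show ?thesis by (simp add: N_def sum_subtractf)
    qed
    also have "\<dots> \<le> (\<Sum>r\<in>?R. (of_bool (e \<in> pruned HS E \<beta> W r) :: real))" by (rule sum_mono) (rule over[OF e])
    finally have "N e \<le> 2 * (\<Sum>r\<in>?R. (of_bool (e \<in> pruned HS E \<beta> W r) :: real))" using half by linarith
    then have "HS * N e \<le> real HS * (2 * (\<Sum>r\<in>?R. (of_bool (e \<in> pruned HS E \<beta> W r) :: real)))" by (rule mult_left_mono) simp
    then show ?thesis using N1[OF e] by (simp add: mult_ac)
  qed
  have "real (\<Sum>e\<in>E. W e) * card ?R = (\<Sum>e\<in>E. W e * real (card ?R))" by (simp add: sum_distrib_right)
  also have "\<dots> \<le> (\<Sum>e\<in>E. 2 * real HS * (\<Sum>r\<in>?R. (of_bool (e \<in> pruned HS E \<beta> W r) :: real)))" by (rule sum_mono) (rule one)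
  also have "\<dots> = 2 * real HS * (\<Sum>r\<in>?R. \<Sum>e\<in>E. (of_bool (e \<in> pruned HS E \<beta> W r) :: real))"
    by (subst sum.swap) (simp add: sum_distrib_left)
  also have "\<dots> = 2 * real HS * (\<Sum>r\<in>?R. real (card (pruned HS E \<beta> W r)))"
  proof -
    have "(\<Sum>e\<in>E. (of_bool (e \<in> pruned HS E \<beta> W r) :: real)) = real (card (pruned HS E \<beta> W r))" for r
    proof -
      have "E \<inter> {e. e \<in> pruned HS E \<beta> W r} = pruned HS E \<beta> W r" by (auto simp: pruned_def candidates_def)
      then show ?thesis using finE by (simp add: of_bool_def sum.If_cases)
    qed
    then show ?thesis by simp
  qed
  finally show ?thesis .
qed

lemma pruned_b_matching: "b_matching {..<n} E \<beta> (pruned HS E \<beta> W r)"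
  unfolding b_matching_def
proof (intro conjI ballI)
  show "pruned HS E \<beta> W r \<subseteq> E" by (auto simp: pruned_def candidates_def)
  fix v
  show "card {e \<in> pruned HS E \<beta> W r. v \<in> e} \<le> \<beta> v"
  proof (cases "\<exists>e\<in>pruned HS E \<beta> W r. v \<in> e")
    case True
    then have "card {f \<in> candidates HS E W r. v \<in> f} \<le> \<beta> v" by (auto simp: pruned_def)
    moreover have "card {e \<in> pruned HS E \<beta> W r. v \<in> e} \<le> card {f \<in> candidates HS E W r. v \<in> f}"
      using finE by (intro card_mono) (auto simp: pruned_def candidates_def)
    ultimately show ?thesis by simp
  next
    case False
    then have "{e \<in> pruned HS E \<beta> W r. v \<in> e} = {}" by auto
    then show ?thesis by (simp only: card.empty)
  qed
qed

end

section \<open>Phases\<close>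

text \<open>For \<open>j = 0\<close> the constant array serves: with a single column the injectivity
  condition is empty.\<close>

lemma oa_exists: "\<exists>L. is_oa (2 ^ j) L"
proof (cases "j = 0")
  case True
  then show ?thesis by (intro exI[of _ "\<lambda>_ _. 0"]) (simp add: is_oa_def)
next
  case False
  then show ?thesis using orthogonal_array_exists[of "2 ^ j" j] by (simp add: is_oa_def)
qed

definition uniform_assignment :: "nat \<Rightarrow> nat \<Rightarrow> (nat \<Rightarrow> nat) pmf" where
  "uniform_assignment n Q = pmf_of_set (assignments n Q)"

definition stage_pmf :: "nat \<Rightarrow> nat set set \<Rightarrow> (nat \<Rightarrow> nat) \<Rightarrow> nat \<times> nat \<Rightarrow> (nat set \<Rightarrow> nat) \<Rightarrow> (nat set \<Rightarrow> nat) pmf" where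
  "stage_pmf n E \<beta> ks W =
     map_pmf (stage n E \<beta> (fst ks) (snd ks) W) (uniform_assignment n (fst ks * fst ks))"

primrec stages :: "nat \<Rightarrow> nat set set \<Rightarrow> (nat \<Rightarrow> nat) \<Rightarrow> (nat \<times> nat) list \<Rightarrow> (nat set \<Rightarrow> nat) \<Rightarrow> (nat set \<Rightarrow> nat) pmf" where
  "stages n E \<beta> [] W = return_pmf W"
| "stages n E \<beta> (ks # kss) W = bind_pmf (stage_pmf n E \<beta> ks W) (stages n E \<beta> kss)"

text \<open>Each phase uses k = 2 ^ (8 e) with the scales k, sqrt k and 1. It aims at n 2 ^ (15 e)
  active edges, and \<open>e - e div 16\<close> is 15 e / 16 rounded up.\<close>

fun phases :: "nat \<Rightarrow> (nat \<times> nat) list" where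
  "phases e = (if e \<le> 16 then [] else
     (2 ^ (8 * e), 2 ^ (8 * e)) # (2 ^ (8 * e), 2 ^ (4 * e)) # (2 ^ (8 * e), 1) # phases (e - e div 16))"

declare phases.simps [simp del]

lemma stages_append: "stages n E \<beta> (xs @ ys) W = bind_pmf (stages n E \<beta> xs W) (stages n E \<beta> ys)"
proof (induction xs arbitrary: W)
  case (Cons a xs)
  then have "stages n E \<beta> (xs @ ys) = (\<lambda>W. bind_pmf (stages n E \<beta> xs W) (stages n E \<beta> ys))" by blast
  then show ?case by (simp add: bind_assoc_pmf)
qed (simp add: bind_return_pmf)

lemma set_uniform_assignment: "Q > 0 \<Longrightarrow> set_pmf (uniform_assignment n Q) = assignments n Q"
  unfolding uniform_assignment_def by (intro set_pmf_of_set assignments_nonempty finite_assignments)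

context bgraph
begin

abbreviation "sp \<equiv> stage_pmf n E \<beta>"

lemma set_stage_pmf: "k > 0 \<Longrightarrow> set_pmf (sp (k, s) W) = stg k s W ` assignments n (k * k)"
  by (simp add: stage_pmf_def set_uniform_assignment)

text \<open>\<open>sum_heavy\<close> with \<rho> = q ^ 2 and k = q ^ 8: the three terms have orders
  q ^ -2, q ^ -8 and q ^ -4, and since q is at least 2 ^ 16 they sum to at most 2 / q ^ 2.\<close>

lemma expected_heavy:
  fixes q :: real and e :: nat
  defines "q \<equiv> 2 ^ e"
  assumes e: "e > 16" and k: "k = 2 ^ (8 * e)" "k \<le> 8 * n" and s: "s > 0" and few: "card (ac W) \<le> n * 2 ^ (16 * e)"
  shows "(\<integral>\<^sup>+ Y. ennreal (real (heavy n (ac Y) \<beta> k s)) \<partial>measure_pmf (sp (k, s) W)) \<le> ennreal (4 * real n * q ^ 14)"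
proof -
  let ?Z = "assignments n (k * k)"
  have q: "q \<ge> 2 ^ 16" unfolding q_def using e by (intro power_increasing) auto
  have kq: "real k = q ^ 8" by (simp add: k q_def mult.commute flip: power_mult)
  have k0: "k > 0" using k by simp
  have k100: "k \<ge> 100"
  proof -
    have "(100::nat) \<le> 2 ^ 7" by simp
    also have "\<dots> \<le> k" unfolding k using e by (intro power_increasing) auto
    finally show ?thesis .
  qed
  have kk: "k * k = 2 ^ (16 * e)" by (simp add: k flip: power_add)
  have kn: "k \<le> 8 * n * s" using k(2) s by (metis le_trans mult.right_neutral mult_le_mono2 One_nat_def Suc_leI)
  have cZ: "card ?Z > 0" using k0 by (intro card_assignments_pos) simp
  have "(\<Sum>\<zeta>\<in>?Z. real (heavy n (ac (stg k s W \<zeta>)) \<beta> k s))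
    \<le> 2 * real (card (ac W)) * (1 / real (2 ^ (2 * e)) + 68 / k + 16 * (real (2 ^ (2 * e)))\<^sup>2 / k) * card ?Z"
    using sum_heavy[OF oa_exists[of "8 * e", folded k(1)] k100 kn s, where W = W and \<rho> = "2 ^ (2 * e)"] few
    by (simp add: kk)
  also have "\<dots> \<le> (4 * real n * q ^ 14) * card ?Z"
  proof (rule mult_right_mono)
    have rq: "real (2 ^ (2 * e)) = q ^ 2" by (simp add: q_def mult.commute flip: power_mult)
    have q0: "q > 0" by (simp add: q_def)
    have "1 / real (2 ^ (2 * e)) + 68 / k + 16 * (real (2 ^ (2 * e)))\<^sup>2 / k = 1 / q\<^sup>2 * (1 + 68 / q ^ 6 + 16 / q\<^sup>2)"
    proof -
      have e8: "q ^ 8 = q\<^sup>2 * q ^ 6" "q ^ 8 = q ^ 4 * q ^ 4" by (simp_all flip: power_add)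
      have "68 / q ^ 8 = 1 / q\<^sup>2 * (68 / q ^ 6)" unfolding e8(1) by simp
      moreover have "16 * (q\<^sup>2)\<^sup>2 / q ^ 8 = 1 / q\<^sup>2 * (16 / q\<^sup>2)"
      proof -
        have q4: "(q\<^sup>2)\<^sup>2 = q ^ 4" by (simp flip: power_mult)
        have "16 * (q\<^sup>2)\<^sup>2 / q ^ 8 = 16 / q ^ 4"
          unfolding q4 e8(2) using q0 by (intro mult_divide_mult_cancel_right) simp
        also have "\<dots> = 1 / q\<^sup>2 * (16 / q\<^sup>2)" by simp
        finally show ?thesis .
      qed
      ultimately show ?thesis unfolding rq kq by (simp only: distrib_left mult_1_right)
    qed
    also have "\<dots> \<le> 1 / q\<^sup>2 * 2"
    proof (rule mult_left_mono)
      have "(2 ^ 16 :: real) ^ 2 \<le> q ^ 2" using q by (intro power_mono) auto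
      then have "16 / q\<^sup>2 \<le> 1 / 2" using q0 by (simp add: divide_simps)
      moreover have "(2 ^ 16 :: real) ^ 6 \<le> q ^ 6" using q by (intro power_mono) auto
      then have "68 / q ^ 6 \<le> 1 / 2" using q0 by (simp add: divide_simps)
      ultimately show "1 + 68 / q ^ 6 + 16 / q\<^sup>2 \<le> 2" by linarith
    qed auto
    finally have A: "1 / real (2 ^ (2 * e)) + 68 / k + 16 * (real (2 ^ (2 * e)))\<^sup>2 / k \<le> 2 / q\<^sup>2" by simp
    have "real (card (ac W)) \<le> real (n * 2 ^ (16 * e))" using few by (simp only: of_nat_le_iff)
    also have "\<dots> = real n * q ^ 16" by (simp add: q_def mult.commute flip: power_mult)
    finally have B: "2 * real (card (ac W)) \<le> 2 * (real n * q ^ 16)" by simp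
    have "2 * real (card (ac W)) * (1 / real (2 ^ (2 * e)) + 68 / k + 16 * (real (2 ^ (2 * e)))\<^sup>2 / k)
      \<le> 2 * (real n * q ^ 16) * (2 / q\<^sup>2)"
      using A B q0 by (intro mult_mono) auto
    also have "\<dots> = 4 * real n * q ^ 14"
    proof -
      have "q ^ 16 = q ^ 14 * q\<^sup>2" by (simp flip: power_add)
      moreover have "2 * (a * (b * c)) * (2 / c) = 4 * a * b" if "c \<noteq> 0" for a b c :: real
        using that by simp
      ultimately show ?thesis using q0 by (metis power_not_zero less_irrefl)
    qed
    finally show "2 * real (card (ac W)) * (1 / real (2 ^ (2 * e)) + 68 / k + 16 * (real (2 ^ (2 * e)))\<^sup>2 / k) \<le> 4 * real n * q ^ 14" .
  qed simp
  finally have S: "(\<Sum>\<zeta>\<in>?Z. real (heavy n (ac (stg k s W \<zeta>)) \<beta> k s)) \<le> (4 * real n * q ^ 14) * card ?Z" .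
  have "(\<integral>\<^sup>+ Y. ennreal (real (heavy n (ac Y) \<beta> k s)) \<partial>measure_pmf (sp (k, s) W))
    = (\<Sum>\<zeta>\<in>?Z. ennreal (real (heavy n (ac (stg k s W \<zeta>)) \<beta> k s))) / card ?Z"
    unfolding stage_pmf_def uniform_assignment_def
    using assignments_nonempty[of "k * k" n] finite_assignments[of n "k * k"] k0
    by (simp add: nn_integral_pmf_of_set)
  also have "\<dots> = ennreal ((\<Sum>\<zeta>\<in>?Z. real (heavy n (ac (stg k s W \<zeta>)) \<beta> k s)) / card ?Z)"
    using cZ by (subst sum_ennreal) (auto simp: divide_ennreal sum_nonneg ennreal_of_nat_eq_real_of_nat)
  also have "\<dots> \<le> ennreal (4 * real n * q ^ 14)"
    using S cZ by (intro ennreal_leI) (simp add: field_simps)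
  finally show ?thesis .
qed

text \<open>An end with budget below \<open>T\<close> is either heavy or has degree at most 16 k (T
  div s).\<close>

lemma card_by_budget:
  assumes A: "A \<subseteq> E"
  shows "card {e \<in> A. (\<forall>u\<in>e. s \<le> \<beta> u) \<and> (\<exists>u\<in>e. \<beta> u < T)} \<le> heavy n A \<beta> k s + n * (16 * k * (T div s))"
proof -
  have fA: "finite A" using A finE by (rule finite_subset)
  let ?S = "\<lambda>u. {e \<in> A. u \<in> e \<and> (\<forall>w\<in>e. s \<le> \<beta> w)}"
  let ?H = "{v. v < n \<and> 16 * k * (\<beta> v div s) < deg A \<beta> s v}"
  let ?N = "{v. v < n \<and> \<not> 16 * k * (\<beta> v div s) < deg A \<beta> s v \<and> \<beta> v < T}"
  have "{e \<in> A. (\<forall>u\<in>e. s \<le> \<beta> u) \<and> (\<exists>u\<in>e. \<beta> u < T)} \<subseteq> (\<Union>v\<in>?H. ?S v) \<union> (\<Union>v\<in>?N. ?S v)"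
  proof
    fix e assume e: "e \<in> {e \<in> A. (\<forall>u\<in>e. s \<le> \<beta> u) \<and> (\<exists>u\<in>e. \<beta> u < T)}"
    then obtain u where u: "u \<in> e" "\<beta> u < T" by auto
    have "u < n" using u e A edgeE(1) by blast
    then show "e \<in> (\<Union>v\<in>?H. ?S v) \<union> (\<Union>v\<in>?N. ?S v)"
      using e u by (cases "16 * k * (\<beta> u div s) < deg A \<beta> s u") auto
  qed
  then have "card {e \<in> A. (\<forall>u\<in>e. s \<le> \<beta> u) \<and> (\<exists>u\<in>e. \<beta> u < T)} \<le> card ((\<Union>v\<in>?H. ?S v) \<union> (\<Union>v\<in>?N. ?S v))"
    using fA by (intro card_mono) auto
  also have "\<dots> \<le> card (\<Union>v\<in>?H. ?S v) + card (\<Union>v\<in>?N. ?S v)" by (rule card_Un_le)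
  also have "card (\<Union>v\<in>?H. ?S v) \<le> (\<Sum>v\<in>?H. card (?S v))" by (rule card_UN_le) simp
  also have "(\<Sum>v\<in>?H. card (?S v)) = heavy n A \<beta> k s" by (simp add: heavy_def deg_def)
  also have "card (\<Union>v\<in>?N. ?S v) \<le> (\<Sum>v\<in>?N. card (?S v))" by (rule card_UN_le) simp
  also have "(\<Sum>v\<in>?N. card (?S v)) \<le> (\<Sum>v\<in>?N. 16 * k * (T div s))"
  proof (rule sum_mono)
    fix v assume v: "v \<in> ?N"
    then have "card (?S v) \<le> 16 * k * (\<beta> v div s)" by (auto simp: deg_def)
    also have "\<dots> \<le> 16 * k * (T div s)" using v by (intro mult_left_mono div_le_mono) auto
    finally show "card (?S v) \<le> 16 * k * (T div s)" .
  qed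
  also have "\<dots> \<le> n * (16 * k * (T div s))"
  proof -
    have "card ?N \<le> card {..<n}" by (rule card_mono) auto
    then have "card ?N * (16 * k * (T div s)) \<le> n * (16 * k * (T div s))" by (intro mult_right_mono) auto
    then show ?thesis by simp
  qed
  finally show ?thesis by simp
qed

text \<open>An edge with large budgets surviving the following stage failed the finishing test, so
  one end had degree above 16 \<beta> u, which is beyond the heavy threshold at scale
  \<open>k\<close>.\<close>

lemma card_unfinished:
  assumes X2: "X2 = stg k s X1 \<zeta>"
  shows "card {e \<in> ac X2. \<forall>u\<in>e. k \<le> \<beta> u} \<le> heavy n (ac X1) \<beta> k k"
proof -
  let ?S = "\<lambda>u. {e \<in> ac X1. u \<in> e \<and> (\<forall>w\<in>e. k \<le> \<beta> w)}"
  let ?H = "{v. v < n \<and> 16 * k * (\<beta> v div k) < deg (ac X1) \<beta> k v}"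
  have "{e \<in> ac X2. \<forall>u\<in>e. k \<le> \<beta> u} \<subseteq> (\<Union>v\<in>?H. ?S v)"
  proof
    fix e assume e: "e \<in> {e \<in> ac X2. \<forall>u\<in>e. k \<le> \<beta> u}"
    then have e1: "e \<in> ac X1" using ac_stage X2 by blast
    have "X2 e < n" using e by (simp add: act_def active_def)
    then have "\<not> finished (deg (ac X1) \<beta> k) \<beta> k e" using e1 by (auto simp: X2 stage_def split: if_splits)
    then obtain u where u: "u \<in> e" "deg (ac X1) \<beta> k u > 16 * \<beta> u" using e by (auto simp: finished_def not_le)
    have "16 * k * (\<beta> u div k) \<le> 16 * \<beta> u" by simp
    then have "16 * k * (\<beta> u div k) < deg (ac X1) \<beta> k u" using u by linarith
    moreover have "u < n" using u e1 ac_sub edgeE(1) by blast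
    ultimately show "e \<in> (\<Union>v\<in>?H. ?S v)" using u e e1 by auto
  qed
  then have "card {e \<in> ac X2. \<forall>u\<in>e. k \<le> \<beta> u} \<le> card (\<Union>v\<in>?H. ?S v)"
    using fin_ac by (intro card_mono) auto
  also have "\<dots> \<le> (\<Sum>v\<in>?H. card (?S v))" by (rule card_UN_le) simp
  also have "\<dots> = heavy n (ac X1) \<beta> k k" by (simp add: heavy_def deg_def)
  finally show ?thesis .
qed

text \<open>Edges are split by their smaller budget: at least \<open>k\<close>, from
  \<open>s\<close> up to \<open>k\<close>, and below \<open>s\<close>. The heavy terms of the scales
  \<open>k\<close>, \<open>s\<close> and 1 account for these ranges in turn.\<close>

lemma card_ac_phase:
  assumes X2: "X2 = stg k s X1 \<zeta>" and X3: "ac X3 \<subseteq> ac X2"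
  shows "card (ac X3) \<le> heavy n (ac X1) \<beta> k k + heavy n (ac X2) \<beta> k s + heavy n (ac X3) \<beta> k 1
    + n * (16 * k * (k div s)) + n * (16 * k * s)"
proof -
  let ?a = "{e \<in> ac X2. \<forall>u\<in>e. k \<le> \<beta> u}"
  let ?b = "{e \<in> ac X2. (\<forall>u\<in>e. s \<le> \<beta> u) \<and> (\<exists>u\<in>e. \<beta> u < k)}"
  let ?c = "{e \<in> ac X3. (\<forall>u\<in>e. 1 \<le> \<beta> u) \<and> (\<exists>u\<in>e. \<beta> u < s)}"
  have "ac X3 \<subseteq> ?a \<union> ?b \<union> ?c"
  proof
    fix e assume e: "e \<in> ac X3"
    then have "e \<subseteq> {..<n}" using ac_sub edgeE(1) by blast
    then have "\<forall>u\<in>e. 1 \<le> \<beta> u" using \<beta>0 by (force simp: Suc_le_eq)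
    then show "e \<in> ?a \<union> ?b \<union> ?c" using e X3 by (auto simp: not_le)
  qed
  then have "card (ac X3) \<le> card (?a \<union> ?b \<union> ?c)" using fin_ac by (intro card_mono) auto
  also have "\<dots> \<le> card ?a + card ?b + card ?c"
    by (meson add_mono_thms_linordered_semiring(3) card_Un_le le_trans)
  finally show ?thesis
    using card_unfinished[OF X2] card_by_budget[OF ac_sub[of X2], where s = s and T = k and k = k]
      card_by_budget[OF ac_sub[of X3], where s = 1 and T = s and k = k]
    by simp
qed

lemma nn_integral_pmf_add_const:
  fixes f :: "'a \<Rightarrow> ennreal"
  shows "(\<integral>\<^sup>+ x. c + f x \<partial>measure_pmf p) = c + (\<integral>\<^sup>+ x. f x \<partial>measure_pmf p)"
  by (subst nn_integral_add) (auto simp: measure_pmf.emeasure_space_1)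

text \<open>Three heavy terms of 4 n q ^ 14 each. As k div s = s = q ^ 4, the two deterministic
  terms are 16 n q ^ 12 each, together at most n q ^ 14.\<close>

lemma expected_phase:
  fixes q :: real and e :: nat
  defines "q \<equiv> 2 ^ e"
  assumes e: "e > 16" and k: "k = 2 ^ (8 * e)" "k \<le> 8 * n" and few: "card (ac W) \<le> n * 2 ^ (16 * e)"
  shows "(\<integral>\<^sup>+ Y. ennreal (real (card (ac Y))) \<partial>measure_pmf (stages n E \<beta> [(k, k), (k, 2 ^ (4 * e)), (k, 1)] W))
    \<le> ennreal (13 * real n * q ^ 14)"
proof -
  define s :: nat where "s = 2 ^ (4 * e)"
  define B where "B = 4 * real n * q ^ 14"
  define C where "C = n * (16 * k * (k div s)) + n * (16 * k * s)"
  have k0: "k > 0" and s0: "s > 0" by (simp_all add: k s_def)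
  have B0: "B \<ge> 0" by (simp add: B_def q_def)
  have fewer: "card (ac Y) \<le> n * 2 ^ (16 * e)" if "ac Y \<subseteq> ac W" for Y
    using card_mono[OF fin_ac that] few by simp
  have sub: "ac Y \<subseteq> ac Z" if "Y \<in> set_pmf (sp (k, t) Z)" for Y Z t
    using that by (auto simp: set_stage_pmf[OF k0] dest: subsetD[OF ac_stage])
  have eh: "(\<integral>\<^sup>+ Y. ennreal (real (heavy n (ac Y) \<beta> k t)) \<partial>measure_pmf (sp (k, t) Z)) \<le> ennreal B"
    if "ac Z \<subseteq> ac W" "t > 0" for Z t
    unfolding B_def q_def by (rule expected_heavy[OF e k that(2) fewer[OF that(1)]])
  let ?h = "\<lambda>t Y. ennreal (real (heavy n (ac Y) \<beta> k t))"
  have in3: "(\<integral>\<^sup>+ X3. ennreal (real (card (ac X3))) \<partial>measure_pmf (sp (k, 1) X2)) \<le> ?h k X1 + (?h s X2 + (ennreal C + ennreal B))"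
    if X1: "X1 \<in> set_pmf (sp (k, k) W)" and X2: "X2 \<in> set_pmf (sp (k, s) X1)" for X1 X2
  proof -
    obtain \<zeta> where \<zeta>: "X2 = stg k s X1 \<zeta>" using X2 by (auto simp: set_stage_pmf[OF k0])
    have "(\<integral>\<^sup>+ X3. ennreal (real (card (ac X3))) \<partial>measure_pmf (sp (k, 1) X2))
      \<le> (\<integral>\<^sup>+ X3. (?h k X1 + ?h s X2 + ennreal C) + ?h 1 X3 \<partial>measure_pmf (sp (k, 1) X2))"
    proof (rule nn_integral_mono_AE, rule AE_pmfI)
      fix X3 assume X3: "X3 \<in> set_pmf (sp (k, 1) X2)"
      have "card (ac X3) \<le> heavy n (ac X1) \<beta> k k + heavy n (ac X2) \<beta> k s + C + heavy n (ac X3) \<beta> k 1"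
        using card_ac_phase[OF \<zeta> sub[OF X3]] by (simp add: C_def)
      then have "real (card (ac X3)) \<le> real (heavy n (ac X1) \<beta> k k) + real (heavy n (ac X2) \<beta> k s) + real C + real (heavy n (ac X3) \<beta> k 1)"
        by linarith
      then show "ennreal (real (card (ac X3))) \<le> (?h k X1 + ?h s X2 + ennreal C) + ?h 1 X3"
        by (simp add: ennreal_leI flip: ennreal_plus)
    qed
    also have "\<dots> = (?h k X1 + ?h s X2 + ennreal C) + (\<integral>\<^sup>+ X3. ?h 1 X3 \<partial>measure_pmf (sp (k, 1) X2))"
      by (rule nn_integral_pmf_add_const)
    also have "\<dots> \<le> (?h k X1 + ?h s X2 + ennreal C) + ennreal B"
      using sub[OF X1] sub[OF X2] by (intro add_left_mono eh) auto
    finally show ?thesis by (simp add: add.assoc)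
  qed
  have in2: "(\<integral>\<^sup>+ X2. \<integral>\<^sup>+ X3. ennreal (real (card (ac X3))) \<partial>measure_pmf (sp (k, 1) X2) \<partial>measure_pmf (sp (k, s) X1))
      \<le> (ennreal C + ennreal B + ennreal B) + ?h k X1" if X1: "X1 \<in> set_pmf (sp (k, k) W)" for X1
  proof -
    have "(\<integral>\<^sup>+ X2. \<integral>\<^sup>+ X3. ennreal (real (card (ac X3))) \<partial>measure_pmf (sp (k, 1) X2) \<partial>measure_pmf (sp (k, s) X1))
      \<le> (\<integral>\<^sup>+ X2. (?h k X1 + ennreal C + ennreal B) + ?h s X2 \<partial>measure_pmf (sp (k, s) X1))"
      using in3[OF X1] by (intro nn_integral_mono_AE AE_pmfI) (simp add: add_ac)
    also have "\<dots> = (?h k X1 + ennreal C + ennreal B) + (\<integral>\<^sup>+ X2. ?h s X2 \<partial>measure_pmf (sp (k, s) X1))"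
      by (rule nn_integral_pmf_add_const)
    also have "\<dots> \<le> (?h k X1 + ennreal C + ennreal B) + ennreal B"
      using sub[OF X1] s0 by (intro add_left_mono eh) auto
    finally show ?thesis by (simp add: add_ac)
  qed
  have "(\<integral>\<^sup>+ Y. ennreal (real (card (ac Y))) \<partial>measure_pmf (stages n E \<beta> [(k, k), (k, 2 ^ (4 * e)), (k, 1)] W))
    = (\<integral>\<^sup>+ X1. \<integral>\<^sup>+ X2. \<integral>\<^sup>+ X3. ennreal (real (card (ac X3))) \<partial>measure_pmf (sp (k, 1) X2) \<partial>measure_pmf (sp (k, s) X1) \<partial>measure_pmf (sp (k, k) W))"
    by (simp add: s_def bind_return_pmf')
  also have "\<dots> \<le> (\<integral>\<^sup>+ X1. (ennreal C + ennreal B + ennreal B) + ?h k X1 \<partial>measure_pmf (sp (k, k) W))"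
    using in2 by (intro nn_integral_mono_AE AE_pmfI)
  also have "\<dots> = (ennreal C + ennreal B + ennreal B) + (\<integral>\<^sup>+ X1. ?h k X1 \<partial>measure_pmf (sp (k, k) W))"
    by (rule nn_integral_pmf_add_const)
  also have "\<dots> \<le> (ennreal C + ennreal B + ennreal B) + ennreal B"
    using k0 by (intro add_left_mono eh) auto
  also have "\<dots> = ennreal (real C + 3 * B)" using B0 by (simp flip: ennreal_plus)
  also have "\<dots> \<le> ennreal (13 * real n * q ^ 14)"
  proof (rule ennreal_leI)
    have q: "q \<ge> 2 ^ 16" unfolding q_def using e by (intro power_increasing) auto
    have kq: "real k = q ^ 8" by (simp add: k q_def mult.commute flip: power_mult)
    have sq: "real s = q ^ 4" by (simp add: s_def q_def mult.commute flip: power_mult)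
    have ks: "k div s = s"
    proof -
      have "k = s * s" by (simp add: k s_def flip: power_add)
      then show ?thesis using s0 by simp
    qed
    have "real C = 32 * real n * q ^ 12" by (simp add: C_def ks kq sq flip: power_add)
    also have "\<dots> \<le> q\<^sup>2 * real n * q ^ 12"
    proof -
      have "(2 ^ 16 :: real) ^ 2 \<le> q ^ 2" using q by (intro power_mono) auto
      then have "32 \<le> q\<^sup>2" by simp
      then show ?thesis by (intro mult_right_mono) (auto simp: q_def)
    qed
    also have "\<dots> = real n * q ^ 14" by (simp flip: power_add)
    finally show "real C + 3 * B \<le> 13 * real n * q ^ 14" by (simp add: B_def)
  qed
  finally show ?thesis .
qed

text \<open>By Markov's inequality a phase misses its target with probability at most 13 / 2 ^ e.
  Since the exponent falls by at least 1 per phase, these probabilities are dominated by a geometric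
  series; the bound is its telescoping form.\<close>

lemma phases_fail:
  assumes "card (ac W) \<le> n * 2 ^ (16 * e)" "16 < e \<Longrightarrow> 2 ^ (8 * e) \<le> 8 * n"
  shows "emeasure (measure_pmf (stages n E \<beta> (phases e) W)) {Y. card (ac Y) > n * 2 ^ 256}
    \<le> ennreal (26 / 2 ^ 16 - 26 / 2 ^ (max 16 e))"
  using assms
proof (induction e arbitrary: W rule: less_induct)
  case (less e)
  show ?case
  proof (cases "e \<le> 16")
    case True
    then have "(2::nat) ^ (16 * e) \<le> 2 ^ 256" by (intro power_increasing) auto
    then have "n * 2 ^ (16 * e) \<le> n * 2 ^ 256" by (rule mult_left_mono) simp
    then have "\<not> card (ac W) > n * 2 ^ 256" using less.prems(1) by linarith
    then have "emeasure (measure_pmf (return_pmf W)) {Y. card (ac Y) > n * 2 ^ 256} = 0"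
      by (simp add: emeasure_return_pmf)
    then show ?thesis using True by (simp add: phases.simps[of e] max_def)
  next
    case False
    then have e: "e > 16" by simp
    define e' where "e' = e - e div 16"
    define k :: nat where "k = 2 ^ (8 * e)"
    define q :: real where "q = 2 ^ e"
    define p where "p = stages n E \<beta> [(k, k), (k, 2 ^ (4 * e)), (k, 1)] W"
    define S where "S = {Y. card (ac Y) > n * 2 ^ 256}"
    have e': "e' < e" using e by (simp add: e'_def)
    have e'15: "15 * e \<le> 16 * e'" using times_div_less_eq_dividend[of 16 e] unfolding e'_def by linarith
    have q0: "q > 0" by (simp add: q_def)
    have "(2::nat) ^ (8 * e') \<le> 2 ^ (8 * e)" using e' by (intro power_increasing) auto
    then have kn': "2 ^ (8 * e') \<le> 8 * n" using less.prems(2)[OF e] by (rule order_trans)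
    have IH: "emeasure (measure_pmf (stages n E \<beta> (phases e') Y)) S \<le> ennreal (26 / 2 ^ 16 - 26 / 2 ^ (max 16 e'))"
      if "card (ac Y) \<le> n * 2 ^ (16 * e')" for Y
      unfolding S_def using less.IH[OF e' that kn'] .
    have Q: "real n * q ^ 15 > 0" using n0 q0 by simp
    \<comment> \<open>Either the phase met its target and the induction hypothesis applies, or the
      second summand is already at least 1.\<close>
    have pt: "emeasure (measure_pmf (stages n E \<beta> (phases e') Y)) S
      \<le> ennreal (26 / 2 ^ 16 - 26 / 2 ^ (max 16 e')) + ennreal (1 / (real n * q ^ 15)) * ennreal (real (card (ac Y)))" for Y
    proof (cases "card (ac Y) \<le> n * 2 ^ (16 * e')")
      case True
      then show ?thesis using IH by (meson add_increasing2 le_zero_eq order_trans zero_le)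
    next
      case False
      have "(2::real) ^ (15 * e) \<le> 2 ^ (16 * e')" using e'15 by (intro power_increasing) auto
      moreover have "q ^ 15 = 2 ^ (15 * e)" by (simp add: q_def mult.commute flip: power_mult)
      ultimately have "real n * q ^ 15 \<le> real n * 2 ^ (16 * e')" by (simp add: mult_left_mono)
      also have "\<dots> = real (n * 2 ^ (16 * e'))" by simp
      also have "\<dots> \<le> real (card (ac Y))" using False by linarith
      finally have "1 \<le> 1 / (real n * q ^ 15) * real (card (ac Y))" using Q by (simp add: field_simps)
      then have "(1 :: ennreal) \<le> ennreal (1 / (real n * q ^ 15)) * ennreal (real (card (ac Y)))"
        using Q by (simp flip: ennreal_mult' ennreal_1 add: ennreal_leI)
      moreover have "emeasure (measure_pmf (stages n E \<beta> (phases e') Y)) S \<le> 1"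
        by (rule measure_pmf.emeasure_le_1)
      ultimately show ?thesis by (meson add_increasing order_trans zero_le)
    qed
    have "emeasure (measure_pmf (stages n E \<beta> (phases e) W)) S
      = (\<integral>\<^sup>+ Y. emeasure (measure_pmf (stages n E \<beta> (phases e') Y)) S \<partial>measure_pmf p)"
    proof -
      have "phases e = [(k, k), (k, 2 ^ (4 * e)), (k, 1)] @ phases e'"
        using e by (simp add: phases.simps[of e] e'_def k_def)
      then show ?thesis unfolding p_def by (simp only: stages_append emeasure_bind_pmf)
    qed
    also have "\<dots> \<le> (\<integral>\<^sup>+ Y. ennreal (26 / 2 ^ 16 - 26 / 2 ^ (max 16 e'))
        + ennreal (1 / (real n * q ^ 15)) * ennreal (real (card (ac Y))) \<partial>measure_pmf p)"
      by (intro nn_integral_mono pt)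
    also have "\<dots> = ennreal (26 / 2 ^ 16 - 26 / 2 ^ (max 16 e'))
        + ennreal (1 / (real n * q ^ 15)) * (\<integral>\<^sup>+ Y. ennreal (real (card (ac Y))) \<partial>measure_pmf p)"
      by (simp add: nn_integral_pmf_add_const nn_integral_cmult)
    also have "\<dots> \<le> ennreal (26 / 2 ^ 16 - 26 / 2 ^ (max 16 e'))
        + ennreal (1 / (real n * q ^ 15)) * ennreal (13 * real n * q ^ 14)"
      unfolding p_def q_def using less.prems(1) less.prems(2)[OF e]
      by (intro add_left_mono mult_left_mono expected_phase e) (auto simp: k_def)
    also have "\<dots> = ennreal (26 / 2 ^ 16 - 26 / 2 ^ (max 16 e') + 13 / q)"
    proof -
      have "ennreal (1 / (real n * q ^ 15)) * ennreal (13 * real n * q ^ 14) = ennreal (13 / q)"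
        
      proof -
        have "q ^ 15 = q ^ 14 * q" by (simp flip: power_Suc2)
        moreover have "1 / (a * (b * c)) * (13 * a * b) = 13 / c" if "a > 0" "b > 0" for a b c :: real
          using that by simp
        ultimately have "1 / (real n * q ^ 15) * (13 * real n * q ^ 14) = 13 / q"
          using n0 q0 by (metis of_nat_0_less_iff zero_less_power)
        then show ?thesis using q0 by (subst ennreal_mult[symmetric]) auto
      qed
      moreover have "(0::real) \<le> 26 / 2 ^ 16 - 26 / 2 ^ (max 16 e')"
      proof -
        have "(2::real) ^ 16 \<le> 2 ^ (max 16 e')" by (intro power_increasing) auto
        then show ?thesis by (simp add: field_simps)
      qed
      ultimately show ?thesis using q0 by (subst ennreal_plus) auto
    qed
    also have "\<dots> \<le> ennreal (26 / 2 ^ 16 - 26 / 2 ^ (max 16 e))"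
    proof (rule ennreal_leI)
      have "max 16 e' + 1 \<le> e" using e e' by simp
      then have "(2::real) ^ (max 16 e' + 1) \<le> 2 ^ e" by (intro power_increasing) auto
      then have "(2::real) ^ (max 16 e') * 2 \<le> q" by (simp add: q_def)
      then have "4 * (13 / q) \<le> 26 / 2 ^ (max 16 e')" using q0 by (simp add: field_simps)
      moreover have "26 / 2 ^ (max 16 e) = 2 * (13 / q)" using e by (simp add: q_def max_def)
      moreover have "0 \<le> 13 / q" using q0 by simp
      ultimately show "26 / 2 ^ 16 - 26 / 2 ^ (max 16 e') + 13 / q \<le> 26 / 2 ^ 16 - 26 / 2 ^ (max 16 e)"
        by linarith
    qed
    finally show ?thesis by (simp add: S_def)
  qed
qed

end

section \<open>Success probability of the whole computation\<close>

definition params :: "nat \<Rightarrow> (nat \<times> nat) list" where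
  "params e = phases e @ [(1, 1)]"

definition result :: "nat \<Rightarrow> nat set set \<Rightarrow> (nat \<Rightarrow> nat) \<Rightarrow> nat \<Rightarrow> nat set set pmf" where
  "result n E \<beta> e = bind_pmf (stages n E \<beta> (params e) (\<lambda>_. 0))
     (\<lambda>Y. map_pmf (pruned (192 * n) E \<beta> Y) (uniform_assignment n (192 * n)))"

lemma phases_ok: "(k, s) \<in> set (phases e) \<Longrightarrow> (\<exists>j. k = 2 ^ j \<and> j \<le> 8 * e) \<and> 0 < s \<and> s \<le> k"
proof (induction e rule: less_induct)
  case (less e)
  show ?case
  proof (cases "e \<le> 16")
    case True
    then show ?thesis using less.prems by (simp add: phases.simps[of e])
  next
    case False
    have "(2::nat) ^ (4 * e) \<le> 2 ^ (8 * e)" by (intro power_increasing) auto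
    moreover have "e - e div 16 < e" using False by simp
    moreover have "(k, s) \<in> {(2 ^ (8 * e), 2 ^ (8 * e)), (2 ^ (8 * e), 2 ^ (4 * e)), (2 ^ (8 * e), 1)} \<union> set (phases (e - e div 16))"
      using less.prems False by (subst (asm) phases.simps) auto
    moreover have "\<exists>j. k = 2 ^ j \<and> j \<le> 8 * e" if ex: "\<exists>j. k = 2 ^ j \<and> j \<le> 8 * (e - e div 16)"
    proof -
      obtain j where "k = 2 ^ j" "j \<le> 8 * (e - e div 16)" using ex by blast
      moreover have "8 * (e - e div 16) \<le> 8 * e" by simp
      ultimately show ?thesis by (intro exI[of _ j]) linarith
    qed
    ultimately show ?thesis using less.IH[of "e - e div 16"] by fastforce
  qed
qed

lemma params_ok: "(k, s) \<in> set (params e) \<Longrightarrow> (\<exists>j. k = 2 ^ j \<and> j \<le> 8 * e) \<and> 0 < s \<and> s \<le> k"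
proof -
  assume "(k, s) \<in> set (params e)"
  then consider "(k, s) \<in> set (phases e)" | "k = 2 ^ 0" "s = 1" by (auto simp: params_def)
  then show ?thesis
  proof cases
    case 1
    then show ?thesis by (rule phases_ok)
  next
    case 2
    then show ?thesis by (auto intro!: exI[of _ 0])
  qed
qed

context bgraph
begin

lemma stages_feasible:
  assumes "\<And>k s. (k, s) \<in> set ps \<Longrightarrow> (\<exists>j. k = 2 ^ j) \<and> 0 < s \<and> s \<le> k"
    and "feasible W" "Y \<in> set_pmf (stages n E \<beta> ps W)"
  shows "feasible Y"
  using assms
proof (induction ps arbitrary: W)
  case (Cons a ps)
  obtain k s where a: "a = (k, s)" by force
  have ks: "\<exists>j. k = 2 ^ j" "0 < s" "s \<le> k" using Cons.prems(1)[of k s] a by auto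
  then have k0: "k > 0" by simp
  obtain Z where Z: "Z \<in> set_pmf (sp (k, s) W)" "Y \<in> set_pmf (stages n E \<beta> ps Z)"
    using Cons.prems(3) by (auto simp: a)
  have "feasible Z"
    using Z(1) ks oa_exists Cons.prems(2) by (auto simp: set_stage_pmf[OF k0] intro!: stage_feasible)
  then show ?case using Cons.IH[OF _ _ Z(2)] Cons.prems(1) by auto
qed simp

lemma feasible_zero: "feasible (\<lambda>_. 0)" by (simp add: feasible_def wload_def)

text \<open>The expected size is at least opt / 13056, where 13056 = 34 * 2 * 192, and no outcome
  exceeds opt. Hence half of this size, opt / 26112, is reached with probability at least 1 /
  26112.\<close>

lemma rounding_succeeds:
  assumes Y: "feasible Y" and cert: "n * max_b_matching_size {..<n} E \<beta> \<le> 34 * (\<Sum>e\<in>E. Y e)"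
  shows "emeasure (measure_pmf (map_pmf (pruned (192 * n) E \<beta> Y) (uniform_assignment n (192 * n))))
    {M. approx_b_matching (1 / 26112) {..<n} E \<beta> M} \<ge> ennreal (1 / 26112)"
proof -
  define opt where "opt = max_b_matching_size {..<n} E \<beta>"
  let ?R = "assignments n (192 * n)"
  let ?c = "\<lambda>r. card (pruned (192 * n) E \<beta> Y r)"
  define G where "G = {r \<in> ?R. real (?c r) \<ge> 1 / 26112 * opt}"
  have H: "HS = 192 * n" by (simp add: hash_size_def)
  have fR: "finite ?R" "?R \<noteq> {}" using finite_assignments assignments_nonempty n0 by auto
  have cR: "card ?R > 0" using fR by (simp add: card_gt_0_iff)
  have le: "?c r \<le> opt" for r
    unfolding opt_def using pruned_b_matching[of Y r] by (intro card_le_max_b_matching_size finE) (simp add: H)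
  have "real n * (real opt * card ?R) \<le> 34 * real (\<Sum>e\<in>E. Y e) * card ?R"
  proof -
    have "real (n * opt) \<le> real (34 * (\<Sum>e\<in>E. Y e))" using cert unfolding opt_def by (simp only: of_nat_le_iff)
    then have "real (n * opt) * card ?R \<le> real (34 * (\<Sum>e\<in>E. Y e)) * card ?R" by (rule mult_right_mono) simp
    then show ?thesis by simp
  qed
  also have "\<dots> = 34 * (real (\<Sum>e\<in>E. Y e) * card ?R)" by simp
  also have "\<dots> \<le> 34 * (2 * real (192 * n) * (\<Sum>r\<in>?R. real (?c r)))"
    using sum_pruned[OF Y] unfolding H by (intro mult_left_mono) auto
  also have "\<dots> = real n * (13056 * (\<Sum>r\<in>?R. real (?c r)))" by simp
  finally have "real opt * card ?R \<le> 13056 * (\<Sum>r\<in>?R. real (?c r))" using n0 by simp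
  also have "(\<Sum>r\<in>?R. real (?c r)) \<le> (\<Sum>r\<in>?R. (if r \<in> G then real opt else 0) + 1 / 26112 * opt)"
  proof (rule sum_mono)
    fix r assume "r \<in> ?R"
    moreover have "real (?c r) \<le> real opt" using le by simp
    ultimately show "real (?c r) \<le> (if r \<in> G then real opt else 0) + 1 / 26112 * opt"
      by (auto simp: G_def not_le)
  qed
  also have "\<dots> = real opt * card G + card ?R * (1 / 26112 * opt)"
  proof -
    have "?R \<inter> {r. r \<in> G} = G" by (auto simp: G_def)
    then show ?thesis using fR by (simp add: sum.distrib sum.If_cases)
  qed
  finally have "real opt * card ?R \<le> real opt * (26112 * real (card G))" by simp
  then have main: "real (card ?R) \<le> 26112 * real (card G)"
  proof (cases "opt = 0")
    case True
    then have "G = ?R" by (simp add: G_def)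
    then show ?thesis by simp
  qed simp
  have "emeasure (measure_pmf (map_pmf (pruned (192 * n) E \<beta> Y) (uniform_assignment n (192 * n))))
    {M. approx_b_matching (1 / 26112) {..<n} E \<beta> M}
    = ennreal (real (card (?R \<inter> {r. approx_b_matching (1 / 26112) {..<n} E \<beta> (pruned (192 * n) E \<beta> Y r)})) / card ?R)"
    using fR by (simp add: uniform_assignment_def emeasure_pmf_of_set vimage_def)
  also have "?R \<inter> {r. approx_b_matching (1 / 26112) {..<n} E \<beta> (pruned (192 * n) E \<beta> Y r)} = G"
    using pruned_b_matching[of Y] by (auto simp: G_def approx_b_matching_def opt_def H)
  also have "ennreal (real (card G) / card ?R) \<ge> ennreal (1 / 26112)"
    using main cR by (intro ennreal_leI) (simp add: field_simps)
  finally show ?thesis .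
qed

text \<open>The phases meet the final target with probability at least 1/2, while feasibility holds
  in every outcome; from there the last stage and the rounding succeed with probability at least 1 /
  26112.\<close>

theorem result_approx:
  assumes E: "card E \<le> n * 2 ^ (16 * e)" and e: "16 < e \<Longrightarrow> 2 ^ (8 * e) \<le> 8 * n"
  shows "measure_pmf.prob (result n E \<beta> e) {M. approx_b_matching (1 / 26112) {..<n} E \<beta> M} \<ge> 1 / 52224"
proof -
  define X0 :: "nat set \<Rightarrow> nat" where "X0 = (\<lambda>_. 0)"
  define p where "p = stages n E \<beta> (phases e) X0"
  define A where "A = {M. approx_b_matching (1 / 26112) {..<n} E \<beta> M}"
  define B where "B = {Y. card (ac Y) > n * 2 ^ 256}"
  let ?round = "\<lambda>Y. map_pmf (pruned (192 * n) E \<beta> Y) (uniform_assignment n (192 * n))"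
  have "card (ac X0) \<le> n * 2 ^ (16 * e)" using card_mono[OF finE ac_sub[of X0]] E by simp
  then have fail: "emeasure (measure_pmf p) B \<le> ennreal (1 / 2)"
  proof -
    have "emeasure (measure_pmf p) B \<le> ennreal (26 / 2 ^ 16 - 26 / 2 ^ (max 16 e))"
      unfolding p_def B_def using \<open>card (ac X0) \<le> _\<close> e by (rule phases_fail)
    also have "\<dots> \<le> ennreal (1 / 2)" 
    proof (rule ennreal_leI)
      have "(0::real) \<le> 26 / 2 ^ (max 16 e)" by simp
      moreover have "(26::real) / 2 ^ 16 \<le> 1 / 2" by simp
      ultimately show "(26::real) / 2 ^ 16 - 26 / 2 ^ (max 16 e) \<le> 1 / 2" by linarith
    qed
    finally show ?thesis .
  qed
  then have "measure_pmf.prob p B \<le> 1 / 2"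
    unfolding measure_pmf.emeasure_eq_measure by (subst (asm) ennreal_le_iff) auto
  then have good: "measure_pmf.prob p (- B) \<ge> 1 / 2"
    by (simp add: measure_pmf.prob_compl[of B p, simplified] Compl_eq_Diff_UNIV)
  have each: "emeasure (measure_pmf (bind_pmf (sp (1, 1) Y) ?round)) A \<ge> ennreal (1 / 26112) * indicator (- B) Y"
    if Y: "Y \<in> set_pmf p" for Y
  proof (cases "Y \<in> B")
    case False
    have fY: "feasible Y"
    proof (rule stages_feasible[OF _ feasible_zero])
      show "Y \<in> set_pmf (stages n E \<beta> (phases e) (\<lambda>_. 0))" using Y by (simp add: p_def X0_def)
      show "(\<exists>j. k = 2 ^ j) \<and> 0 < s \<and> s \<le> k" if "(k, s) \<in> set (phases e)" for k s
        using phases_ok[OF that] by blast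
    qed
    have "ennreal (1 / 26112) = (\<integral>\<^sup>+ Z. ennreal (1 / 26112) \<partial>measure_pmf (sp (1, 1) Y))"
      by (simp add: measure_pmf.emeasure_space_1)
    also have "\<dots> \<le> (\<integral>\<^sup>+ Z. emeasure (measure_pmf (?round Z)) A \<partial>measure_pmf (sp (1, 1) Y))"
    proof (rule nn_integral_mono_AE, rule AE_pmfI)
      fix Z assume Z: "Z \<in> set_pmf (sp (1, 1) Y)"
      then obtain \<zeta> where \<zeta>: "Z = stg 1 1 Y \<zeta>" "\<zeta> \<in> assignments n 1" by (auto simp: set_stage_pmf)
      have oa1: "\<exists>L. is_oa 1 L" using oa_exists[of 0] by simp
      show "ennreal (1 / 26112) \<le> emeasure (measure_pmf (?round Z)) A"
        unfolding A_def
      proof (rule rounding_succeeds)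
        show "feasible Z" unfolding \<zeta> using \<zeta>(2) by (intro stage_feasible oa1 fY) auto
        show "n * max_b_matching_size {..<n} E \<beta> \<le> 34 * (\<Sum>e\<in>E. Z e)"
          unfolding \<zeta>(1) using False by (intro final_certificate oa1 \<zeta>(2)) (auto simp: B_def cap_def not_less mult.commute)
      qed
    qed
    finally show ?thesis using False by (simp add: indicator_def)
  qed (simp add: indicator_def)
  have "result n E \<beta> e = bind_pmf p (\<lambda>Y. bind_pmf (sp (1, 1) Y) ?round)"
    by (simp add: result_def params_def stages_append bind_assoc_pmf bind_return_pmf bind_return_pmf' p_def X0_def)
  then have "emeasure (measure_pmf (result n E \<beta> e)) A = (\<integral>\<^sup>+ Y. emeasure (measure_pmf (bind_pmf (sp (1, 1) Y) ?round)) A \<partial>measure_pmf p)"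
    by (simp only: emeasure_bind_pmf)
  also have "\<dots> \<ge> (\<integral>\<^sup>+ Y. ennreal (1 / 26112) * indicator (- B) Y \<partial>measure_pmf p)"
    by (intro nn_integral_mono_AE AE_pmfI each)
  also have "(\<integral>\<^sup>+ Y. ennreal (1 / 26112) * indicator (- B) Y \<partial>measure_pmf p) = ennreal (1 / 26112) * emeasure (measure_pmf p) (- B)"
    by (subst nn_integral_cmult_indicator) auto
  also have "\<dots> = ennreal (1 / 26112 * measure_pmf.prob p (- B))"
    unfolding measure_pmf.emeasure_eq_measure by (subst ennreal_mult) auto
  finally have "1 / 26112 * measure_pmf.prob p (- B) \<le> measure_pmf.prob (result n E \<beta> e) A"
    by (simp add: measure_pmf.emeasure_eq_measure)
  then show ?thesis using good by (simp add: A_def)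
qed

end

section \<open>Memory layout and communication\<close>

text \<open>Memory entries: \<open>EE u v x\<close> is the edge between \<open>u\<close> and \<open>v\<close> with weight \<open>x\<close> (or, on its way to a
  host, with sender \<open>x\<close>); \<open>EB v b\<close> is the budget \<open>b\<close> of \<open>v\<close> (or, in a reply, a matched edge).\<close>

datatype entry = EE nat nat nat | EB nat nat

text \<open>Parity tells the two kinds of entries apart. Pairing is quadratic and nested twice, so
  an entry with components of order n is a word of order n ^ 4.\<close>

fun enc :: "entry \<Rightarrow> nat" where
  "enc (EE u v x) = 2 * prod_encode (u, prod_encode (v, x))"
| "enc (EB v b) = 2 * prod_encode (v, b) + 1"

lemma inj_enc: "inj enc"
proof (rule injI)
  fix a b assume "enc a = enc b"
  then show "a = b"
  proof (cases a; cases b)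
    fix u v x w c assume "a = EE u v x" "b = EB w c"
    then show ?thesis using \<open>enc a = enc b\<close> by simp presburger
  next
    fix u v x w c assume "a = EB w c" "b = EE u v x"
    then show ?thesis using \<open>enc a = enc b\<close> by simp presburger
  qed simp_all
qed

definition dec :: "nat \<Rightarrow> entry" where "dec = the_inv enc"

lemma dec_enc [simp]: "dec (enc x) = x"
  unfolding dec_def by (rule the_inv_f_f[OF inj_enc])

lemma map_dec_enc [simp]: "map dec (map enc xs) = xs"
  by (induction xs) auto

lemma prod_encode_le: "prod_encode (a, b) \<le> (a + b + 1) * (a + b + 1)"
proof -
  have "2 * triangle (a + b) = (a + b) * (a + b + 1)"
    by (induction "a + b") (auto simp: triangle_def)
  then have "2 * prod_encode (a, b) \<le> (a + b) * (a + b + 1) + 2 * (a + b + 1)" by (simp add: prod_encode_def)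
  also have "\<dots> \<le> 2 * ((a + b + 1) * (a + b + 1))" by (simp add: algebra_simps)
  finally show ?thesis by simp
qed

lemma enc_EE_le:
  assumes "u \<le> N" "v \<le> N" "x \<le> N" "1 \<le> N"
  shows "enc (EE u v x) \<le> 242 * N ^ 4"
proof -
  have "prod_encode (v, x) \<le> (v + x + 1) * (v + x + 1)" by (rule prod_encode_le)
  also have "\<dots> \<le> (3 * N) * (3 * N)" using assms by (intro mult_mono) auto
  finally have 1: "prod_encode (v, x) \<le> 9 * (N * N)" by simp
  have NN: "N \<le> N * N" "1 \<le> N * N" using assms by auto
  have "prod_encode (u, prod_encode (v, x)) \<le> (u + prod_encode (v, x) + 1) * (u + prod_encode (v, x) + 1)"
    by (rule prod_encode_le)
  also have "\<dots> \<le> (11 * (N * N)) * (11 * (N * N))"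
  proof -
    have "u + prod_encode (v, x) + 1 \<le> 11 * (N * N)" using 1 NN assms by linarith
    then show ?thesis by (intro mult_mono) auto
  qed
  finally show ?thesis by (simp add: power4_eq_xxxx mult_ac)
qed

lemma enc_EB_le:
  assumes "v \<le> N" "x \<le> N" "1 \<le> N"
  shows "enc (EB v x) \<le> 242 * N ^ 4"
proof -
  have "prod_encode (v, x) \<le> (v + x + 1) * (v + x + 1)" by (rule prod_encode_le)
  also have "\<dots> \<le> (3 * N) * (3 * N)" using assms by (intro mult_mono) auto
  finally have "enc (EB v x) \<le> 18 * (N * N) + 1" by simp
  also have "\<dots> \<le> 19 * (N * N)" using assms by simp
  also have "\<dots> \<le> 19 * ((N * N) * (N * N))" using assms by (intro mult_left_mono) auto
  finally show ?thesis by (simp add: power4_eq_xxxx mult_ac)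
qed

text \<open>The leading count separates the entries from other words. As messages are appended to
  the kept words, \<open>aux\<close> of the next memory is the kept remainder followed by the
  inbox.\<close>

definition pack :: "entry list \<Rightarrow> nat list \<Rightarrow> nat list" where
  "pack rs xs = length rs # map enc rs @ xs"

definition recs :: "nat list \<Rightarrow> entry list" where "recs mem = map dec (take (hd mem) (tl mem))"

definition aux :: "nat list \<Rightarrow> nat list" where "aux mem = drop (hd mem) (tl mem)"

lemma recs_pack [simp]: "recs (pack rs xs) = rs" and aux_pack [simp]: "aux (pack rs xs) = xs"
  by (simp_all add: recs_def aux_def pack_def flip: map_map)

lemma pack_append: "pack rs xs @ ys = pack rs (xs @ ys)"
  by (simp add: pack_def)

section \<open>Summing a vector over all machines in two rounds\<close>

definition block :: "nat \<Rightarrow> (nat \<Rightarrow> nat) \<Rightarrow> nat \<Rightarrow> nat list" where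
  "block B c j = map (\<lambda>r. c (j * B + r)) [0..<B]"

text \<open>Machine \<open>j\<close> receives block \<open>j\<close> of every vector, adds these up
  and sends the sums to all machines. In either round a machine sends and receives P B words, the
  length of one vector.\<close>

definition block_sums :: "nat \<Rightarrow> nat \<Rightarrow> nat list \<Rightarrow> nat list" where
  "block_sums P B xs = map (\<lambda>r. \<Sum>j<P. xs ! (j * B + r)) [0..<B]"

lemma concat_blocks:
  "concat (map (\<lambda>i. map (f i) [0..<B]) [0..<P]) = map (\<lambda>x. f (x div B) (x mod B)) [0..<P * B]"
proof (induction P)
  case (Suc P)
  have "map (f P) [0..<B] = map (\<lambda>x. f (x div B) (x mod B)) [P * B..<P * B + B]"
    by (rule nth_equalityI) (auto simp: )
  moreover have "[0..<Suc P * B] = [0..<P * B] @ [P * B..<P * B + B]"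
  proof -
    have "Suc P * B = P * B + B" by simp
    then show ?thesis by (simp only: upt_add_eq_append[OF le0])
  qed
  ultimately show ?case using Suc by simp
qed simp

lemma block_index: "j < P \<Longrightarrow> r < B \<Longrightarrow> j * B + r < P * (B :: nat)"
proof -
  assume a: "j < P" "r < B"
  have "j * B + r < (j + 1) * B" using a by simp
  also have "\<dots> \<le> P * B" using a by (intro mult_right_mono) auto
  finally show ?thesis .
qed

lemma block_sums_inbox:
  "block_sums P B (concat (map (\<lambda>i. block B (c i) j) [0..<P])) = block B (\<lambda>x. \<Sum>i<P. c i x) j"
proof -
  have *: "(\<Sum>i<P. (map (\<lambda>x. c (x div B) (j * B + x mod B)) [0..<P * B]) ! (i * B + r)) = (\<Sum>i<P. c i (j * B + r))"
    if "r < B" for r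
    using that block_index[of _ P r B] by (intro sum.cong) auto
  show ?thesis unfolding block_sums_def block_def concat_blocks
    by (rule map_cong) (use * in auto)
qed

lemma concat_block: "concat (map (block B c) [0..<P]) = map c [0..<P * B]"
  unfolding block_def concat_blocks by simp

lemma length_inbox_blocks: "length (concat (map (\<lambda>i. block B (c i) j) [0..<P])) = P * B"
  unfolding block_def concat_blocks by simp

lemma deterministic_round:
  assumes "\<And>i. i < machines A n m \<Longrightarrow> step A n m t i (\<sigma> i) = return_pmf (f i)"
  shows "local_computations A n m t \<sigma> = return_pmf (\<lambda>i. if i < machines A n m then f i else ([], \<lambda>_. []))"
proof -
  have "local_computations A n m t \<sigma> = Pi_pmf {..<machines A n m} ([], \<lambda>_. []) (\<lambda>i. return_pmf (f i))"
    unfolding local_computations_def using assms by (intro Pi_pmf_cong) auto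
  then show ?thesis by simp
qed

text \<open>Only machine 0 draws, so the joint computation is a function of one draw; the others do
  not depend on it and may be evaluated at any \<open>w\<close>.\<close>

lemma one_random_round:
  assumes P: "machines A n m > 0"
    and 0: "step A n m t 0 (\<sigma> 0) = map_pmf (f 0) q"
    and "\<And>i. 0 < i \<Longrightarrow> i < machines A n m \<Longrightarrow> step A n m t i (\<sigma> i) = return_pmf (f i w)"
    and f: "\<And>i z. 0 < i \<Longrightarrow> f i z = f i w"
  shows "local_computations A n m t \<sigma> = map_pmf (\<lambda>z i. if i < machines A n m then f i z else ([], \<lambda>_. [])) q"
proof -
  let ?P = "machines A n m" and ?d = "([], \<lambda>_. [])"
  have ins: "{..<?P} = insert 0 {0<..<?P}" using P by auto
  have "local_computations A n m t \<sigma>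
      = Pi_pmf (insert 0 {0<..<?P}) ?d (\<lambda>i. if i = 0 then map_pmf (f 0) q else return_pmf (f i w))"
    unfolding local_computations_def ins using 0 assms(3) by (intro Pi_pmf_cong) auto
  also have "\<dots> = map_pmf (\<lambda>(y, g). g(0 := y)) (pair_pmf (map_pmf (f 0) q)
      (Pi_pmf {0<..<?P} ?d (\<lambda>i. if i = 0 then map_pmf (f 0) q else return_pmf (f i w))))"
    by (subst Pi_pmf_insert) auto
  also have "Pi_pmf {0<..<?P} ?d (\<lambda>i. if i = 0 then map_pmf (f 0) q else return_pmf (f i w))
      = Pi_pmf {0<..<?P} ?d (\<lambda>i. return_pmf (f i w))"
    by (intro Pi_pmf_cong) auto
  also have "\<dots> = return_pmf (\<lambda>i. if i \<in> {0<..<?P} then f i w else ?d)" by (subst Pi_pmf_return_pmf) auto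
  also have "map_pmf (\<lambda>(y, g). g(0 := y)) (pair_pmf (map_pmf (f 0) q) (return_pmf (\<lambda>i. if i \<in> {0<..<?P} then f i w else ?d)))
      = map_pmf (\<lambda>z. (\<lambda>i. if i \<in> {0<..<?P} then f i w else ?d)(0 := f 0 z)) q"
    by (simp add: pair_return_pmf2 map_pmf_comp o_def)
  also have "\<dots> = map_pmf (\<lambda>z i. if i < ?P then f i z else ?d) q"
  proof (intro map_pmf_cong refl ext)
    fix z i
    show "((\<lambda>i. if i \<in> {0<..<?P} then f i w else ?d)(0 := f 0 z)) i = (if i < ?P then f i z else ?d)"
      using P f[of i z] by (cases "i = 0") simp_all
  qed
  finally show ?thesis .
qed

definition size_exp :: "nat \<Rightarrow> nat \<Rightarrow> nat" where
  "size_exp n m = (LEAST e. m \<le> n * 2 ^ (16 * e))"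

text \<open>One machine per point of the largest plane, which has k = 2 ^ (8 e). Minimality of the
  exponent keeps the machines within the factor 2 ^ 16 of m / n + 1.\<close>

definition num_machines :: "nat \<Rightarrow> nat \<Rightarrow> nat" where "num_machines n m = 2 ^ (16 * size_exp n m)"

text \<open>Makes P blocks hold at least 3 n + P numbers: the first shared vector needs 3 n, the
  second P + n.\<close>

definition block_len :: "nat \<Rightarrow> nat \<Rightarrow> nat" where "block_len n m = 3 * n div num_machines n m + 2"

definition vec_len :: "nat \<Rightarrow> nat \<Rightarrow> nat" where "vec_len n m = num_machines n m * block_len n m"

text \<open>The memory size is odd because a machine with \<open>l\<close> items may have to hold the \<open>2 * l + 1\<close> words
  of its entries, their number and a reply for each of them.\<close>

definition memory :: "nat \<Rightarrow> nat" where "memory n = 2 ^ 260 * n + 1"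

lemma size_exp: "n > 0 \<Longrightarrow> m \<le> n * 2 ^ (16 * size_exp n m)"
proof -
  assume n: "n > 0"
  have "m < 2 ^ m" by (rule less_exp)
  also have "\<dots> \<le> 2 ^ (16 * m)" by (intro power_increasing) auto
  finally have "m \<le> 1 * 2 ^ (16 * m)" by simp
  also have "\<dots> \<le> n * 2 ^ (16 * m)" using n by (intro mult_right_mono) auto
  finally show ?thesis unfolding size_exp_def by (rule LeastI)
qed

lemma size_exp_minimal: "size_exp n m > 0 \<Longrightarrow> n * 2 ^ (16 * (size_exp n m - 1)) < m"
  using not_less_Least[of "size_exp n m - 1" "\<lambda>e. m \<le> n * 2 ^ (16 * e)"] by (simp add: size_exp_def)

lemma num_machines_le: "n > 0 \<Longrightarrow> num_machines n m * n \<le> 2 ^ 16 * (m + n)"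
proof (cases "size_exp n m = 0")
  case False
  then obtain d where d: "size_exp n m = Suc d" using not0_implies_Suc by blast
  have "num_machines n m = 2 ^ 16 * 2 ^ (16 * (size_exp n m - 1))"
    by (simp add: num_machines_def d power_add)
  then have "num_machines n m * n = 2 ^ 16 * (n * 2 ^ (16 * (size_exp n m - 1)))" by simp
  also have "\<dots> \<le> 2 ^ 16 * (m + n)" using size_exp_minimal[of n m] False by (intro mult_left_mono) auto
  finally show ?thesis .
qed (simp add: num_machines_def)

lemma card_edges_le:
  assumes "simple_graph {..<n} E" shows "card E \<le> n * n - n"
proof -
  have "card E \<le> card {p \<in> {..<n} \<times> {..<n}. fst p \<noteq> snd p}"
  proof (rule surj_card_le[of _ _ "\<lambda>p. {fst p, snd p}"])
    show "E \<subseteq> (\<lambda>p. {fst p, snd p}) ` {p \<in> {..<n} \<times> {..<n}. fst p \<noteq> snd p}"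
    proof
      fix e assume "e \<in> E"
      then have "e \<subseteq> {..<n}" "card e = 2" using assms by (auto simp: simple_graph_def)
      then obtain x y where "e = {x, y}" "x \<noteq> y" "x < n" "y < n" by (auto simp: card_2_iff)
      then show "e \<in> (\<lambda>p. {fst p, snd p}) ` {p \<in> {..<n} \<times> {..<n}. fst p \<noteq> snd p}"
        by (intro image_eqI[of _ _ "(x, y)"]) auto
    qed
  qed simp
  also have "{p \<in> {..<n} \<times> {..<n}. fst p \<noteq> snd p} = {..<n} \<times> {..<n} - (\<lambda>x. (x, x)) ` {..<n}" by auto
  also have "card \<dots> = n * n - n"
    by (subst card_Diff_subset) (auto simp: card_image inj_on_def)
  finally show ?thesis .
qed

section \<open>The algorithm\<close>

fun is_edge :: "entry \<Rightarrow> bool" where "is_edge (EE _ _ _) = True" | "is_edge (EB _ _) = False"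
fun entry_edge :: "entry \<Rightarrow> nat set" where "entry_edge (EE u v _) = {u, v}" | "entry_edge (EB _ _) = {}"
fun entry_val :: "entry \<Rightarrow> nat" where "entry_val (EE _ _ x) = x" | "entry_val (EB _ _) = 0"
fun set_val :: "nat \<Rightarrow> entry \<Rightarrow> entry" where "set_val x (EE u v _) = EE u v x" | "set_val x (EB v c) = EB v c"
fun entry_budget :: "entry \<Rightarrow> nat \<Rightarrow> nat" where
  "entry_budget (EB v c) w = (if v = w then c else 0)" | "entry_budget (EE _ _ _) w = 0"
fun reply_of :: "entry \<Rightarrow> entry" where "reply_of (EE u v _) = EB u v" | "reply_of (EB v c) = EB v c"
fun ends :: "entry \<Rightarrow> nat list" where "ends (EE u v _) = [u, v]" | "ends (EB _ _) = []"

text \<open>The first shared vector: \<open>n\<close> seeds supplied by machine 0, then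
  \<open>n\<close> loads, then \<open>n\<close> budgets.\<close>

definition contrib1 :: "nat \<Rightarrow> nat \<Rightarrow> (nat \<Rightarrow> nat) \<Rightarrow> entry list \<Rightarrow> nat \<Rightarrow> nat" where
  "contrib1 n i z rs x =
     (if x < n then if i = 0 then z x else 0
      else if x < 2 * n then \<Sum>r\<leftarrow>rs. if x - n \<in> entry_edge r then entry_val r else 0
      else \<Sum>r\<leftarrow>rs. entry_budget r (x - 2 * n))"

text \<open>The value 0 outside the range agrees with assignments, loads and truncated budgets
  there, so the recovered data are equal as functions.\<close>

definition slot :: "nat \<Rightarrow> nat list \<Rightarrow> nat \<Rightarrow> nat \<Rightarrow> nat" where
  "slot n xs d v = (if v < n then xs ! (d + v) else 0)"

definition e_active :: "nat \<Rightarrow> nat list \<Rightarrow> entry \<Rightarrow> bool" where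
  "e_active n xs r \<longleftrightarrow> is_edge r \<and> active n (slot n xs n) (slot n xs (2 * n)) (entry_val r) (entry_edge r)"

definition e_at :: "nat \<Rightarrow> nat \<Rightarrow> nat \<Rightarrow> nat list \<Rightarrow> nat \<Rightarrow> entry \<Rightarrow> bool" where
  "e_at n k s xs p r \<longleftrightarrow> e_active n xs r \<and> at_point k s (slot n xs (2 * n)) (slot n xs 0) p (entry_edge r)"

definition e_picked :: "nat \<Rightarrow> nat list \<Rightarrow> entry \<Rightarrow> bool" where
  "e_picked n xs r \<longleftrightarrow> is_edge r \<and> picked (192 * n) (slot n xs 0) (entry_val r) (entry_edge r)"

lemma not_EB: "\<not> e_active n xs (EB v c)" "\<not> e_at n k s xs p (EB v c)" "\<not> e_picked n xs (EB v c)"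
  by (auto simp: e_active_def e_at_def e_picked_def)

text \<open>The second shared vector: edge counts of the points, then per vertex the degree for the
  finishing test or, in the final rounding, the number of candidates.\<close>

fun contrib2 :: "nat \<Rightarrow> nat \<Rightarrow> (nat \<times> nat) option \<Rightarrow> nat list \<Rightarrow> entry list \<Rightarrow> nat \<Rightarrow> nat" where
  "contrib2 n P (Some (k, s)) xs rs x =
     (if x < P then if x < k * k then length (filter (e_at n k s xs x) rs) else 0
      else length (filter (\<lambda>r. e_active n xs r \<and> x - P \<in> entry_edge r \<and> (\<forall>u\<in>entry_edge r. k \<le> slot n xs (2 * n) u)) rs))"
| "contrib2 n P None xs rs x =
     (if x < P then 0 else length (filter (\<lambda>r. e_picked n xs r \<and> x - P \<in> entry_edge r) rs))"

definition finish_entry :: "nat \<Rightarrow> nat \<Rightarrow> nat \<Rightarrow> nat list \<Rightarrow> nat list \<Rightarrow> entry \<Rightarrow> entry" where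
  "finish_entry n P k xs ys r =
     (if e_active n xs r \<and> finished (slot n ys P) (slot n xs (2 * n)) k (entry_edge r)
      then set_val (entry_val r + n) r else r)"

text \<open>The counts are known everywhere, so edges of an overfull point are never sent. The value
  field carries the sender, to whom the reply goes.\<close>

definition to_host :: "nat \<Rightarrow> nat \<Rightarrow> nat \<Rightarrow> nat list \<Rightarrow> nat list \<Rightarrow> nat \<Rightarrow> entry list \<Rightarrow> nat \<Rightarrow> entry list" where
  "to_host n k s xs ys i rs p =
     (if p < k * k \<and> ys ! p \<le> cap n then map (set_val i) (filter (e_at n k s xs p) rs) else [])"

definition host_matching :: "nat \<Rightarrow> nat \<Rightarrow> nat list \<Rightarrow> entry list \<Rightarrow> nat set set" where
  "host_matching n s xs is = opt_matching n (entry_edge ` set is) (\<lambda>v. slot n xs (2 * n) v div s)"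

definition replies :: "nat \<Rightarrow> nat \<Rightarrow> nat list \<Rightarrow> entry list \<Rightarrow> nat \<Rightarrow> entry list" where
  "replies n s xs is h =
     map reply_of (filter (\<lambda>r. entry_edge r \<in> host_matching n s xs is \<and> entry_val r = h) is)"

definition merge :: "nat \<Rightarrow> nat \<Rightarrow> nat \<Rightarrow> entry list \<Rightarrow> entry \<Rightarrow> entry" where
  "merge n k s reps r =
     (if is_edge r \<and> reply_of r \<in> set reps then set_val (entry_val r + weight n k s) r else r)"

definition kept_ends :: "nat \<Rightarrow> nat \<Rightarrow> nat list \<Rightarrow> nat list \<Rightarrow> entry list \<Rightarrow> nat list" where
  "kept_ends n P xs ys rs =
     concat (map ends (filter (\<lambda>r. e_picked n xs r \<and> (\<forall>w\<in>entry_edge r. slot n ys P w \<le> slot n xs (2 * n) w)) rs))"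

definition stage_of :: "nat \<Rightarrow> nat \<Rightarrow> nat \<Rightarrow> (nat \<times> nat) option" where
  "stage_of n m j = (let ps = params (size_exp n m) in if j < length ps then Some (ps ! j) else None)"

definition seed_range :: "nat \<Rightarrow> (nat \<times> nat) option \<Rightarrow> nat" where
  "seed_range n ks = (case ks of Some (k, s) \<Rightarrow> k * k | None \<Rightarrow> 192 * n)"

text \<open>Seven rounds per stage: two to share each vector, one to finish edges and send active
  ones to their points, one to match and reply, one to add the weights. After the last stage the
  fifth round writes the output instead, hence the final 5 in \<open>rounds\<close>.\<close>

definition out :: "nat \<Rightarrow> nat \<Rightarrow> nat \<Rightarrow> nat \<Rightarrow> (nat \<Rightarrow> nat) \<Rightarrow> nat list \<Rightarrow> nat list \<times> (nat \<Rightarrow> nat list)" where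
  "out n m t i z mem =
    (let P = num_machines n m; B = block_len n m; L = vec_len n m; rs = recs mem; xs = aux mem;
         ks = stage_of n m (t div 7) in
     if t mod 7 = 0 then (pack rs [], block B (contrib1 n i z rs))
     else if t mod 7 = 1 then (pack rs [], \<lambda>_. block_sums P B xs)
     else if t mod 7 = 2 then (pack rs xs, block B (contrib2 n P ks xs rs))
     else if t mod 7 = 3 then (pack rs (take L xs), \<lambda>_. block_sums P B (drop L xs))
     else case ks of
       None \<Rightarrow> (kept_ends n P (take L xs) (drop L xs) rs, \<lambda>_. [])
     | Some (k, s) \<Rightarrow>
         if t mod 7 = 4 then
           (pack (map (finish_entry n P k (take L xs) (drop L xs)) rs) (take L xs),
            \<lambda>p. map enc (to_host n k s (take L xs) (drop L xs) i rs p))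
         else if t mod 7 = 5 then
           (pack rs [], \<lambda>h. map enc (replies n s (take L xs) (map dec (drop L xs)) h))
         else (pack (map (merge n k s (map dec xs)) rs) [], \<lambda>_. []))"

text \<open>A vertex has fewer than \<open>n\<close> edges, so its budget may be cut to
  \<open>n\<close>, which makes it a word.\<close>

fun entry_of :: "nat \<Rightarrow> (nat set \<Rightarrow> nat) \<Rightarrow> item \<Rightarrow> entry" where
  "entry_of n W (Edge e) = EE (Min e) (Max e) (W e)"
| "entry_of n W (Budget v c) = EB v (min c n)"

definition bmatch_algorithm :: mpc_algorithm where
  "bmatch_algorithm =
    \<lparr>machines = num_machines, local_memory = (\<lambda>n m. memory n),
     rounds = (\<lambda>n m. 7 * length (params (size_exp n m)) + 5),
     load = (\<lambda>n m i items. pack (map (entry_of n (\<lambda>_. 0)) items) []),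
     step = (\<lambda>n m t i mem. map_pmf (\<lambda>z. out n m t i z mem)
       (if t mod 7 = 0 \<and> i = 0 then uniform_assignment n (seed_range n (stage_of n m (t div 7)))
        else return_pmf (\<lambda>_. 0)))\<rparr>"

lemma communicate_fun:
  "communicate P (\<lambda>i. if i < P then f i else d)
    = (\<lambda>i. if i < P then fst (f i) @ concat (map (\<lambda>j. snd (f j) i) [0..<P]) else [])"
proof -
  have "concat (map (\<lambda>j. snd (if j < P then f j else d) i) [0..<P]) = concat (map (\<lambda>j. snd (f j) i) [0..<P])" for i
    by (intro arg_cong[where f = concat] map_cong) auto
  then show ?thesis unfolding communicate_def inbox_def by (intro ext) auto
qed

section \<open>The shared vectors and memories in terms of the graph\<close>

locale simulation =
  fixes n m :: nat and E :: "nat set set" and b :: "nat \<Rightarrow> nat" and D :: "nat \<Rightarrow> item list"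
  assumes n0: "n > 0" and graph: "simple_graph {..<n} E" and cardE: "card E = m"
    and b0: "\<And>v. v < n \<Longrightarrow> b v > 0"
    and dist: "input_distribution (num_machines n m) (memory n) {..<n} E b D"
begin

abbreviation "P \<equiv> num_machines n m"
abbreviation "B \<equiv> block_len n m"
abbreviation "L \<equiv> vec_len n m"
definition \<beta> :: "nat \<Rightarrow> nat" where "\<beta> v = (if v < n then min (b v) n else 0)"
abbreviation "ps \<equiv> params (size_exp n m)"
definition es :: "(nat set \<Rightarrow> nat) \<Rightarrow> nat \<Rightarrow> entry list" where "es W i = map (entry_of n W) (D i)"

sublocale bgraph n E \<beta>
  by unfold_locales (use n0 graph b0 in \<open>auto simp: \<beta>_def\<close>)

lemma P0: "P > 0" by (simp add: num_machines_def)

lemma L_def': "L = P * B" by (simp add: vec_len_def)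

lemma L_ge: "3 * n + P \<le> L"
proof -
  have "3 * n < P * (3 * n div P) + P" using P0 by (metis add.commute dividend_less_times_div)
  then show ?thesis unfolding vec_len_def block_len_def by (simp add: distrib_left)
qed

lemma D_items: "i < P \<Longrightarrow> it \<in> set (D i) \<Longrightarrow> it \<in> input_items {..<n} E b"
  using dist unfolding input_distribution_def by auto

lemma D_cover: "it \<in> input_items {..<n} E b \<Longrightarrow> \<exists>i<P. it \<in> set (D i)"
  using dist unfolding input_distribution_def by fastforce

lemma ends_eq: "e \<in> E \<Longrightarrow> {Min e, Max e} = e"
proof -
  assume e: "e \<in> E"
  obtain x y where xy: "e = {x, y}" using edgeE(2)[OF e] by (auto simp: card_2_iff)
  then show ?thesis by (cases "x \<le> y") (auto simp: min_def max_def)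
qed

lemma entry_edge_eq: "e \<in> E \<Longrightarrow> entry_edge (EE (Min e) (Max e) x) = e"
  by (simp add: ends_eq)

lemma ac_E: "e \<in> ac W \<Longrightarrow> e \<in> E"
  using ac_sub by blast

lemma sum_items:
  fixes f :: "item \<Rightarrow> nat"
  shows "(\<Sum>i<P. \<Sum>it\<leftarrow>D i. f it) = (\<Sum>e\<in>E. f (Edge e)) + (\<Sum>v<n. f (Budget v (b v)))"
proof -
  have "(\<Sum>i<P. \<Sum>it\<leftarrow>D i. f it) = sum_list (map f (concat (map D [0..<P])))"
  proof -
    have "sum_list (map f (concat xss)) = (\<Sum>xs\<leftarrow>xss. \<Sum>it\<leftarrow>xs. f it)" for xss
      by (induction xss) auto
    then show ?thesis by (simp add: o_def interv_sum_list_conv_sum_set_nat atLeast0LessThan)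
  qed
  also have "\<dots> = sum f (input_items {..<n} E b)"
    using dist unfolding input_distribution_def by (metis sum_list_distinct_conv_sum_set)
  also have "\<dots> = sum f (Edge ` E) + sum f ((\<lambda>v. Budget v (b v)) ` {..<n})"
    unfolding input_items_def using finE by (intro sum.union_disjoint) auto
  also have "\<dots> = (\<Sum>e\<in>E. f (Edge e)) + (\<Sum>v<n. f (Budget v (b v)))"
    by (simp add: sum.reindex inj_on_def)
  finally show ?thesis .
qed

lemma sum_entries:
  "(\<Sum>i<P. \<Sum>r\<leftarrow>es W i. f r) = (\<Sum>e\<in>E. f (EE (Min e) (Max e) (W e))) + (\<Sum>v<n. f (EB v (min (b v) n)) :: nat)"
  using sum_items[of "\<lambda>it. f (entry_of n W it)"] by (simp add: es_def o_def)

lemma count_entries: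
  assumes "\<And>v c. \<not> Q (EB v c)"
  shows "(\<Sum>i<P. length (filter Q (es W i))) = card {e \<in> E. Q (EE (Min e) (Max e) (W e))}"
proof -
  have "length (filter Q rs) = (\<Sum>r\<leftarrow>rs. if Q r then 1 else 0)" for rs by (induction rs) auto
  then have "(\<Sum>i<P. length (filter Q (es W i))) = (\<Sum>e\<in>E. if Q (EE (Min e) (Max e) (W e)) then 1 else 0)"
    using sum_entries[where W = W and f = "\<lambda>r. if Q r then 1 else 0"] assms by simp
  then show ?thesis using finE by (simp add: sum.If_cases Int_def)
qed

definition V1 :: "(nat set \<Rightarrow> nat) \<Rightarrow> (nat \<Rightarrow> nat) \<Rightarrow> nat list" where
  "V1 W \<zeta> = map (\<lambda>x. \<Sum>i<P. contrib1 n i \<zeta> (es W i) x) [0..<L]"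

lemma length_V1 [simp]: "length (V1 W \<zeta>) = L" by (simp add: V1_def)

lemma sum_contrib1:
  shows "x < n \<Longrightarrow> (\<Sum>i<P. contrib1 n i \<zeta> (es W i) x) = \<zeta> x"
    and "v < n \<Longrightarrow> (\<Sum>i<P. contrib1 n i \<zeta> (es W i) (n + v)) = ld W v"
    and "(\<Sum>i<P. contrib1 n i \<zeta> (es W i) (2 * n + v)) = \<beta> v"
proof -
  show "(\<Sum>i<P. contrib1 n i \<zeta> (es W i) x) = \<zeta> x" if "x < n"
    using that P0 by (simp add: contrib1_def)
  show "(\<Sum>i<P. contrib1 n i \<zeta> (es W i) (n + v)) = ld W v" if "v < n"
  proof -
    have "(\<Sum>i<P. contrib1 n i \<zeta> (es W i) (n + v)) = (\<Sum>i<P. \<Sum>r\<leftarrow>es W i. if v \<in> entry_edge r then entry_val r else 0)"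
      using that by (simp add: contrib1_def)
    also have "\<dots> = (\<Sum>e\<in>E. if v \<in> e then W e else 0)"
      unfolding sum_entries using ends_eq by (auto intro!: sum.cong)
    also have "\<dots> = ld W v" unfolding wload_def using finE by (simp add: sum.If_cases Int_def)
    finally show ?thesis .
  qed
  show "(\<Sum>i<P. contrib1 n i \<zeta> (es W i) (2 * n + v)) = \<beta> v"
  proof -
    have "(\<Sum>i<P. contrib1 n i \<zeta> (es W i) (2 * n + v)) = (\<Sum>i<P. \<Sum>r\<leftarrow>es W i. entry_budget r v)"
      by (simp add: contrib1_def)
    also have "\<dots> = (\<Sum>w<n. if w = v then min (b w) n else 0)" unfolding sum_entries by simp
    also have "\<dots> = \<beta> v" by (simp add: \<beta>_def)
    finally show ?thesis .
  qed
qed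

lemma slot_V1:
  assumes "\<zeta> \<in> assignments n Q"
  shows "slot n (V1 W \<zeta>) 0 = \<zeta>" "slot n (V1 W \<zeta>) n = ld W" "slot n (V1 W \<zeta>) (2 * n) = \<beta>"
proof -
  have ld0: "ld W v = 0" if "\<not> v < n" for v
  proof -
    have "{e. e \<in> E \<and> v \<in> e} = {}" using that edgeE(1) by blast
    then show ?thesis unfolding wload_def by (simp only: sum.empty)
  qed
  show "slot n (V1 W \<zeta>) 0 = \<zeta>"
  proof
    fix v show "slot n (V1 W \<zeta>) 0 v = \<zeta> v"
      using assms L_ge sum_contrib1(1)[of v \<zeta> W] by (cases "v < n") (auto simp: slot_def V1_def assignments_iff not_less)
  qed
  show "slot n (V1 W \<zeta>) n = ld W"
  proof
    fix v show "slot n (V1 W \<zeta>) n v = ld W v"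
      using L_ge sum_contrib1(2)[of v \<zeta> W] ld0[of v] by (cases "v < n") (auto simp: slot_def V1_def)
  qed
  show "slot n (V1 W \<zeta>) (2 * n) = \<beta>"
  proof
    fix v show "slot n (V1 W \<zeta>) (2 * n) v = \<beta> v"
      using L_ge sum_contrib1(3)[of \<zeta> W v] by (cases "v < n") (auto simp: slot_def V1_def \<beta>_def)
  qed
qed

definition V2 :: "(nat \<times> nat) option \<Rightarrow> (nat set \<Rightarrow> nat) \<Rightarrow> (nat \<Rightarrow> nat) \<Rightarrow> nat list" where
  "V2 ks W \<zeta> = map (\<lambda>x. \<Sum>i<P. contrib2 n P ks (V1 W \<zeta>) (es W i) x) [0..<L]"

lemma length_V2 [simp]: "length (V2 ks W \<zeta>) = L" by (simp add: V2_def)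

context
  fixes W :: "nat set \<Rightarrow> nat" and \<zeta> :: "nat \<Rightarrow> nat" and Q :: nat
  assumes \<zeta>: "\<zeta> \<in> assignments n Q"
begin

lemma e_active_iff: "e \<in> E \<Longrightarrow> e_active n (V1 W \<zeta>) (EE (Min e) (Max e) (W e)) \<longleftrightarrow> e \<in> ac W"
  by (simp add: e_active_def slot_V1[OF \<zeta>] ends_eq act_def)

lemma e_at_iff: "e \<in> E \<Longrightarrow> e_at n k s (V1 W \<zeta>) p (EE (Min e) (Max e) (W e)) \<longleftrightarrow> e \<in> point_edges (ac W) \<beta> k s \<zeta> p"
  by (simp add: e_at_def e_active_iff slot_V1[OF \<zeta>] ends_eq point_edges_def)

lemma e_picked_iff: "e \<in> E \<Longrightarrow> e_picked n (V1 W \<zeta>) (EE (Min e) (Max e) (W e)) \<longleftrightarrow> e \<in> candidates (192 * n) E W \<zeta>"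
  by (simp add: e_picked_def slot_V1[OF \<zeta>] ends_eq candidates_def)

lemma V2_count:
  assumes "k * k \<le> P" "p < k * k"
  shows "V2 (Some (k, s)) W \<zeta> ! p = card (point_edges (ac W) \<beta> k s \<zeta> p)"
proof -
  have "p < L" "p < P" using assms L_ge by auto
  then have "V2 (Some (k, s)) W \<zeta> ! p = (\<Sum>i<P. length (filter (e_at n k s (V1 W \<zeta>) p) (es W i)))"
    using assms by (simp add: V2_def)
  also have "\<dots> = card {e \<in> E. e_at n k s (V1 W \<zeta>) p (EE (Min e) (Max e) (W e))}"
    by (rule count_entries) (rule not_EB)
  also have "{e \<in> E. e_at n k s (V1 W \<zeta>) p (EE (Min e) (Max e) (W e))} = point_edges (ac W) \<beta> k s \<zeta> p"
  proof -
    have "(e \<in> E \<and> e_at n k s (V1 W \<zeta>) p (EE (Min e) (Max e) (W e))) = (e \<in> point_edges (ac W) \<beta> k s \<zeta> p)" for e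
      by (cases "e \<in> E") (auto simp: e_at_iff point_edges_def dest: ac_E)
    then show ?thesis by auto
  qed
  finally show ?thesis .
qed

lemma V2_deg: "slot n (V2 (Some (k, s)) W \<zeta>) P = deg (ac W) \<beta> k"
proof
  fix v
  show "slot n (V2 (Some (k, s)) W \<zeta>) P v = deg (ac W) \<beta> k v"
  proof (cases "v < n")
    case True
    then have "P + v < L" using L_ge by simp
    then have "slot n (V2 (Some (k, s)) W \<zeta>) P v = (\<Sum>i<P. length (filter (\<lambda>r. e_active n (V1 W \<zeta>) r \<and> v \<in> entry_edge r
        \<and> (\<forall>u\<in>entry_edge r. k \<le> slot n (V1 W \<zeta>) (2 * n) u)) (es W i)))"
      using True by (simp add: slot_def V2_def)
    also have "\<dots> = card {e \<in> E. e_active n (V1 W \<zeta>) (EE (Min e) (Max e) (W e)) \<and> v \<in> entry_edge (EE (Min e) (Max e) (W e))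
        \<and> (\<forall>u\<in>entry_edge (EE (Min e) (Max e) (W e)). k \<le> slot n (V1 W \<zeta>) (2 * n) u)}"
      by (rule count_entries) (simp add: not_EB)
    also have "\<dots> = deg (ac W) \<beta> k v"
    proof -
      have "{e \<in> E. e_active n (V1 W \<zeta>) (EE (Min e) (Max e) (W e)) \<and> v \<in> entry_edge (EE (Min e) (Max e) (W e))
        \<and> (\<forall>u\<in>entry_edge (EE (Min e) (Max e) (W e)). k \<le> slot n (V1 W \<zeta>) (2 * n) u)}
        = {e \<in> ac W. v \<in> e \<and> (\<forall>u\<in>e. k \<le> \<beta> u)}"
      proof (rule Collect_cong)
        fix e
        show "(e \<in> E \<and> e_active n (V1 W \<zeta>) (EE (Min e) (Max e) (W e)) \<and> v \<in> entry_edge (EE (Min e) (Max e) (W e))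
          \<and> (\<forall>u\<in>entry_edge (EE (Min e) (Max e) (W e)). k \<le> slot n (V1 W \<zeta>) (2 * n) u))
          = (e \<in> ac W \<and> v \<in> e \<and> (\<forall>u\<in>e. k \<le> \<beta> u))"
        proof (cases "e \<in> E")
          case True
          then show ?thesis unfolding entry_edge_eq[OF True] e_active_iff[OF True] slot_V1[OF \<zeta>] by simp
        qed (auto dest: ac_E)
      qed
      then show ?thesis by (simp only: deg_def)
    qed
    finally show ?thesis .
  next
    case False
    then have "{e \<in> ac W. v \<in> e \<and> (\<forall>u\<in>e. k \<le> \<beta> u)} = {}" using ac_sub edgeE(1) by blast
    then have "deg (ac W) \<beta> k v = 0" unfolding deg_def by (simp only: card.empty)
    then show ?thesis using False by (simp add: slot_def)
  qed
qed

lemma V2_candidates: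
  assumes v: "v < n"
  shows "slot n (V2 None W \<zeta>) P v = card {f \<in> candidates (192 * n) E W \<zeta>. v \<in> f}"
proof -
  have "P + v < L" using L_ge v by simp
  then have "slot n (V2 None W \<zeta>) P v = (\<Sum>i<P. length (filter (\<lambda>r. e_picked n (V1 W \<zeta>) r \<and> v \<in> entry_edge r) (es W i)))"
    using v by (simp add: slot_def V2_def)
  also have "\<dots> = card {e \<in> E. e_picked n (V1 W \<zeta>) (EE (Min e) (Max e) (W e)) \<and> v \<in> entry_edge (EE (Min e) (Max e) (W e))}"
    by (rule count_entries) (simp add: not_EB)
  also have "\<dots> = card {f \<in> candidates (192 * n) E W \<zeta>. v \<in> f}"
  proof (intro arg_cong[where f = card] Collect_cong)
    fix e
    show "(e \<in> E \<and> e_picked n (V1 W \<zeta>) (EE (Min e) (Max e) (W e)) \<and> v \<in> entry_edge (EE (Min e) (Max e) (W e)))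
      = (e \<in> candidates (192 * n) E W \<zeta> \<and> v \<in> e)"
    proof (cases "e \<in> E")
      case True
      then show ?thesis unfolding entry_edge_eq[OF True] e_picked_iff[OF True] by simp
    qed (auto simp: candidates_def)
  qed
  finally show ?thesis .
qed

end

end

lemma opt_matching_empty: "opt_matching n {} c = {}"
  using opt_matching_subset[of "{}"] by simp

context simulation
begin

definition guard :: "(nat \<Rightarrow> 'a list) \<Rightarrow> nat \<Rightarrow> 'a list" where
  "guard f = (\<lambda>i. if i < P then f i else [])"

text \<open>The weights after finishing, before the replies of the hosts arrive.\<close>

definition mid :: "nat \<Rightarrow> (nat set \<Rightarrow> nat) \<Rightarrow> nat set \<Rightarrow> nat" where
  "mid k W e = W e + (if e \<in> ac W \<and> finished (deg (ac W) \<beta> k) \<beta> k e then n else 0)"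

definition insts :: "nat \<Rightarrow> nat \<Rightarrow> (nat set \<Rightarrow> nat) \<Rightarrow> (nat \<Rightarrow> nat) \<Rightarrow> nat \<Rightarrow> entry list" where
  "insts k s W \<zeta> p = concat (map (\<lambda>i. to_host n k s (V1 W \<zeta>) (V2 (Some (k, s)) W \<zeta>) i (es W i) p) [0..<P])"

definition reps :: "nat \<Rightarrow> nat \<Rightarrow> (nat set \<Rightarrow> nat) \<Rightarrow> (nat \<Rightarrow> nat) \<Rightarrow> nat \<Rightarrow> entry list" where
  "reps k s W \<zeta> h = concat (map (\<lambda>p. replies n s (V1 W \<zeta>) (insts k s W \<zeta> p) h) [0..<P])"

text \<open>\<open>S0\<close> to \<open>S6\<close> are the memories before the seven rounds of a
  stage, \<open>SF\<close> is the output, and \<open>R0\<close> to \<open>RF\<close> are the local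
  results in between. All are functions of the weights and seeds only, which reduces the run to the
  abstract process.\<close>

definition S0 where "S0 W = guard (\<lambda>i. pack (es W i) [])"
definition S1 where "S1 W \<zeta> = guard (\<lambda>i. pack (es W i) (concat (map (\<lambda>j. block B (contrib1 n j \<zeta> (es W j)) i) [0..<P])))"
definition S2 where "S2 W \<zeta> = guard (\<lambda>i. pack (es W i) (V1 W \<zeta>))"
definition S3 where "S3 ks W \<zeta> = guard (\<lambda>i. pack (es W i)
  (V1 W \<zeta> @ concat (map (\<lambda>j. block B (contrib2 n P ks (V1 W \<zeta>) (es W j)) i) [0..<P])))"
definition S4 where "S4 ks W \<zeta> = guard (\<lambda>i. pack (es W i) (V1 W \<zeta> @ V2 ks W \<zeta>))"
definition S5 where "S5 k s W \<zeta> = guard (\<lambda>i. pack (es (mid k W) i) (V1 W \<zeta> @ map enc (insts k s W \<zeta> i)))"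
definition S6 where "S6 k s W \<zeta> = guard (\<lambda>i. pack (es (mid k W) i) (map enc (reps k s W \<zeta> i)))"
definition SF where "SF W \<zeta> = guard (\<lambda>i. kept_ends n P (V1 W \<zeta>) (V2 None W \<zeta>) (es W i))"

definition R0 where "R0 W \<zeta> i = (pack (es W i) [], block B (contrib1 n i \<zeta> (es W i)))"
definition R1 where "R1 W \<zeta> i = (pack (es W i) [], \<lambda>_::nat. block B (\<lambda>x. \<Sum>j<P. contrib1 n j \<zeta> (es W j) x) i)"
definition R2 where "R2 ks W \<zeta> i = (pack (es W i) (V1 W \<zeta>), block B (contrib2 n P ks (V1 W \<zeta>) (es W i)))"
definition R3 where "R3 ks W \<zeta> i = (pack (es W i) (V1 W \<zeta>),
  \<lambda>_::nat. block B (\<lambda>x. \<Sum>j<P. contrib2 n P ks (V1 W \<zeta>) (es W j) x) i)"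
definition R4 where "R4 k s W \<zeta> i = (pack (es (mid k W) i) (V1 W \<zeta>),
  \<lambda>p. map enc (to_host n k s (V1 W \<zeta>) (V2 (Some (k, s)) W \<zeta>) i (es W i) p))"
definition R5 where "R5 k s W \<zeta> i = (pack (es (mid k W) i) [], \<lambda>h. map enc (replies n s (V1 W \<zeta>) (insts k s W \<zeta> i) h))"
definition R6 where "R6 k s W \<zeta> i = (pack (es (stg k s W \<zeta>) i) [], \<lambda>_::nat. [] :: nat list)"
definition RF where "RF W \<zeta> i = (kept_ends n P (V1 W \<zeta>) (V2 None W \<zeta>) (es W i), \<lambda>_::nat. [] :: nat list)"

lemma insts_outside: "\<not> p < k * k \<Longrightarrow> insts k s W \<zeta> p = []"
  by (simp add: insts_def to_host_def)

abbreviation "comm R \<equiv> communicate P (\<lambda>i. if i < P then R i else ([], \<lambda>_. []))"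

lemma comm_R0: "comm (R0 W \<zeta>) = S1 W \<zeta>"
  unfolding communicate_fun S1_def guard_def
  by (rule ext) (simp add: R0_def pack_append)

lemma comm_R1: "comm (R1 W \<zeta>) = S2 W \<zeta>"
  unfolding communicate_fun S2_def guard_def
  by (rule ext) (simp add: R1_def pack_append concat_block V1_def L_def')

lemma comm_R2: "comm (R2 ks W \<zeta>) = S3 ks W \<zeta>"
  unfolding communicate_fun S3_def guard_def
  by (rule ext) (simp add: R2_def pack_append)

lemma comm_R3: "comm (R3 ks W \<zeta>) = S4 ks W \<zeta>"
  unfolding communicate_fun S4_def guard_def
  by (rule ext) (simp add: R3_def pack_append concat_block V2_def L_def')

lemma comm_R4: "comm (R4 k s W \<zeta>) = S5 k s W \<zeta>"
  unfolding communicate_fun S5_def guard_def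
  by (rule ext) (simp add: R4_def pack_append insts_def map_concat o_def)

lemma comm_R5: "comm (R5 k s W \<zeta>) = S6 k s W \<zeta>"
  unfolding communicate_fun S6_def guard_def
  by (rule ext) (simp add: R5_def pack_append reps_def map_concat o_def)

lemma comm_R6: "comm (R6 k s W \<zeta>) = S0 (stg k s W \<zeta>)"
proof -
  have "concat (map (\<lambda>j. []) xs) = []" for xs :: "nat list" by (induction xs) auto
  then show ?thesis unfolding communicate_fun S0_def guard_def by (intro ext) (simp add: R6_def)
qed

lemma comm_RF: "comm (RF W \<zeta>) = SF W \<zeta>"
proof -
  have "concat (map (\<lambda>j. []) xs) = []" for xs :: "nat list" by (induction xs) auto
  then show ?thesis unfolding communicate_fun SF_def guard_def by (intro ext) (simp add: RF_def)
qed

lemma D_edge: "i < P \<Longrightarrow> Edge e \<in> set (D i) \<Longrightarrow> e \<in> E"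
  using D_items by (fastforce simp: input_items_def)

lemma es_cong: "(\<And>e. Edge e \<in> set (D i) \<Longrightarrow> f (EE (Min e) (Max e) (W e)) = EE (Min e) (Max e) (Y e)) \<Longrightarrow>
  (\<And>v c. f (EB v c) = EB v c) \<Longrightarrow> map f (es W i) = es Y i"
  unfolding es_def
proof -
  assume a: "\<And>e. Edge e \<in> set (D i) \<Longrightarrow> f (EE (Min e) (Max e) (W e)) = EE (Min e) (Max e) (Y e)"
    "\<And>v c. f (EB v c) = EB v c"
  have "f (entry_of n W it) = entry_of n Y it" if "it \<in> set (D i)" for it
    using a that by (cases it) auto
  then show "map f (map (entry_of n W) (D i)) = map (entry_of n Y) (D i)" by simp
qed

context
  fixes W :: "nat set \<Rightarrow> nat" and \<zeta> :: "nat \<Rightarrow> nat" and Q :: nat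
  assumes \<zeta>: "\<zeta> \<in> assignments n Q"
begin

lemma es_finish:
  assumes "i < P"
  shows "map (finish_entry n P k (V1 W \<zeta>) (V2 (Some (k, s)) W \<zeta>)) (es W i) = es (mid k W) i"
proof (rule es_cong)
  fix e assume "Edge e \<in> set (D i)"
  then have e: "e \<in> E" using D_edge assms by blast
  show "finish_entry n P k (V1 W \<zeta>) (V2 (Some (k, s)) W \<zeta>) (EE (Min e) (Max e) (W e)) = EE (Min e) (Max e) (mid k W e)"
    unfolding finish_entry_def V2_deg[OF \<zeta>] slot_V1[OF \<zeta>] entry_edge_eq[OF e] e_active_iff[OF \<zeta> e]
    by (simp add: mid_def)
qed (simp add: finish_entry_def not_EB)

lemma set_to_host:
  assumes i: "i < P" and kP: "k * k \<le> P" and p: "p < k * k"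
  shows "set (to_host n k s (V1 W \<zeta>) (V2 (Some (k, s)) W \<zeta>) i (es W i) p) =
    (if card (point_edges (ac W) \<beta> k s \<zeta> p) \<le> cap n
     then {EE (Min e) (Max e) i |e. Edge e \<in> set (D i) \<and> e \<in> point_edges (ac W) \<beta> k s \<zeta> p} else {})"
proof -
  have "set_val i ` {r \<in> set (es W i). e_at n k s (V1 W \<zeta>) p r}
    = {EE (Min e) (Max e) i |e. Edge e \<in> set (D i) \<and> e \<in> point_edges (ac W) \<beta> k s \<zeta> p}"
  proof (intro equalityI subsetI)
    fix r assume "r \<in> set_val i ` {r \<in> set (es W i). e_at n k s (V1 W \<zeta>) p r}"
    then obtain it where it: "it \<in> set (D i)" "e_at n k s (V1 W \<zeta>) p (entry_of n W it)" "r = set_val i (entry_of n W it)"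
      by (auto simp: es_def)
    obtain e where e: "it = Edge e"
    proof (cases it)
      case (Budget v c)
      then show thesis using it(2) not_EB by simp
    qed (use that in blast)
    have eE: "e \<in> E" using it e D_edge i by blast
    then show "r \<in> {EE (Min e) (Max e) i |e. Edge e \<in> set (D i) \<and> e \<in> point_edges (ac W) \<beta> k s \<zeta> p}"
      using it e e_at_iff[OF \<zeta> eE] by auto
  next
    fix r assume "r \<in> {EE (Min e) (Max e) i |e. Edge e \<in> set (D i) \<and> e \<in> point_edges (ac W) \<beta> k s \<zeta> p}"
    then obtain e where e: "r = EE (Min e) (Max e) i" "Edge e \<in> set (D i)" "e \<in> point_edges (ac W) \<beta> k s \<zeta> p" by auto
    have eE: "e \<in> E" using e D_edge i by blast
    have "EE (Min e) (Max e) (W e) \<in> set (es W i)" using e by (force simp: es_def)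
    moreover have "e_at n k s (V1 W \<zeta>) p (EE (Min e) (Max e) (W e))" using e_at_iff[OF \<zeta> eE] e by simp
    ultimately show "r \<in> set_val i ` {r \<in> set (es W i). e_at n k s (V1 W \<zeta>) p r}"
      using e by (intro image_eqI[of _ _ "EE (Min e) (Max e) (W e)"]) auto
  qed
  then show ?thesis using p V2_count[OF \<zeta> kP p] by (simp add: to_host_def)
qed

lemma set_insts:
  assumes kP: "k * k \<le> P" and p: "p < k * k"
  shows "set (insts k s W \<zeta> p) =
    (if card (point_edges (ac W) \<beta> k s \<zeta> p) \<le> cap n
     then {EE (Min e) (Max e) i |e i. i < P \<and> Edge e \<in> set (D i) \<and> e \<in> point_edges (ac W) \<beta> k s \<zeta> p} else {})"
proof -
  have "set (insts k s W \<zeta> p) = (\<Union>i<P. set (to_host n k s (V1 W \<zeta>) (V2 (Some (k, s)) W \<zeta>) i (es W i) p))"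
    by (auto simp: insts_def)
  also have "\<dots> = (\<Union>i<P. if card (point_edges (ac W) \<beta> k s \<zeta> p) \<le> cap n
     then {EE (Min e) (Max e) i |e. Edge e \<in> set (D i) \<and> e \<in> point_edges (ac W) \<beta> k s \<zeta> p} else {})"
    using set_to_host[OF _ kP p] by (intro SUP_cong) auto
  finally show ?thesis by auto
qed

text \<open>An overfull point receives no edges, and the optimal matching of nothing is empty; this
  agrees with the convention of \<open>capped_matching\<close>.\<close>

lemma host_matching_eq:
  assumes kP: "k * k \<le> P"
  shows "host_matching n s (V1 W \<zeta>) (insts k s W \<zeta> p) = (if p < k * k then point_matching n (ac W) \<beta> k s \<zeta> p else {})"
proof (cases "p < k * k")
  case False
  then show ?thesis by (simp add: host_matching_def insts_outside opt_matching_empty)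
next
  case True
  let ?F = "point_edges (ac W) \<beta> k s \<zeta> p"
  have FE: "e \<in> E" if "e \<in> ?F" for e using that ac_E by (auto simp: point_edges_def)
  have "entry_edge ` set (insts k s W \<zeta> p) = (if card ?F \<le> cap n then ?F else {})"
  proof (cases "card ?F \<le> cap n")
    case True
    have cov: "\<exists>i<P. Edge e \<in> set (D i)" if "e \<in> ?F" for e
      using D_cover[of "Edge e"] FE[OF that] by (auto simp: input_items_def)
    have "entry_edge ` {EE (Min e) (Max e) i |e i. i < P \<and> Edge e \<in> set (D i) \<and> e \<in> ?F} = ?F"
    proof (intro equalityI subsetI)
      fix e assume e: "e \<in> ?F"
      then obtain i where "i < P" "Edge e \<in> set (D i)" using cov by blast
      then show "e \<in> entry_edge ` {EE (Min e) (Max e) i |e i. i < P \<and> Edge e \<in> set (D i) \<and> e \<in> ?F}"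
        using e entry_edge_eq[OF FE[OF e], of i] by (intro image_eqI[of _ _ "EE (Min e) (Max e) i"]) auto
    next
      fix e assume "e \<in> entry_edge ` {EE (Min e) (Max e) i |e i. i < P \<and> Edge e \<in> set (D i) \<and> e \<in> ?F}"
      then obtain e' i where "e = entry_edge (EE (Min e') (Max e') i)" "e' \<in> ?F" by blast
      then show "e \<in> ?F" using entry_edge_eq[OF FE] by simp
    qed
    then show ?thesis using True by (simp add: set_insts[OF kP \<open>p < k * k\<close>])
  qed (simp add: set_insts[OF kP \<open>p < k * k\<close>])
  then show ?thesis using True
    by (simp add: host_matching_def point_matching_def capped_matching_def slot_V1[OF \<zeta>] opt_matching_empty)
qed

text \<open>A reply carries only the two ends, but ordered by \<open>Min\<close> and
  \<open>Max\<close> they identify the edge; the sender field brings it back to the machine that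
  holds the edge.\<close>

lemma es_merge:
  assumes kP: "k * k \<le> P" and i: "i < P"
  shows "map (merge n k s (reps k s W \<zeta> i)) (es (mid k W) i) = es (stg k s W \<zeta>) i"
proof (rule es_cong)
  fix e assume eD: "Edge e \<in> set (D i)"
  then have e: "e \<in> E" using D_edge i by blast
  have "EB (Min e) (Max e) \<in> set (reps k s W \<zeta> i) \<longleftrightarrow> (\<exists>p<k * k. e \<in> point_matching n (ac W) \<beta> k s \<zeta> p)"
  proof
    assume "EB (Min e) (Max e) \<in> set (reps k s W \<zeta> i)"
    then obtain p r where pr: "p < P" "r \<in> set (insts k s W \<zeta> p)" "EB (Min e) (Max e) = reply_of r"
        "entry_edge r \<in> host_matching n s (V1 W \<zeta>) (insts k s W \<zeta> p)"
      by (auto simp: reps_def replies_def)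
    then have p: "p < k * k" using insts_outside by (metis empty_iff list.set(1))
    from pr(2) obtain e' i' where r: "r = EE (Min e') (Max e') i'"
      by (auto simp: set_insts[OF kP p] split: if_splits)
    then have "entry_edge r = {Min e, Max e}" using pr(3) by simp
    then have "entry_edge r = e" using ends_eq[OF e] by simp
    then show "\<exists>p<k * k. e \<in> point_matching n (ac W) \<beta> k s \<zeta> p"
      using pr(4) p by (auto simp: host_matching_eq[OF kP])
  next
    assume "\<exists>p<k * k. e \<in> point_matching n (ac W) \<beta> k s \<zeta> p"
    then obtain p where p: "p < k * k" "e \<in> point_matching n (ac W) \<beta> k s \<zeta> p" by blast
    have "card (point_edges (ac W) \<beta> k s \<zeta> p) \<le> cap n"
      using p(2) by (auto simp: point_matching_def capped_matching_def split: if_splits)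
    moreover have "e \<in> point_edges (ac W) \<beta> k s \<zeta> p" using p(2) pm_sub by blast
    ultimately have "EE (Min e) (Max e) i \<in> set (insts k s W \<zeta> p)"
      using i eD by (auto simp: set_insts[OF kP p(1)])
    moreover have "entry_edge (EE (Min e) (Max e) i) \<in> host_matching n s (V1 W \<zeta>) (insts k s W \<zeta> p)"
      unfolding entry_edge_eq[OF e] using p by (simp add: host_matching_eq[OF kP])
    ultimately have "EB (Min e) (Max e) \<in> set (replies n s (V1 W \<zeta>) (insts k s W \<zeta> p) i)"
      unfolding replies_def by (auto intro!: image_eqI[of _ _ "EE (Min e) (Max e) i"])
    moreover have "p < P" using p(1) kP by simp
    ultimately show "EB (Min e) (Max e) \<in> set (reps k s W \<zeta> i)" by (auto simp: reps_def)
  qed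
  then show "merge n k s (reps k s W \<zeta> i) (EE (Min e) (Max e) (mid k W e)) = EE (Min e) (Max e) (stg k s W \<zeta> e)"
    by (auto simp: merge_def stage_def mid_def)
qed (simp add: merge_def)

lemma output_eq: "(\<Union>i<P. decode_edges (SF W \<zeta> i)) = pruned (192 * n) E \<beta> W \<zeta>"
proof -
  let ?Q = "\<lambda>r. e_picked n (V1 W \<zeta>) r \<and> (\<forall>w\<in>entry_edge r. slot n (V2 None W \<zeta>) P w \<le> slot n (V1 W \<zeta>) (2 * n) w)"
  have dc: "decode_edges (concat (map ends rs)) = entry_edge ` {r \<in> set rs. is_edge r}" for rs
  proof (induction rs)
    case (Cons r rs)
    show ?case
    proof (cases r)
      case (EE u v x)
      then have "{r' \<in> set (r # rs). is_edge r'} = insert r {r' \<in> set rs. is_edge r'}" by auto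
      then show ?thesis using Cons EE by (simp only: image_insert) simp
    next
      case (EB v c)
      then have "{r' \<in> set (r # rs). is_edge r'} = {r' \<in> set rs. is_edge r'}" by auto
      then show ?thesis using Cons EB by simp
    qed
  qed simp
  have Q: "?Q (EE (Min e) (Max e) (W e)) \<longleftrightarrow> e \<in> pruned (192 * n) E \<beta> W \<zeta>" if e: "e \<in> E" for e
  proof -
    have "(\<forall>w\<in>e. slot n (V2 None W \<zeta>) P w \<le> \<beta> w) \<longleftrightarrow> (\<forall>w\<in>e. card {f \<in> candidates (192 * n) E W \<zeta>. w \<in> f} \<le> \<beta> w)"
      using edgeE(1)[OF e] V2_candidates[OF \<zeta>] by (intro ball_cong) auto
    then show ?thesis
      unfolding entry_edge_eq[OF e] slot_V1[OF \<zeta>] e_picked_iff[OF \<zeta> e] by (simp add: pruned_def)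
  qed
  have each: "decode_edges (SF W \<zeta> i) = {e. Edge e \<in> set (D i) \<and> e \<in> pruned (192 * n) E \<beta> W \<zeta>}" if i: "i < P" for i
  proof -
    have "decode_edges (SF W \<zeta> i) = entry_edge ` {r \<in> set (es W i). ?Q r}"
      using i by (auto simp: SF_def guard_def kept_ends_def dc e_picked_def)
    also have "\<dots> = {e. Edge e \<in> set (D i) \<and> e \<in> pruned (192 * n) E \<beta> W \<zeta>}"
    proof (intro equalityI subsetI)
      fix e assume "e \<in> entry_edge ` {r \<in> set (es W i). ?Q r}"
      then obtain it where it: "it \<in> set (D i)" "?Q (entry_of n W it)" "e = entry_edge (entry_of n W it)" by (auto simp: es_def)
      obtain e' where e': "it = Edge e'"
      proof (cases it)
        case (Budget v c)
        then show thesis using it(2) not_EB by simp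
      qed (use that in blast)
      have "e' \<in> E" using it e' D_edge i by blast
      then show "e \<in> {e. Edge e \<in> set (D i) \<and> e \<in> pruned (192 * n) E \<beta> W \<zeta>}"
        using it e' Q[of e'] entry_edge_eq[of e' "W e'"] by simp
    next
      fix e assume "e \<in> {e. Edge e \<in> set (D i) \<and> e \<in> pruned (192 * n) E \<beta> W \<zeta>}"
      then have e: "Edge e \<in> set (D i)" "e \<in> pruned (192 * n) E \<beta> W \<zeta>" "e \<in> E" using D_edge i by auto
      have "EE (Min e) (Max e) (W e) \<in> set (es W i)" using e by (force simp: es_def)
      then have "EE (Min e) (Max e) (W e) \<in> {r \<in> set (es W i). ?Q r}" using Q[OF e(3)] e(2) by blast
      then have "entry_edge (EE (Min e) (Max e) (W e)) \<in> entry_edge ` {r \<in> set (es W i). ?Q r}" by (rule imageI)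
      then show "e \<in> entry_edge ` {r \<in> set (es W i). ?Q r}" by (simp only: entry_edge_eq[OF e(3)])
    qed
    finally show ?thesis .
  qed
  have "(\<Union>i<P. decode_edges (SF W \<zeta> i)) = (\<Union>i<P. {e. Edge e \<in> set (D i) \<and> e \<in> pruned (192 * n) E \<beta> W \<zeta>})"
    using each by (intro SUP_cong) auto
  also have "\<dots> = pruned (192 * n) E \<beta> W \<zeta>"
  proof -
    have "\<exists>i<P. Edge e \<in> set (D i)" if "e \<in> pruned (192 * n) E \<beta> W \<zeta>" for e
      using D_cover[of "Edge e"] that by (auto simp: input_items_def pruned_def candidates_def)
    then show ?thesis by auto
  qed
  finally show ?thesis .
qed

end

end

section \<open>Resource bounds\<close>

lemma sum_length_filter_le: "(\<Sum>h<(P::nat). length (filter (\<lambda>r. A r \<and> f r = h) xs)) \<le> length xs"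
proof (induction xs)
  case (Cons r xs)
  have "(\<Sum>h<P. length (filter (\<lambda>r. A r \<and> f r = h) (r # xs)))
    \<le> (\<Sum>h<P. (if h = f r then 1 else 0) + length (filter (\<lambda>r. A r \<and> f r = h) xs))"
    by (intro sum_mono) auto
  also have "\<dots> = (\<Sum>h<P. if h = f r then 1 else 0) + (\<Sum>h<P. length (filter (\<lambda>r. A r \<and> f r = h) xs))"
    by (rule sum.distrib)
  also have "\<dots> \<le> 1 + length xs" using Cons by (intro add_mono) (auto simp: sum.delta)
  finally show ?case by simp
qed simp

lemma sum_length_filter_points:
  fixes N :: nat
  assumes "\<And>r. r \<in> set xs \<Longrightarrow> card {p \<in> {..<N}. A p r} \<le> 1"
  shows "(\<Sum>p<N. length (filter (A p) xs)) \<le> length xs"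
  using assms
proof (induction xs)
  case (Cons r xs)
  have "(\<Sum>p<N. length (filter (A p) (r # xs))) = (\<Sum>p<N. (if A p r then 1 else 0) + length (filter (A p) xs))"
    by (intro sum.cong) auto
  also have "\<dots> = card {p \<in> {..<N}. A p r} + (\<Sum>p<N. length (filter (A p) xs))"
    by (simp add: sum.distrib sum.If_cases Int_def)
  also have "\<dots> \<le> 1 + length xs" using Cons by (intro add_mono) auto
  finally show ?case by simp
qed simp

lemma length_concat_map: "length (concat (map f [0..<N])) = (\<Sum>i<N. length (f i))"
  by (induction N) auto

context simulation
begin

lemma mn: "m + n \<le> n * n"
proof -
  have "n \<le> n * n" using n0 by simp
  then show ?thesis using card_edges_le[OF graph] cardE by linarith
qed

text \<open>In a simple graph m + n <= n ^ 2, so there are O(n) machines and even vectors with one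
  number per machine fit into local memory.\<close>

lemma P_le: "P \<le> 2 ^ 16 * n"
proof -
  have "P * n \<le> 2 ^ 16 * (m + n)" using num_machines_le n0 by blast
  also have "\<dots> \<le> 2 ^ 16 * (n * n)" using mn by (intro mult_left_mono) auto
  finally have "n * P \<le> n * (2 ^ 16 * n)" by (simp only: mult_ac)
  then show ?thesis using n0 by (simp only: nat_mult_le_cancel1)
qed

lemma L_le: "L \<le> 2 ^ 18 * n"
proof -
  have "P * (3 * n div P) \<le> 3 * n" by simp
  then have "L \<le> 3 * n + 2 * P" unfolding vec_len_def block_len_def by (simp add: distrib_left)
  then show ?thesis using P_le by simp
qed

definition fits :: "nat list \<Rightarrow> bool" where
  "fits xs \<longleftrightarrow> length xs \<le> memory n \<and> words_ok 300 n xs"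

text \<open>As n + 1 >= 2, the constant 2 ^ 260 is absorbed into 260 factors n + 1; with the fourth
  power this stays below the exponent 300.\<close>

lemma word_bound: "w \<le> 2 ^ 260 * n ^ 4 \<Longrightarrow> w < (n + 1) ^ 300"
proof -
  assume "w \<le> 2 ^ 260 * n ^ 4"
  also have "\<dots> \<le> (n + 1) ^ 260 * (n + 1) ^ 4" using n0 by (intro mult_mono power_mono) auto
  also have "\<dots> = (n + 1) ^ 264" by (simp flip: power_add)
  also have "\<dots> < (n + 1) ^ 300" using n0 by (intro power_strict_increasing) auto
  finally show ?thesis .
qed

definition small :: "nat \<Rightarrow> bool" where "small w \<longleftrightarrow> w \<le> 2 ^ 260 * n ^ 4"

lemma words_okI: "(\<And>w. w \<in> set xs \<Longrightarrow> small w) \<Longrightarrow> words_ok 300 n xs"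
  unfolding words_ok_def small_def using word_bound by blast

lemma small_quadratic: "w \<le> 2 ^ 260 * (n * n) \<Longrightarrow> small w"
proof -
  assume "w \<le> 2 ^ 260 * (n * n)"
  also have "n * n \<le> (n * n) * (n * n)" using n0 by simp
  finally show ?thesis by (simp add: small_def power4_eq_xxxx mult_ac)
qed

lemma small_linear: "w \<le> 2 ^ 260 * n \<Longrightarrow> small w"
proof -
  assume "w \<le> 2 ^ 260 * n"
  also have "n \<le> n * n" using n0 by simp
  finally show ?thesis by (intro small_quadratic) simp
qed

lemma small_enc4: "w \<le> 242 * (2 ^ 16 * n) ^ 4 \<Longrightarrow> small w"
  unfolding small_def by (simp add: power_mult_distrib)

lemma small_EE: "u < n \<Longrightarrow> v < n \<Longrightarrow> x \<le> 2 ^ 16 * n \<Longrightarrow> small (enc (EE u v x))"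
  using n0 by (intro small_enc4 enc_EE_le) auto

lemma small_EB: "u < n \<Longrightarrow> v \<le> n \<Longrightarrow> small (enc (EB u v))"
  using n0 by (intro small_enc4 enc_EB_le) auto

lemma length_D: "i < P \<Longrightarrow> length (D i) \<le> 2 ^ 259 * n"
  using dist by (auto simp: input_distribution_def memory_def)

lemma length_es [simp]: "length (es W i) = length (D i)" by (simp add: es_def)

lemma edge_ends: "e \<in> E \<Longrightarrow> Min e < n \<and> Max e < n"
  using ends_eq edgeE(1) by blast

lemma small_es:
  assumes W: "\<And>e. W e \<le> 18 * n" and i: "i < P" and w: "w \<in> set (map enc (es W i))"
  shows "small w"
proof -
  obtain it where it: "it \<in> set (D i)" "w = enc (entry_of n W it)" using w by (auto simp: es_def)
  have "it \<in> input_items {..<n} E b" using D_items i it by blast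
  then consider e where "it = Edge e" "e \<in> E" | v where "it = Budget v (b v)" "v < n" by (auto simp: input_items_def)
  then show ?thesis
  proof cases
    case 1
    have "W e \<le> 2 ^ 16 * n" using W[of e] by simp
    then have "small (enc (EE (Min e) (Max e) (W e)))" using edge_ends[OF 1(2)] by (intro small_EE) auto
    then show ?thesis using 1 it by (simp only: entry_of.simps)
  next
    case 2
    have "small (enc (EB v (min (b v) n)))" using 2 by (intro small_EB) auto
    then show ?thesis using 2 it by (simp only: entry_of.simps)
  qed
qed

text \<open>Entries fill at most about half of the memory, because an item counts as two words but
  is stored as one; this leaves room for 2 ^ 258 n other words.\<close>

lemma fits_pack:
  assumes W: "\<And>e. W e \<le> 18 * n" and i: "i < P" and len: "length xs \<le> 2 ^ 258 * n" and sm: "\<And>w. w \<in> set xs \<Longrightarrow> small w"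
  shows "fits (pack (es W i) xs)"
proof -
  have "small (length (D i))" using length_D[OF i] by (intro small_linear) simp
  then have "words_ok 300 n (pack (es W i) xs)"
    using small_es[where W = W and i = i, OF W i] sm by (intro words_okI) (auto simp: pack_def)
  moreover have "length (pack (es W i) xs) \<le> memory n"
    using length_D[OF i] len n0 by (simp add: pack_def memory_def)
  ultimately show ?thesis by (simp add: fits_def)
qed

lemma sum_contrib1_small:
  assumes W: "feasible W" and \<zeta>: "\<zeta> \<in> assignments n Q" and Q: "Q \<le> 2 ^ 16 * n"
  shows "(\<Sum>i<P. contrib1 n i \<zeta> (es W i) x) \<le> 2 ^ 16 * (n * n)"
proof -
  have nn: "n \<le> n * n" using n0 by simp
  consider "x < n" | v where "x = n + v" "v < n" | v where "x = 2 * n + v"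
    by (metis add_diff_inverse_nat mult_2 nat_add_left_cancel_less add.assoc)
  then show ?thesis
  proof cases
    case 1
    then have "\<zeta> x < Q" using \<zeta> by (simp add: assignments_iff)
    then have "\<zeta> x \<le> 2 ^ 16 * n" using Q by (meson le_trans less_imp_le_nat)
    also have "2 ^ 16 * n \<le> 2 ^ 16 * (n * n)" using nn by (intro mult_left_mono) auto
    finally have "\<zeta> x \<le> 2 ^ 16 * (n * n)" .
    then show ?thesis using sum_contrib1(1)[OF 1] by simp
  next
    case 2
    have "ld W v \<le> 48 * n * \<beta> v" using W 2 by (simp add: feasible_def)
    also have "\<dots> \<le> 48 * n * n" by (intro mult_left_mono) (auto simp: \<beta>_def)
    finally show ?thesis using sum_contrib1(2)[OF 2(2)] 2 by simp
  next
    case 3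
    have "\<beta> v \<le> n" by (simp add: \<beta>_def)
    also have "\<dots> \<le> 2 ^ 16 * (n * n)" using nn by (rule order_trans) simp
    finally show ?thesis using sum_contrib1(3)[of \<zeta> W v] 3 by simp
  qed
qed

lemma sum_contrib2_small: "(\<Sum>i<P. contrib2 n P ks xs (es W i) x) \<le> n * n"
proof -
  have *: "(\<Sum>i<P. length (filter T (es W i))) \<le> n * n" if "\<And>v c. \<not> T (EB v c)" for T
  proof -
    have "(\<Sum>i<P. length (filter T (es W i))) \<le> card E"
      unfolding count_entries[where Q = T, OF that] using finE by (intro card_mono) auto
    then show ?thesis using mn cardE by simp
  qed
  show ?thesis
  proof (cases ks)
    case None
    then show ?thesis using * not_EB by (cases "x < P") simp_all
  next
    case (Some a)
    obtain k s where "a = (k, s)" by force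
    then show ?thesis using Some * not_EB by (cases "x < P"; cases "x < k * k") simp_all
  qed
qed

lemma small_V1:
  assumes "feasible W" "\<zeta> \<in> assignments n Q" "Q \<le> 2 ^ 16 * n" "w \<in> set (V1 W \<zeta>)"
  shows "small w"
proof -
  obtain x where "w = (\<Sum>i<P. contrib1 n i \<zeta> (es W i) x)" using assms(4) by (auto simp: V1_def)
  then show ?thesis using sum_contrib1_small[OF assms(1-3), of x] by (intro small_quadratic) simp
qed

lemma small_V2: "w \<in> set (V2 ks W \<zeta>) \<Longrightarrow> small w"
proof -
  assume "w \<in> set (V2 ks W \<zeta>)"
  then obtain x where "w = (\<Sum>i<P. contrib2 n P ks (V1 W \<zeta>) (es W i) x)" by (auto simp: V2_def)
  then show ?thesis using sum_contrib2_small[of ks "V1 W \<zeta>" W x] by (intro small_quadratic) simp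
qed

lemma small_block1:
  assumes "feasible W" "\<zeta> \<in> assignments n Q" "Q \<le> 2 ^ 16 * n" "j < P" "w \<in> set (block B (contrib1 n j \<zeta> (es W j)) i)"
  shows "small w"
proof -
  obtain x where x: "w = contrib1 n j \<zeta> (es W j) x" using assms(5) by (auto simp: block_def)
  have "w \<le> (\<Sum>i<P. contrib1 n i \<zeta> (es W i) x)"
    unfolding x using assms(4) by (intro member_le_sum[of j "{..<P}" "\<lambda>i. contrib1 n i \<zeta> (es W i) x"]) auto
  then show ?thesis using sum_contrib1_small[OF assms(1-3), of x] by (intro small_quadratic) simp
qed

lemma small_block2:
  assumes "j < P" "w \<in> set (block B (contrib2 n P ks xs (es W j)) i)"
  shows "small w"
proof -
  obtain x where x: "w = contrib2 n P ks xs (es W j) x" using assms(2) by (auto simp: block_def)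
  have "w \<le> (\<Sum>i<P. contrib2 n P ks xs (es W i) x)"
    unfolding x using assms(1) by (intro member_le_sum[of j "{..<P}" "\<lambda>i. contrib2 n P ks xs (es W i) x"]) auto
  then show ?thesis using sum_contrib2_small[of ks xs W x] by (intro small_quadratic) simp
qed

lemma L_le': "L \<le> 2 ^ 257 * n" "L \<le> memory n"
proof -
  show "L \<le> 2 ^ 257 * n" by (rule order_trans[OF L_le]) simp
  then show "L \<le> memory n" by (simp add: memory_def)
qed

lemma fits_S0: "feasible W \<Longrightarrow> i < P \<Longrightarrow> fits (S0 W i)"
  by (auto simp: S0_def guard_def feasible_def intro: fits_pack)

lemma fits_S1:
  assumes "feasible W" "\<zeta> \<in> assignments n Q" "Q \<le> 2 ^ 16 * n" "i < P"
  shows "fits (S1 W \<zeta> i)"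
  using assms L_le'(1) small_block1[OF assms(1-3)]
  by (auto simp: S1_def guard_def feasible_def length_inbox_blocks L_def' intro!: fits_pack)

lemma fits_S2:
  assumes "feasible W" "\<zeta> \<in> assignments n Q" "Q \<le> 2 ^ 16 * n" "i < P"
  shows "fits (S2 W \<zeta> i)"
  using assms L_le'(1) small_V1[OF assms(1-3)]
  by (auto simp: S2_def guard_def feasible_def intro!: fits_pack)

lemma fits_S3:
  assumes "feasible W" "\<zeta> \<in> assignments n Q" "Q \<le> 2 ^ 16 * n" "i < P"
  shows "fits (S3 ks W \<zeta> i)"
proof -
  have len: "length (V1 W \<zeta> @ concat (map (\<lambda>j. block B (contrib2 n P ks (V1 W \<zeta>) (es W j)) i) [0..<P])) \<le> 2 ^ 258 * n"
    using L_le'(1) by (simp only: length_append length_inbox_blocks length_V1 L_def'[symmetric]) simp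
  show ?thesis
    using assms small_V1[OF assms(1-3)] small_block2 len
    by (auto simp: S3_def guard_def feasible_def intro!: fits_pack)
qed

lemma fits_S4:
  assumes "feasible W" "\<zeta> \<in> assignments n Q" "Q \<le> 2 ^ 16 * n" "i < P"
  shows "fits (S4 ks W \<zeta> i)"
  using assms L_le'(1) small_V1[OF assms(1-3)] small_V2
  by (auto simp: S4_def guard_def feasible_def intro!: fits_pack)

lemma fits_SF:
  assumes "i < P" shows "fits (SF W \<zeta> i)"
proof -
  let ?rs = "filter (\<lambda>r. e_picked n (V1 W \<zeta>) r \<and> (\<forall>w\<in>entry_edge r. slot n (V2 None W \<zeta>) P w \<le> slot n (V1 W \<zeta>) (2 * n) w)) (es W i)"
  have SF: "SF W \<zeta> i = concat (map ends ?rs)" using assms by (simp add: SF_def guard_def kept_ends_def)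
  have "length (concat (map ends rs)) \<le> 2 * length rs" for rs
  proof (induction rs)
    case (Cons r rs)
    then show ?case by (cases r) auto
  qed simp
  from this[of ?rs] have "length (SF W \<zeta> i) \<le> 2 * length (D i)"
    unfolding SF using length_filter_le[of _ "es W i"] by (metis (no_types, lifting) length_es le_trans mult_le_mono2)
  moreover have "small w" if w: "w \<in> set (SF W \<zeta> i)" for w
  proof -
    obtain it where it: "it \<in> set (D i)" "w \<in> set (ends (entry_of n W it))" using w unfolding SF by (auto simp: es_def)
    then obtain e where e: "it = Edge e" by (cases it rule: item.exhaust) auto
    then have "e \<in> E" using D_edge assms it by blast
    then have "w < n" using it e edge_ends by auto
    then show ?thesis by (intro small_linear) simp
  qed
  ultimately show ?thesis using length_D[OF assms] by (auto simp: fits_def memory_def intro!: words_okI)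
qed

end

context simulation
begin

definition round_fits :: "(nat \<Rightarrow> nat list \<times> (nat \<Rightarrow> nat list)) \<Rightarrow> bool" where
  "round_fits R \<longleftrightarrow> (\<forall>i<P. (\<Sum>j<P. length (snd (R i) j)) \<le> memory n
     \<and> length (concat (map (\<lambda>j. snd (R j) i) [0..<P])) \<le> memory n)"

lemma round_fits_R0: "round_fits (R0 W \<zeta>)"
  using L_le'(2) by (simp add: round_fits_def R0_def length_inbox_blocks L_def' block_def length_concat_map)

lemma round_fits_R1: "round_fits (R1 W \<zeta>)"
  using L_le'(2) by (simp add: round_fits_def R1_def length_inbox_blocks L_def' block_def length_concat_map)

lemma round_fits_R2: "round_fits (R2 ks W \<zeta>)"
  using L_le'(2) by (simp add: round_fits_def R2_def length_inbox_blocks L_def' block_def length_concat_map)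

lemma round_fits_R3: "round_fits (R3 ks W \<zeta>)"
  using L_le'(2) by (simp add: round_fits_def R3_def length_inbox_blocks L_def' block_def length_concat_map)

lemma round_fits_R6: "round_fits (R6 k s W \<zeta>)" and round_fits_RF: "round_fits (RF W \<zeta>)"
  by (simp_all add: round_fits_def R6_def RF_def length_concat_map)

text \<open>For k > 1 the ends lie on distinct lines, which meet at most once; for
  \<open>k = 1\<close> there is only one point. So a machine sends each of its edges at most
  once.\<close>

lemma at_point_unique:
  assumes oa: "\<exists>L. is_oa k L" and k0: "k > 0" and \<zeta>: "\<zeta> \<in> assignments n (k * k)" and e: "e \<in> E"
  shows "card {p \<in> {..<k * k}. at_point k s \<beta> \<zeta> p e} \<le> 1"
proof (cases "k = 1")
  case True
  have "card {p \<in> {..<k * k}. at_point k s \<beta> \<zeta> p e} \<le> card {..<k * k}" by (rule card_mono) auto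
  then show ?thesis using True by simp
next
  case False
  obtain x y where xy: "e = {x, y}" "x \<noteq> y" using edgeE(2)[OF e] by (auto simp: card_2_iff)
  have lt: "\<zeta> x < k * k" "\<zeta> y < k * k" using edgeE(1)[OF e] \<zeta> xy by (auto simp: assignments_iff)
  show ?thesis
  proof (cases "\<zeta> x = \<zeta> y")
    case True
    then have "{p \<in> {..<k * k}. at_point k s \<beta> \<zeta> p e} = {}" using xy False by (auto simp: at_point_def inj_on_def)
    then show ?thesis by (simp only: card.empty)
  next
    case False
    have "card {p \<in> {..<k * k}. at_point k s \<beta> \<zeta> p e} \<le> card {p. p < k * k \<and> on_line k (\<zeta> x) p \<and> on_line k (\<zeta> y) p}"
      by (rule card_mono) (auto simp: at_point_def xy)
    then show ?thesis using card_lines_inter[OF oa k0 lt False] by simp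
  qed
qed

context
  fixes W :: "nat set \<Rightarrow> nat" and \<zeta> :: "nat \<Rightarrow> nat" and k s :: nat
  assumes W: "feasible W" and oa: "\<exists>L. is_oa k L" and k0: "k > 0" and s: "0 < s" "s \<le> k"
    and kP: "k * k \<le> P" and \<zeta>: "\<zeta> \<in> assignments n (k * k)"
begin

abbreviation "TH i p \<equiv> to_host n k s (V1 W \<zeta>) (V2 (Some (k, s)) W \<zeta>) i (es W i) p"

lemma Q_le: "k * k \<le> 2 ^ 16 * n" using kP P_le by (rule order_trans)

lemma mid_le: "mid k W e \<le> 18 * n"
proof -
  have "mid k W e \<le> stg k s W \<zeta> e" by (simp add: mid_def stage_def)
  also have "\<dots> \<le> 18 * n" using stage_feasible[OF oa k0 s \<zeta> W] by (simp add: feasible_def)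
  finally show ?thesis .
qed

lemma es_at_unique:
  assumes i: "i < P" and r: "r \<in> set (es W i)"
  shows "card {p \<in> {..<k * k}. e_at n k s (V1 W \<zeta>) p r} \<le> 1"
proof -
  obtain it where it: "it \<in> set (D i)" "r = entry_of n W it" using r by (auto simp: es_def)
  show ?thesis
  proof (cases it)
    case (Edge e)
    then have e: "e \<in> E" using D_edge i it by blast
    have "card {p \<in> {..<k * k}. e_at n k s (V1 W \<zeta>) p r} \<le> card {p \<in> {..<k * k}. at_point k s \<beta> \<zeta> p e}"
      using it Edge e_at_iff[OF \<zeta> e] by (intro card_mono) (auto simp: point_edges_def)
    then show ?thesis using at_point_unique[OF oa k0 \<zeta> e, of s] by linarith
  next
    case (Budget v c)
    then have "{p \<in> {..<k * k}. e_at n k s (V1 W \<zeta>) p r} = {}" using it not_EB by simp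
    then show ?thesis by (simp only: card.empty)
  qed
qed

lemma sum_length_to_host:
  assumes i: "i < P"
  shows "(\<Sum>p<P. length (TH i p)) \<le> length (D i)"
proof -
  have "(\<Sum>p<P. length (TH i p)) \<le> (\<Sum>p<P. if p < k * k then length (filter (e_at n k s (V1 W \<zeta>) p) (es W i)) else 0)"
    by (rule sum_mono) (auto simp: to_host_def)
  also have "\<dots> = (\<Sum>p<k * k. length (filter (e_at n k s (V1 W \<zeta>) p) (es W i)))"
    by (rule sum.mono_neutral_cong_right) (use kP in auto)
  also have "\<dots> \<le> length (es W i)" by (rule sum_length_filter_points) (rule es_at_unique[OF i])
  finally show ?thesis by simp
qed

lemma length_insts: "length (insts k s W \<zeta> p) \<le> cap n"
proof (cases "p < k * k \<and> V2 (Some (k, s)) W \<zeta> ! p \<le> cap n")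
  case True
  then have "p < L" "p < P" using kP L_ge by auto
  then have "V2 (Some (k, s)) W \<zeta> ! p = (\<Sum>i<P. length (filter (e_at n k s (V1 W \<zeta>) p) (es W i)))"
    using True by (simp add: V2_def)
  moreover have "length (insts k s W \<zeta> p) = (\<Sum>i<P. length (filter (e_at n k s (V1 W \<zeta>) p) (es W i)))"
    using True by (simp add: insts_def length_concat_map to_host_def)
  ultimately show ?thesis using True by simp
next
  case False
  then have "insts k s W \<zeta> p = []" by (auto simp: insts_def to_host_def)
  then show ?thesis by simp
qed

lemma entry_val_to_host: "r \<in> set (TH i p) \<Longrightarrow> entry_val r = i"
proof -
  assume "r \<in> set (TH i p)"
  then obtain r' where r': "r = set_val i r'" "e_at n k s (V1 W \<zeta>) p r'" by (auto simp: to_host_def split: if_splits)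
  then have "is_edge r'" by (simp add: e_at_def e_active_def)
  then show ?thesis using r' by (cases r') auto
qed

text \<open>Replies to \<open>h\<close> concern edges which \<open>h\<close> itself sent, and each
  of its entries was sent at most once.\<close>

lemma length_reps:
  assumes h: "h < P"
  shows "length (reps k s W \<zeta> h) \<le> length (D h)"
proof -
  have "length (replies n s (V1 W \<zeta>) (insts k s W \<zeta> p) h) \<le> length (TH h p)" for p
  proof -
    let ?T = "\<lambda>r. entry_edge r \<in> host_matching n s (V1 W \<zeta>) (insts k s W \<zeta> p) \<and> entry_val r = h"
    have "length (replies n s (V1 W \<zeta>) (insts k s W \<zeta> p) h) = length (filter ?T (concat (map (\<lambda>i. TH i p) [0..<P])))"
      by (simp add: replies_def insts_def)
    also have "\<dots> = (\<Sum>i<P. length (filter ?T (TH i p)))"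
      by (simp add: filter_concat length_concat_map o_def)
    also have "\<dots> \<le> (\<Sum>i<P. if i = h then length (TH h p) else 0)"
    proof (rule sum_mono)
      fix i
      show "length (filter ?T (TH i p)) \<le> (if i = h then length (TH h p) else 0)"
      proof (cases "i = h")
        case False
        then have "filter ?T (TH i p) = []" using entry_val_to_host by (auto simp: filter_empty_conv)
        then show ?thesis by simp
      qed simp
    qed
    also have "\<dots> = length (TH h p)" using h by simp
    finally show ?thesis .
  qed
  then have "length (reps k s W \<zeta> h) \<le> (\<Sum>p<P. length (TH h p))"
    unfolding reps_def length_concat_map by (intro sum_mono)
  then show ?thesis using sum_length_to_host[OF h] by linarith
qed

lemma insts_cases:
  assumes "r \<in> set (insts k s W \<zeta> p)"
  shows "\<exists>e i. r = EE (Min e) (Max e) i \<and> e \<in> E \<and> i < P"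
proof -
  have p: "p < k * k" using assms insts_outside by (metis empty_iff list.set(1))
  show ?thesis using assms ac_E unfolding set_insts[OF \<zeta> kP p]
    by (auto simp: point_edges_def split: if_splits)
qed

lemma fits_S5:
  assumes i: "i < P" shows "fits (S5 k s W \<zeta> i)"
proof -
  have "small w" if w: "w \<in> set (map enc (insts k s W \<zeta> i))" for w
  proof -
    obtain r where r: "r \<in> set (insts k s W \<zeta> i)" "w = enc r" using w by auto
    obtain e j where "r = EE (Min e) (Max e) j" "e \<in> E" "j < P" using insts_cases[OF r(1)] by blast
    then have "w = enc (EE (Min e) (Max e) j)" "e \<in> E" "j \<le> 2 ^ 16 * n"
      using r P_le by (auto simp del: enc.simps intro: order_trans less_imp_le)
    then show ?thesis using edge_ends[of e] small_EE by blast
  qed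
  moreover have "L + length (insts k s W \<zeta> i) \<le> 2 ^ 258 * n"
    using L_le'(1) length_insts[of i] by (simp add: cap_def)
  ultimately have "fits (pack (es (mid k W) i) (V1 W \<zeta> @ map enc (insts k s W \<zeta> i)))"
    using i mid_le small_V1[OF W \<zeta> Q_le] by (intro fits_pack) auto
  then show ?thesis using i by (simp add: S5_def guard_def)
qed

text \<open>Here \<open>fits_pack\<close> is too weak: the replies can be as many as the entries,
  and the exact size of the memory is needed.\<close>

lemma fits_S6:
  assumes i: "i < P" shows "fits (S6 k s W \<zeta> i)"
proof -
  have "small w" if w: "w \<in> set (map enc (reps k s W \<zeta> i))" for w
  proof -
    obtain r p where r: "r \<in> set (insts k s W \<zeta> p)" "w = enc (reply_of r)"
      using w by (auto simp: reps_def replies_def simp del: enc.simps)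
    obtain e j where "r = EE (Min e) (Max e) j" "e \<in> E" using insts_cases[OF r(1)] by blast
    then have "w = enc (EB (Min e) (Max e))" "e \<in> E" using r by (auto simp del: enc.simps)
    then show ?thesis using edge_ends[of e] small_EB[of "Min e" "Max e"] by auto
  qed
  moreover have "small w" if "w \<in> set (map enc (es (mid k W) i))" for w
    using that small_es[where W = "mid k W", OF mid_le i] by blast
  moreover have "small (length (D i))" using length_D[OF i] by (intro small_linear) simp
  ultimately have "words_ok 300 n (pack (es (mid k W) i) (map enc (reps k s W \<zeta> i)))"
    by (intro words_okI) (auto simp: pack_def)
  moreover have "length (pack (es (mid k W) i) (map enc (reps k s W \<zeta> i))) \<le> memory n"
    using length_D[OF i] length_reps[OF i] by (simp add: pack_def memory_def)
  ultimately show ?thesis using i by (simp add: S6_def guard_def fits_def)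
qed

lemma round_fits_R4: "round_fits (R4 k s W \<zeta>)"
  unfolding round_fits_def
proof (intro allI impI conjI)
  fix i assume i: "i < P"
  show "(\<Sum>j<P. length (snd (R4 k s W \<zeta> i) j)) \<le> memory n"
    using sum_length_to_host[OF i] length_D[OF i] by (simp add: R4_def memory_def)
  have "length (concat (map (\<lambda>j. snd (R4 k s W \<zeta> j) i) [0..<P])) = length (insts k s W \<zeta> i)"
    by (simp add: R4_def insts_def length_concat_map)
  then show "length (concat (map (\<lambda>j. snd (R4 k s W \<zeta> j) i) [0..<P])) \<le> memory n"
    using length_insts[of i] by (simp add: cap_def memory_def)
qed

lemma round_fits_R5: "round_fits (R5 k s W \<zeta>)"
  unfolding round_fits_def
proof (intro allI impI conjI)
  fix i assume i: "i < P"
  have "(\<Sum>j<P. length (snd (R5 k s W \<zeta> i) j)) \<le> length (insts k s W \<zeta> i)"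
    unfolding R5_def replies_def by (simp add: sum_length_filter_le)
  then show "(\<Sum>j<P. length (snd (R5 k s W \<zeta> i) j)) \<le> memory n"
    using length_insts[of i] by (simp add: cap_def memory_def)
  have "length (concat (map (\<lambda>j. snd (R5 k s W \<zeta> j) i) [0..<P])) = length (reps k s W \<zeta> i)"
    by (simp add: R5_def reps_def length_concat_map)
  then show "length (concat (map (\<lambda>j. snd (R5 k s W \<zeta> j) i) [0..<P])) \<le> memory n"
    using length_reps[OF i] length_D[OF i] by (simp add: memory_def)
qed

end

end

section \<open>The run of the algorithm\<close>

context simulation
begin

abbreviation "A \<equiv> bmatch_algorithm"

lemma alg [simp]: "machines A n m = P" "local_memory A n m = memory n" "rounds A n m = 7 * length ps + 5"
  by (simp_all add: bmatch_algorithm_def)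

definition state_ok :: "nat \<Rightarrow> bool" where
  "state_ok t \<longleftrightarrow> (\<forall>\<sigma>\<in>set_pmf (run A n m D t). \<forall>i<P. fits (\<sigma> i))"

definition round_ok :: "nat \<Rightarrow> bool" where
  "round_ok t \<longleftrightarrow> (\<forall>\<sigma>\<in>set_pmf (run A n m D t). \<forall>r\<in>set_pmf (local_computations A n m t \<sigma>). \<forall>i<P.
     (\<Sum>j<P. length (snd (r i) j)) \<le> memory n \<and> length (inbox P r i) \<le> memory n)"

lemma round_fits_limits:
  assumes "round_fits R" "r = (\<lambda>i. if i < P then R i else ([], \<lambda>_. []))" "i < P"
  shows "(\<Sum>j<P. length (snd (r i) j)) \<le> memory n \<and> length (inbox P r i) \<le> memory n"
proof -
  have "inbox P r i = concat (map (\<lambda>j. snd (R j) i) [0..<P])"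
    unfolding inbox_def assms(2) by (intro arg_cong[where f = concat] map_cong) auto
  then show ?thesis using assms by (simp add: round_fits_def)
qed

text \<open>Carries a state of the form \<open>map_pmf S p\<close> through a round without
  randomness, where \<open>p\<close> is the distribution of the abstract weights and seeds.\<close>

lemma det_round:
  assumes run: "run A n m D t = map_pmf S p" and t: "t mod 7 \<noteq> 0"
    and out: "\<And>a i. a \<in> set_pmf p \<Longrightarrow> i < P \<Longrightarrow> out n m t i (\<lambda>_. 0) (S a i) = R a i"
    and fit: "\<And>a i. a \<in> set_pmf p \<Longrightarrow> i < P \<Longrightarrow> fits (S a i)"
    and rf: "\<And>a. a \<in> set_pmf p \<Longrightarrow> round_fits (R a)"
    and cm: "\<And>a. a \<in> set_pmf p \<Longrightarrow> comm (R a) = S' a"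
  shows "run A n m D (Suc t) = map_pmf S' p \<and> state_ok t \<and> round_ok t"
proof -
  have lc: "local_computations A n m t (S a) = return_pmf (\<lambda>i. if i < P then R a i else ([], \<lambda>_. []))"
    if "a \<in> set_pmf p" for a
    using deterministic_round[of A n m t "S a" "R a"] out[OF that] t by (simp add: bmatch_algorithm_def)
  have "run A n m D (Suc t) = bind_pmf p (\<lambda>a. map_pmf (communicate P) (local_computations A n m t (S a)))"
    by (simp add: run bind_map_pmf)
  also have "\<dots> = bind_pmf p (\<lambda>a. return_pmf (S' a))"
    using lc cm by (intro bind_pmf_cong refl) simp
  also have "\<dots> = map_pmf S' p" by (simp add: map_pmf_def)
  finally have "run A n m D (Suc t) = map_pmf S' p" .
  moreover have "state_ok t" using fit by (auto simp: state_ok_def run)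
  moreover have "round_ok t" unfolding round_ok_def run
    using lc rf round_fits_limits[OF _ refl] by (fastforce simp: )
  ultimately show ?thesis by blast
qed

text \<open>The abstract state is extended by the fresh seeds \<open>z\<close>; \<open>indep\<close>
  expresses that in this round only machine 0 sees them.\<close>

lemma random_round:
  assumes run: "run A n m D t = map_pmf S p" and t: "t mod 7 = 0"
    and out: "\<And>a i z. a \<in> set_pmf p \<Longrightarrow> i < P \<Longrightarrow> out n m t i z (S a i) = R (a, z) i"
    and indep: "\<And>a i z z'. 0 < i \<Longrightarrow> R (a, z) i = R (a, z') i"
    and fit: "\<And>a i. a \<in> set_pmf p \<Longrightarrow> i < P \<Longrightarrow> fits (S a i)"
    and rf: "\<And>a. round_fits (R a)"
    and cm: "\<And>a. comm (R a) = S' a"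
  defines "q \<equiv> uniform_assignment n (seed_range n (stage_of n m (t div 7)))"
  shows "run A n m D (Suc t) = map_pmf S' (bind_pmf p (\<lambda>a. map_pmf (Pair a) q)) \<and> state_ok t \<and> round_ok t"
proof -
  have lc: "local_computations A n m t (S a) = map_pmf (\<lambda>z i. if i < P then R (a, z) i else ([], \<lambda>_. [])) q"
    if a: "a \<in> set_pmf p" for a
  proof -
    have "local_computations A n m t (S a) = map_pmf (\<lambda>z i. if i < machines A n m then R (a, z) i else ([], \<lambda>_. [])) q"
    proof (rule one_random_round[where f = "\<lambda>i z. R (a, z) i" and w = "\<lambda>_. 0"])
      show "0 < machines A n m" using P0 by simp
      show "step A n m t 0 (S a 0) = map_pmf (\<lambda>z. R (a, z) 0) q"
        using out[OF a] P0 t by (simp add: bmatch_algorithm_def q_def)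
      show "step A n m t i (S a i) = return_pmf (R (a, \<lambda>_. 0) i)" if "0 < i" "i < machines A n m" for i
        using out[OF a, of i] that by (simp add: bmatch_algorithm_def)
      show "R (a, z) i = R (a, \<lambda>_. 0) i" if "0 < i" for i z using that by (rule indep)
    qed
    then show ?thesis by simp
  qed
  have "run A n m D (Suc t) = bind_pmf p (\<lambda>a. map_pmf (communicate P) (local_computations A n m t (S a)))"
    by (simp add: run bind_map_pmf)
  also have "\<dots> = bind_pmf p (\<lambda>a. map_pmf (\<lambda>z. S' (a, z)) q)"
    using lc cm by (intro bind_pmf_cong refl) (simp add: map_pmf_comp)
  also have "\<dots> = map_pmf S' (bind_pmf p (\<lambda>a. map_pmf (Pair a) q))"
    by (simp add: map_bind_pmf map_pmf_comp)
  finally have "run A n m D (Suc t) = map_pmf S' (bind_pmf p (\<lambda>a. map_pmf (Pair a) q))" .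
  moreover have "state_ok t" using fit by (auto simp: state_ok_def run)
  moreover have "round_ok t" unfolding round_ok_def run
  proof (intro ballI allI impI)
    fix \<sigma> r i assume "\<sigma> \<in> set_pmf (map_pmf S p)" and r: "r \<in> set_pmf (local_computations A n m t \<sigma>)" and i: "i < P"
    then obtain a where a: "a \<in> set_pmf p" "\<sigma> = S a" by auto
    then obtain z where "r = (\<lambda>i. if i < P then R (a, z) i else ([], \<lambda>_. []))" using r lc by auto
    then show "(\<Sum>j<P. length (snd (r i) j)) \<le> memory n \<and> length (inbox P r i) \<le> memory n"
      using round_fits_limits[OF rf _ i] by blast
  qed
  ultimately show ?thesis by blast
qed

lemma tmod: "r < 7 \<Longrightarrow> (7 * j + r) mod 7 = r" "r < 7 \<Longrightarrow> (7 * j + r) div 7 = j" for j r :: nat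
  by auto

lemma out0: "i < P \<Longrightarrow> out n m (7 * j) i z (S0 W i) = R0 W z i"
  by (simp add: out_def Let_def S0_def guard_def R0_def)

lemma out1: "i < P \<Longrightarrow> out n m (7 * j + 1) i z (S1 W \<zeta> i) = R1 W \<zeta> i"
  using tmod[of 1 j] by (simp add: out_def Let_def S1_def guard_def R1_def block_sums_inbox)

lemma out2: "i < P \<Longrightarrow> out n m (7 * j + 2) i z (S2 W \<zeta> i) = R2 (stage_of n m j) W \<zeta> i"
  using tmod[of 2 j] by (simp add: out_def Let_def S2_def guard_def R2_def)

lemma out3: "i < P \<Longrightarrow> out n m (7 * j + 3) i z (S3 ks W \<zeta> i) = R3 ks W \<zeta> i"
  using tmod[of 3 j] by (simp add: out_def Let_def S3_def guard_def R3_def block_sums_inbox)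

lemma out4:
  assumes "i < P" "stage_of n m j = Some (k, s)" "\<zeta> \<in> assignments n Q"
  shows "out n m (7 * j + 4) i z (S4 (Some (k, s)) W \<zeta> i) = R4 k s W \<zeta> i"
  using assms tmod[of 4 j] by (simp add: out_def Let_def S4_def guard_def R4_def es_finish)

lemma outF:
  assumes "i < P" "stage_of n m j = None"
  shows "out n m (7 * j + 4) i z (S4 None W \<zeta> i) = RF W \<zeta> i"
  using assms tmod[of 4 j] by (simp add: out_def Let_def S4_def guard_def RF_def)

lemma out5:
  assumes "i < P" "stage_of n m j = Some (k, s)"
  shows "out n m (7 * j + 5) i z (S5 k s W \<zeta> i) = R5 k s W \<zeta> i"
  using assms tmod[of 5 j] by (simp add: out_def Let_def S5_def guard_def R5_def del: map_map)

lemma out6: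
  assumes "i < P" "stage_of n m j = Some (k, s)" "\<zeta> \<in> assignments n Q" "k * k \<le> P"
  shows "out n m (7 * j + 6) i z (S6 k s W \<zeta> i) = R6 k s W \<zeta> i"
  using assms tmod[of 6 j] by (simp add: out_def Let_def S6_def guard_def R6_def es_merge del: map_map)

text \<open>The four rounds common to a stage and to the final rounding, after which all machines
  know both vectors.\<close>

lemma first_rounds:
  assumes run: "run A n m D (7 * j) = map_pmf S0 q" and q: "\<And>W. W \<in> set_pmf q \<Longrightarrow> feasible W"
    and Q: "0 < seed_range n (stage_of n m j)" "seed_range n (stage_of n m j) \<le> 2 ^ 16 * n"
  defines "J \<equiv> bind_pmf q (\<lambda>W. map_pmf (Pair W) (uniform_assignment n (seed_range n (stage_of n m j))))"
  shows "run A n m D (7 * j + 4) = map_pmf (\<lambda>(W, \<zeta>). S4 (stage_of n m j) W \<zeta>) J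
    \<and> (\<forall>r<4. state_ok (7 * j + r) \<and> round_ok (7 * j + r))
    \<and> (\<forall>(W, \<zeta>)\<in>set_pmf J. feasible W \<and> \<zeta> \<in> assignments n (seed_range n (stage_of n m j)))"
proof -
  let ?Q = "seed_range n (stage_of n m j)" and ?ks = "stage_of n m j"
  have J: "feasible W \<and> \<zeta> \<in> assignments n ?Q" if "(W, \<zeta>) \<in> set_pmf J" for W \<zeta>
    using that q by (auto simp: J_def set_uniform_assignment[OF Q(1)])
  have f: "fits (S1 W \<zeta> i)" "fits (S2 W \<zeta> i)" "fits (S3 ?ks W \<zeta> i)" if "(W, \<zeta>) \<in> set_pmf J" "i < P" for W \<zeta> i
    using J[OF that(1)] that(2) Q(2) fits_S1 fits_S2 fits_S3 by blast+
  have r0: "run A n m D (Suc (7 * j)) = map_pmf (\<lambda>(W, \<zeta>). S1 W \<zeta>) J \<and> state_ok (7 * j) \<and> round_ok (7 * j)"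
  proof -
    have jj: "7 * j div 7 = j" by simp
    have "run A n m D (Suc (7 * j)) = map_pmf (\<lambda>(W, \<zeta>). S1 W \<zeta>)
        (bind_pmf q (\<lambda>W. map_pmf (Pair W) (uniform_assignment n (seed_range n (stage_of n m (7 * j div 7))))))
      \<and> state_ok (7 * j) \<and> round_ok (7 * j)"
    proof (rule random_round[where R = "\<lambda>(W, \<zeta>). R0 W \<zeta>" and S = S0, OF run])
      show "(case (W, z) of (W, \<zeta>) \<Rightarrow> R0 W \<zeta>) i = (case (W, z') of (W, \<zeta>) \<Rightarrow> R0 W \<zeta>) i" if "0 < i" for W i z z'
      proof -
        have "contrib1 n i z rs = contrib1 n i z' rs" for rs using that by (auto simp: contrib1_def fun_eq_iff)
        then show ?thesis by (simp add: R0_def)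
      qed
    qed (use out0 fits_S0[OF q] round_fits_R0 comm_R0 in auto)
    then show ?thesis unfolding jj J_def .
  qed
  have r1: "run A n m D (Suc (7 * j + 1)) = map_pmf (\<lambda>(W, \<zeta>). S2 W \<zeta>) J \<and> state_ok (7 * j + 1) \<and> round_ok (7 * j + 1)"
  proof (rule det_round[where R = "\<lambda>(W, \<zeta>). R1 W \<zeta>" and S = "\<lambda>(W, \<zeta>). S1 W \<zeta>"])
    show "run A n m D (7 * j + 1) = map_pmf (\<lambda>(W, \<zeta>). S1 W \<zeta>) J" using r0 by simp
  qed (use tmod[of 1 j] f in \<open>auto simp: out1[simplified] comm_R1 round_fits_R1\<close>)
  have r2: "run A n m D (Suc (7 * j + 2)) = map_pmf (\<lambda>(W, \<zeta>). S3 ?ks W \<zeta>) J \<and> state_ok (7 * j + 2) \<and> round_ok (7 * j + 2)"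
  proof (rule det_round[where R = "\<lambda>(W, \<zeta>). R2 ?ks W \<zeta>" and S = "\<lambda>(W, \<zeta>). S2 W \<zeta>"])
    show "run A n m D (7 * j + 2) = map_pmf (\<lambda>(W, \<zeta>). S2 W \<zeta>) J" using r1 by (simp add: numeral_2_eq_2)
  qed (use tmod[of 2 j] f in \<open>auto simp: out2 out2[unfolded add_2_eq_Suc'] comm_R2 round_fits_R2\<close>)
  have r3: "run A n m D (Suc (7 * j + 3)) = map_pmf (\<lambda>(W, \<zeta>). S4 ?ks W \<zeta>) J \<and> state_ok (7 * j + 3) \<and> round_ok (7 * j + 3)"
  proof (rule det_round[where R = "\<lambda>(W, \<zeta>). R3 ?ks W \<zeta>" and S = "\<lambda>(W, \<zeta>). S3 ?ks W \<zeta>"])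
    show "run A n m D (7 * j + 3) = map_pmf (\<lambda>(W, \<zeta>). S3 ?ks W \<zeta>) J" using r2 by (simp add: numeral_3_eq_3)
  qed (use tmod[of 3 j] f in \<open>auto simp: out3 comm_R3 round_fits_R3\<close>)
  have "run A n m D (7 * j + 4) = map_pmf (\<lambda>(W, \<zeta>). S4 ?ks W \<zeta>) J"
    using r3 by (metis add_Suc_right eval_nat_numeral(2) semiring_norm(26) semiring_norm(27) semiring_norm(28))
  moreover have "state_ok (7 * j + r) \<and> round_ok (7 * j + r)" if "r < 4" for r
  proof -
    have "r = 0 \<or> r = 1 \<or> r = 2 \<or> r = 3" using that by linarith
    then show ?thesis using r0 r1 r2 r3 by (elim disjE) simp_all
  qed
  ultimately show ?thesis using J by auto
qed

lemma stage_rounds: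
  assumes run: "run A n m D (7 * j) = map_pmf S0 q" and q: "\<And>W. W \<in> set_pmf q \<Longrightarrow> feasible W"
    and ks: "stage_of n m j = Some (k, s)" and oa: "\<exists>L. is_oa k L" and k0: "k > 0" and s: "0 < s" "s \<le> k" and kP: "k * k \<le> P"
  shows "run A n m D (7 * Suc j) = map_pmf S0 (bind_pmf q (stage_pmf n E \<beta> (k, s)))
    \<and> (\<forall>r<7. state_ok (7 * j + r) \<and> round_ok (7 * j + r))"
proof -
  define J where "J = bind_pmf q (\<lambda>W. map_pmf (Pair W) (uniform_assignment n (k * k)))"
  have sr: "seed_range n (stage_of n m j) = k * k" by (simp add: seed_range_def ks)
  have Q: "k * k \<le> 2 ^ 16 * n" using kP P_le by (rule order_trans)
  have "0 < k * k" using k0 by simp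
  note fr = first_rounds[OF run q, unfolded sr, OF _ \<open>0 < k * k\<close> Q, folded J_def, unfolded ks]
  have first: "run A n m D (7 * j + 4) = map_pmf (\<lambda>(W, \<zeta>). S4 (Some (k, s)) W \<zeta>) J"
    "\<And>r. r < 4 \<Longrightarrow> state_ok (7 * j + r) \<and> round_ok (7 * j + r)"
    "\<And>W \<zeta>. (W, \<zeta>) \<in> set_pmf J \<Longrightarrow> feasible W \<and> \<zeta> \<in> assignments n (k * k)"
    using fr by blast+
  have f: "fits (S4 (Some (k, s)) W \<zeta> i)" "fits (S5 k s W \<zeta> i)" "fits (S6 k s W \<zeta> i)"
    if "(W, \<zeta>) \<in> set_pmf J" "i < P" for W \<zeta> i
    using first(3)[OF that(1)] that(2) Q fits_S4 fits_S5[OF _ oa k0 s kP] fits_S6[OF _ oa k0 s kP] by blast+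
  have rf: "round_fits (R4 k s W \<zeta>)" "round_fits (R5 k s W \<zeta>)" if "(W, \<zeta>) \<in> set_pmf J" for W \<zeta>
    using first(3)[OF that] round_fits_R4[OF _ oa k0 s kP] round_fits_R5[OF _ oa k0 s kP] by blast+
  have o: "out n m (7 * j + 4) i z (S4 (Some (k, s)) W \<zeta> i) = R4 k s W \<zeta> i"
    "out n m (7 * j + 6) i z (S6 k s W \<zeta> i) = R6 k s W \<zeta> i" if "(W, \<zeta>) \<in> set_pmf J" "i < P" for W \<zeta> i z
    using out4[OF that(2) ks] out6[OF that(2) ks _ kP] first(3)[OF that(1)] by blast+
  have r4: "run A n m D (Suc (7 * j + 4)) = map_pmf (\<lambda>(W, \<zeta>). S5 k s W \<zeta>) J \<and> state_ok (7 * j + 4) \<and> round_ok (7 * j + 4)"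
    by (rule det_round[where R = "\<lambda>(W, \<zeta>). R4 k s W \<zeta>" and S = "\<lambda>(W, \<zeta>). S4 (Some (k, s)) W \<zeta>"])
      (use first tmod[of 4 j] f rf o comm_R4 in auto)
  have r5: "run A n m D (Suc (7 * j + 5)) = map_pmf (\<lambda>(W, \<zeta>). S6 k s W \<zeta>) J \<and> state_ok (7 * j + 5) \<and> round_ok (7 * j + 5)"
  proof (rule det_round[where R = "\<lambda>(W, \<zeta>). R5 k s W \<zeta>" and S = "\<lambda>(W, \<zeta>). S5 k s W \<zeta>"])
    have "Suc (7 * j + 4) = 7 * j + 5" by simp
    then show "run A n m D (7 * j + 5) = map_pmf (\<lambda>(W, \<zeta>). S5 k s W \<zeta>) J" using r4 by (simp only:)
  qed (use tmod[of 5 j] f rf out5[OF _ ks] comm_R5 in auto)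
  have r6: "run A n m D (Suc (7 * j + 6)) = map_pmf (\<lambda>(W, \<zeta>). S0 (stg k s W \<zeta>)) J \<and> state_ok (7 * j + 6) \<and> round_ok (7 * j + 6)"
  proof (rule det_round[where R = "\<lambda>(W, \<zeta>). R6 k s W \<zeta>" and S = "\<lambda>(W, \<zeta>). S6 k s W \<zeta>"])
    have "Suc (7 * j + 5) = 7 * j + 6" by simp
    then show "run A n m D (7 * j + 6) = map_pmf (\<lambda>(W, \<zeta>). S6 k s W \<zeta>) J" using r5 by (simp only:)
  qed (use tmod[of 6 j] f o comm_R6 round_fits_R6 in auto)
  have "map_pmf (\<lambda>(W, \<zeta>). S0 (stg k s W \<zeta>)) J = map_pmf S0 (bind_pmf q (stage_pmf n E \<beta> (k, s)))"
    unfolding J_def stage_pmf_def by (simp add: map_bind_pmf map_pmf_comp)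
  moreover have "Suc (7 * j + 6) = 7 * Suc j" by simp
  ultimately have "run A n m D (7 * Suc j) = map_pmf S0 (bind_pmf q (stage_pmf n E \<beta> (k, s)))"
    using r6 by (simp only:)
  moreover have "state_ok (7 * j + r) \<and> round_ok (7 * j + r)" if "r < 7" for r
  proof -
    have "r < 4 \<or> r = 4 \<or> r = 5 \<or> r = 6" using that by linarith
    then show ?thesis using first(2) r4 r5 r6 by (elim disjE) auto
  qed
  ultimately show ?thesis by blast
qed

lemma stage_ok:
  assumes "j < length ps"
  obtains k s where "stage_of n m j = Some (k, s)" "ps ! j = (k, s)" "\<exists>L. is_oa k L" "k > 0" "0 < s" "s \<le> k" "k * k \<le> P"
proof -
  obtain k s where a: "ps ! j = (k, s)" by force
  then have "(k, s) \<in> set ps" using assms by (metis nth_mem)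
  then obtain l where l: "k = 2 ^ l" "l \<le> 8 * size_exp n m" "0 < s" "s \<le> k" using params_ok by blast
  have "k * k = 2 ^ (2 * l)" by (simp add: l power_add mult_2)
  also have "\<dots> \<le> P" unfolding num_machines_def using l by (intro power_increasing) auto
  finally have "k * k \<le> P" .
  then show thesis using that[of k s] a l assms oa_exists[of l] by (simp add: stage_of_def Let_def)
qed

lemma stages_take_feasible:
  assumes "Y \<in> set_pmf (stages n E \<beta> (take j ps) (\<lambda>_. 0))" shows "feasible Y"
proof (rule stages_feasible[OF _ feasible_zero assms])
  fix k s assume "(k, s) \<in> set (take j ps)"
  then have "(k, s) \<in> set ps" by (rule in_set_takeD)
  then show "(\<exists>j. k = 2 ^ j) \<and> 0 < s \<and> s \<le> k" using params_ok by blast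
qed

lemma run_stages:
  "j \<le> length ps \<Longrightarrow> run A n m D (7 * j) = map_pmf S0 (stages n E \<beta> (take j ps) (\<lambda>_. 0))
    \<and> (\<forall>t<7 * j. state_ok t \<and> round_ok t)"
proof (induction j)
  case 0
  have "run A n m D 0 = return_pmf (S0 (\<lambda>_. 0))"
    by (simp add: S0_def guard_def es_def bmatch_algorithm_def fun_eq_iff)
  then show ?case by simp
next
  case (Suc j)
  then have j: "j < length ps" by simp
  obtain k s where ks: "stage_of n m j = Some (k, s)" "ps ! j = (k, s)" "\<exists>L. is_oa k L" "k > 0" "0 < s" "s \<le> k" "k * k \<le> P"
    using stage_ok[OF j] by blast
  have IH: "run A n m D (7 * j) = map_pmf S0 (stages n E \<beta> (take j ps) (\<lambda>_. 0))" "\<forall>t<7 * j. state_ok t \<and> round_ok t"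
    using Suc by auto
  have st: "run A n m D (7 * Suc j) = map_pmf S0 (bind_pmf (stages n E \<beta> (take j ps) (\<lambda>_. 0)) (stage_pmf n E \<beta> (k, s)))"
    "\<forall>r<7. state_ok (7 * j + r) \<and> round_ok (7 * j + r)"
    using stage_rounds[OF IH(1) stages_take_feasible[where j = j] ks(1) ks(3-7)] by blast+
  have "take (Suc j) ps = take j ps @ [(k, s)]" using j ks(2) by (simp add: take_Suc_conv_app_nth)
  then have "stages n E \<beta> (take (Suc j) ps) (\<lambda>_. 0) = bind_pmf (stages n E \<beta> (take j ps) (\<lambda>_. 0)) (stage_pmf n E \<beta> (k, s))"
  proof -
    have "stages n E \<beta> [] = return_pmf" by (rule ext) simp
    then have "stages n E \<beta> [(k, s)] = sp (k, s)" by (intro ext) (simp add: bind_return_pmf')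
    then show ?thesis using \<open>take (Suc j) ps = _\<close> by (simp only: stages_append)
  qed
  moreover have "state_ok t \<and> round_ok t" if "t < 7 * Suc j" for t
  proof (cases "t < 7 * j")
    case False
    then have "t = 7 * j + (t - 7 * j)" "t - 7 * j < 7" using that by auto
    then show ?thesis using st(2) by metis
  qed (use IH(2) in blast)
  ultimately show ?case using st(1) by (simp only:) blast
qed

theorem simulation:
  "mpc_output A n m D = result n E \<beta> (size_exp n m) \<and> obeys_limits 300 A n m D"
proof -
  let ?T = "length ps"
  define q where "q = stages n E \<beta> ps (\<lambda>_. 0)"
  define J where "J = bind_pmf q (\<lambda>W. map_pmf (Pair W) (uniform_assignment n (192 * n)))"
  have run: "run A n m D (7 * ?T) = map_pmf S0 q" "\<forall>t<7 * ?T. state_ok t \<and> round_ok t"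
    using run_stages[of ?T] by (simp_all add: q_def)
  have fq: "feasible W" if "W \<in> set_pmf q" for W using stages_take_feasible[of W ?T] that by (simp add: q_def)
  have ks: "stage_of n m ?T = None" by (simp add: stage_of_def Let_def)
  have sr: "seed_range n (stage_of n m ?T) = 192 * n" by (simp add: seed_range_def ks)
  have Q: "0 < 192 * n" "192 * n \<le> 2 ^ 16 * n" using n0 by auto
  note fr = first_rounds[OF run(1) fq, unfolded sr, OF _ Q, folded J_def, unfolded ks]
  have first: "run A n m D (7 * ?T + 4) = map_pmf (\<lambda>(W, \<zeta>). S4 None W \<zeta>) J"
    "\<And>r. r < 4 \<Longrightarrow> state_ok (7 * ?T + r) \<and> round_ok (7 * ?T + r)"
    "\<And>W \<zeta>. (W, \<zeta>) \<in> set_pmf J \<Longrightarrow> feasible W \<and> \<zeta> \<in> assignments n (192 * n)"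
    using fr by blast+
  have f4: "fits (S4 None W \<zeta> i)" if "(W, \<zeta>) \<in> set_pmf J" "i < P" for W \<zeta> i
  proof -
    have "192 * n \<le> 2 ^ 16 * n" by simp
    then show ?thesis using first(3)[OF that(1)] that(2) fits_S4 by blast
  qed
  have r4: "run A n m D (Suc (7 * ?T + 4)) = map_pmf (\<lambda>(W, \<zeta>). SF W \<zeta>) J \<and> state_ok (7 * ?T + 4) \<and> round_ok (7 * ?T + 4)"
    by (rule det_round[where R = "\<lambda>(W, \<zeta>). RF W \<zeta>" and S = "\<lambda>(W, \<zeta>). S4 None W \<zeta>"])
      (use first tmod[of 4 ?T] f4 outF[OF _ ks] comm_RF round_fits_RF in auto)
  have "Suc (7 * ?T + 4) = 7 * ?T + 5" by simp
  then have r5: "run A n m D (7 * ?T + 5) = map_pmf (\<lambda>(W, \<zeta>). SF W \<zeta>) J" using r4 by (simp only:)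
  have ok: "state_ok t \<and> round_ok t" if "t < 7 * ?T + 5" for t
  proof (cases "t < 7 * ?T")
    case False
    then have t: "t = 7 * ?T + (t - 7 * ?T)" "t - 7 * ?T < 4 \<or> t - 7 * ?T = 4" using that by auto
    then show ?thesis using first(2) r4 by metis
  qed (use run(2) in blast)
  have "state_ok (7 * ?T + 5)" using fits_SF by (auto simp: state_ok_def r5)
  then have "obeys_limits 300 A n m D"
    using ok unfolding obeys_limits_def Let_def alg state_ok_def round_ok_def fits_def
    by (metis add_le_same_cancel1 le_neq_implies_less)
  moreover have "mpc_output A n m D = result n E \<beta> (size_exp n m)"
  proof -
    have "mpc_output A n m D = map_pmf (\<lambda>(W, \<zeta>). \<Union>i<P. decode_edges (SF W \<zeta> i)) J"
      unfolding mpc_output_def alg r5 by (simp add: map_pmf_comp split_def)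
    also have "\<dots> = map_pmf (\<lambda>(W, \<zeta>). pruned (192 * n) E \<beta> W \<zeta>) J"
    proof (rule map_pmf_cong[OF refl])
      fix a assume a: "a \<in> set_pmf J"
      obtain W \<zeta> where W: "a = (W, \<zeta>)" by force
      have "(\<Union>i<P. decode_edges (SF W \<zeta> i)) = pruned (192 * n) E \<beta> W \<zeta>"
        using first(3)[of W \<zeta>] a W by (intro output_eq) auto
      then show "(case a of (W, \<zeta>) \<Rightarrow> \<Union>i<P. decode_edges (SF W \<zeta> i)) = (case a of (W, \<zeta>) \<Rightarrow> pruned (192 * n) E \<beta> W \<zeta>)"
        by (simp only: W prod.case)
    qed
    also have "\<dots> = result n E \<beta> (size_exp n m)"
      unfolding J_def result_def q_def by (simp add: map_bind_pmf map_pmf_comp)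
    finally show ?thesis .
  qed
  ultimately show ?thesis by blast
qed

end

section \<open>The number of rounds, existence of input distributions, and the conclusion\<close>

lemma length_phases: "\<exists>J. length (phases e) = 3 * J \<and> (31 / 30 :: real) ^ J \<le> max 1 (real e)"
proof (induction e rule: less_induct)
  case (less e)
  show ?case
  proof (cases "e \<le> 16")
    case True
    then show ?thesis by (intro exI[of _ 0]) (simp add: phases.simps[of e])
  next
    case False
    let ?e = "e - e div 16"
    have "?e < e" using False by simp
    then obtain J where J: "length (phases ?e) = 3 * J" "(31 / 30 :: real) ^ J \<le> max 1 (real ?e)"
      using less.IH by blast
    \<comment> \<open>For e > 16 the quotient q = e div 16 is at least 1 and the remainder at most
      15, so e <= 31 q: every phase shrinks the exponent by the factor 30/31.\<close>
    have "a \<le> 31 * q" if "q * 16 + r = a" "r < 16" "a > 16" for a q r :: nat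
      using that by (cases q) auto
    from this[OF div_mult_mod_eq[of e 16] mod_less_divisor[of 16 e]] have "31 * (e div 16) \<ge> e"
      using False by simp
    then have "31 * ?e \<le> 30 * e" by (simp add: diff_mult_distrib2)
    then have "31 * real ?e \<le> 30 * real e" by (metis of_nat_le_iff of_nat_mult of_nat_numeral)
    moreover have "max 1 (real ?e) = real ?e"
    proof -
      have "e div 16 < e" using False by simp
      then have "?e \<ge> 1" by linarith
      then have "1 \<le> real ?e" using of_nat_le_iff[of 1 ?e, where 'a = real] by (simp only: of_nat_1)
      then show ?thesis by (rule max_absorb2)
    qed
    ultimately have "(31 / 30 :: real) ^ Suc J \<le> real e" using J(2) by simp
    then have "(31 / 30 :: real) ^ Suc J \<le> max 1 (real e)" by simp
    moreover have "length (phases e) = 3 * Suc J" using False J(1) by (simp add: phases.simps[of e])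
    ultimately show ?thesis by blast
  qed
qed

text \<open>The initial exponent is at most \<open>l\<close>, the logarithm of the truncated average
  degree, and (31/30) ^ 22 >= 2, so there are at most 22 log l phases. With three stages each the
  rounds are 21 J + 12, and 21 * 22 + 12 = 474 as log l >= 1.\<close>

lemma rounds_bound:
  assumes n: "n > 0"
  shows "real (7 * length (params (size_exp n m)) + 5) \<le> 474 * loglog_trunc (avg_degree n m)"
proof -
  define e where "e = size_exp n m"
  define x where "x = max 4 (avg_degree n m)"
  define l where "l = log 2 x"
  have x4: "x \<ge> 4" by (simp add: x_def)
  have l2: "l \<ge> 2"
  proof -
    have "log 2 (2 ^ 2) \<le> log 2 x" using x4 by (subst log_le_cancel_iff) auto
    moreover have "log 2 (2 ^ 2) = real 2" by (rule log_pow_cancel) auto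
    ultimately show ?thesis unfolding l_def by linarith
  qed
  have LL: "loglog_trunc (avg_degree n m) = log 2 l" by (simp add: loglog_trunc_def l_def x_def)
  have LL1: "log 2 l \<ge> 1"
  proof -
    have "log 2 2 \<le> log 2 l" using l2 by (subst log_le_cancel_iff) auto
    then show ?thesis by simp
  qed
  have el: "real e \<le> l"
  proof (cases "e = 0")
    case False
    then have "n * 2 ^ (16 * (e - 1)) < m" using size_exp_minimal[of n m] by (simp add: e_def)
    then have "real (n * 2 ^ (16 * (e - 1))) < real m" by (simp only: of_nat_less_iff)
    then have "real n * 2 ^ (16 * (e - 1)) < real m" by simp
    then have "2 ^ (16 * (e - 1)) < real m / real n" using n by (simp add: field_simps)
    also have "\<dots> \<le> avg_degree n m" by (simp add: avg_degree_def divide_right_mono)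
    also have "\<dots> \<le> x" by (simp add: x_def)
    finally have "log 2 (2 ^ (16 * (e - 1))) \<le> log 2 x" using x4 by (subst log_le_cancel_iff) auto
    moreover have "log 2 (2 ^ (16 * (e - 1))) = real (16 * (e - 1))" by (rule log_pow_cancel) auto
    ultimately have "real (16 * (e - 1)) \<le> l" unfolding l_def by linarith
    then have "16 * real e \<le> l + 16" using False by (simp add: of_nat_diff)
    moreover have "l + 16 \<le> 16 * l" using l2 by argo
    ultimately show ?thesis by argo
  qed (use l2 in simp)
  obtain J where J: "length (phases e) = 3 * J" "(31 / 30 :: real) ^ J \<le> max 1 (real e)"
    using length_phases by blast
  have "real J \<le> 22 * log 2 l"
  proof -
    have "(2::real) \<le> (31 / 30) ^ 22" by (simp add: power_divide)
    then have "(2::real) ^ J \<le> ((31 / 30) ^ 22) ^ J" by (rule power_mono) simp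
    also have "\<dots> = ((31 / 30) ^ J) ^ 22" by (simp add: mult.commute flip: power_mult)
    also have "\<dots> \<le> l ^ 22" using J(2) el l2 by (intro power_mono) auto
    finally have "log 2 (2 ^ J) \<le> log 2 (l ^ 22)" using l2 by (subst log_le_cancel_iff) auto
    then show ?thesis using l2 by (simp add: log_nat_power)
  qed
  then have "7 * (3 * real J + 1) + 5 \<le> 474 * log 2 l" using LL1 by argo
  then show ?thesis by (simp add: LL params_def J(1) flip: e_def)
qed

lemma concat_chunks: "concat (map (\<lambda>i. take h (drop (i * h) xs)) [0..<P]) = take (P * h) xs"
proof (induction P)
  case (Suc P)
  have "take (Suc P * h) xs = take (P * h) xs @ take h (drop (P * h) xs)"
    by (simp add: add.commute flip: take_add)
  then show ?case using Suc by simp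
qed simp

text \<open>Rules out that the claim about all distributions is vacuous: there are at most 2 P n
  items, and each machine can take at least 2 n.\<close>

lemma distribution_exists:
  assumes n: "n > 0" and E: "simple_graph {..<n} E" "card E = m"
  shows "\<exists>D. input_distribution (num_machines n m) (memory n) {..<n} E b D"
proof -
  let ?I = "input_items {..<n} E b" and ?P = "num_machines n m"
  define h where "h = memory n div 2"
  have fI: "finite ?I" unfolding input_items_def using simple_graph_finite[OF E(1)] by simp
  have cI: "card ?I \<le> m + n"
  proof -
    have "card ?I \<le> card (Edge ` E) + card ((\<lambda>v. Budget v (b v)) ` {..<n})"
      unfolding input_items_def by (rule card_Un_le)
    also have "\<dots> \<le> card E + card {..<n}"
      using simple_graph_finite[OF E(1)] by (intro add_mono card_image_le) auto
    finally show ?thesis using E by simp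
  qed
  obtain its where its: "set its = ?I" "distinct its" using finite_distinct_list[OF fI] by blast
  have "length its \<le> m + n" using its cI by (metis distinct_card)
  also have "\<dots> \<le> ?P * n + ?P * n"
  proof (rule add_mono)
    show "m \<le> ?P * n" using size_exp[OF n, of m] by (simp add: num_machines_def mult.commute)
    show "n \<le> ?P * n" by (simp add: num_machines_def)
  qed
  also have "\<dots> \<le> ?P * h"
  proof -
    have "2 * n \<le> h" by (simp add: h_def memory_def)
    then have "?P * (n + n) \<le> ?P * h" by (intro mult_left_mono) auto
    then show ?thesis by (simp only: distrib_left)
  qed
  finally have len: "length its \<le> ?P * h" .
  define D where "D i = take h (drop (i * h) its)" for i
  have "concat (map D [0..<?P]) = its" unfolding D_def concat_chunks using len by simp
  moreover have "2 * length (D i) \<le> memory n" for i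
  proof -
    have "length (D i) \<le> h" by (simp add: D_def)
    then show ?thesis unfolding h_def by linarith
  qed
  ultimately show ?thesis using its by (intro exI[of _ D]) (simp add: input_distribution_def)
qed

context simulation
begin

text \<open>The graph is simple, so no vertex has more than \<open>n\<close> edges and cutting its
  budget to \<open>n\<close> changes nothing.\<close>

lemma b_matching_\<beta>: "b_matching {..<n} E b M \<longleftrightarrow> b_matching {..<n} E \<beta> M"
proof -
  have "card {e \<in> M. v \<in> e} \<le> n" if "M \<subseteq> E" "v < n" for v
  proof -
    have "{e \<in> M. v \<in> e} \<subseteq> (\<lambda>u. {u, v}) ` {..<n}"
    proof
      fix e assume e: "e \<in> {e \<in> M. v \<in> e}"
      then have eE: "e \<in> E" using that by auto
      then obtain x y where xy: "e = {x, y}" using edgeE(2) by (metis card_2_iff)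
      then have "x < n" "y < n" using edgeE(1)[OF eE] by auto
      then show "e \<in> (\<lambda>u. {u, v}) ` {..<n}" using xy e by (cases "v = x") (auto simp: insert_commute)
    qed
    then have "card {e \<in> M. v \<in> e} \<le> card ((\<lambda>u. {u, v}) ` {..<n})" by (intro card_mono) auto
    also have "\<dots> \<le> n" using card_image_le[of "{..<n}" "\<lambda>u. {u, v}"] by simp
    finally show ?thesis .
  qed
  then show ?thesis unfolding b_matching_def \<beta>_def by auto
qed

lemma approx_\<beta>: "approx_b_matching \<alpha> {..<n} E b M \<longleftrightarrow> approx_b_matching \<alpha> {..<n} E \<beta> M"
  unfolding approx_b_matching_def max_b_matching_size_def b_matching_\<beta> ..

lemma output_approx:
  "measure_pmf.prob (mpc_output A n m D) {M. approx_b_matching (1 / 26112) {..<n} E b M} \<ge> 1 / 52224"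
proof -
  \<comment> \<open>Since 2 ^ (16 e) is the number of machines and at most 2 ^ 16 n, its square root
    is far below \<open>n\<close> once e > 16; this is the condition under which weights do not
    round to 0.\<close>
  have "2 ^ (8 * size_exp n m) \<le> 8 * n" if "16 < size_exp n m"
  proof -
    define e where "e = size_exp n m"
    have "(2::nat) ^ 16 * 2 ^ (8 * e) = 2 ^ (16 + 8 * e)" by (simp add: power_add)
    also have "\<dots> \<le> 2 ^ (16 * e)" using that by (intro power_increasing) (auto simp: e_def)
    also have "\<dots> \<le> 2 ^ 16 * n" using P_le by (simp add: num_machines_def e_def)
    finally show ?thesis by (simp add: e_def)
  qed
  moreover have "card E \<le> n * 2 ^ (16 * size_exp n m)" using size_exp[OF n0, of m] cardE by simp
  ultimately show ?thesis
    using result_approx[of "size_exp n m"] simulation by (simp add: approx_\<beta>)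
qed

end

theorem theorem3p1:
  "\<exists>(A :: mpc_algorithm) (C :: real) (k :: nat) (c :: nat) (\<alpha> :: real) (p :: real).
     C > 0 \<and> \<alpha> > 0 \<and> p > 0 \<and>
     (\<forall>(n :: nat) (m :: nat) (E :: nat set set) (b :: nat \<Rightarrow> nat).
        n > 0 \<and> simple_graph {..<n} E \<and> card E = m \<and> (\<forall>v<n. b v > 0) \<longrightarrow>
          real (rounds A n m) \<le> C * loglog_trunc (avg_degree n m) \<and>
          real (local_memory A n m) \<le> C * real n * log_trunc (real n) ^ k \<and>
          real (global_memory A n m) \<le> C * real (m + n) \<and>
          (\<exists>D. input_distribution (machines A n m) (local_memory A n m) {..<n} E b D) \<and>
          (\<forall>D. input_distribution (machines A n m) (local_memory A n m) {..<n} E b D \<longrightarrow>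
             obeys_limits c A n m D \<and>
             measure_pmf.prob (mpc_output A n m D) {M. approx_b_matching \<alpha> {..<n} E b M} \<ge> p))"
proof -
  let ?A = bmatch_algorithm
  \<comment> \<open>Local memory costs 2 ^ 261 and the number of machines another 2 ^ 16; the
    product 2 ^ 277 is the largest constant required.\<close>
  define C :: real where "C = 2 ^ 280"
  have C0: "C > 0" by (simp add: C_def)
  have main: "real (rounds ?A n m) \<le> C * loglog_trunc (avg_degree n m) \<and>
      real (local_memory ?A n m) \<le> C * real n * log_trunc (real n) ^ 0 \<and>
      real (global_memory ?A n m) \<le> C * real (m + n) \<and>
      (\<exists>D. input_distribution (machines ?A n m) (local_memory ?A n m) {..<n} E b D) \<and>
      (\<forall>D. input_distribution (machines ?A n m) (local_memory ?A n m) {..<n} E b D \<longrightarrow>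
         obeys_limits 300 ?A n m D \<and>
         measure_pmf.prob (mpc_output ?A n m D) {M. approx_b_matching (1 / 26112) {..<n} E b M} \<ge> 1 / 52224)"
    if n: "n > 0" and E: "simple_graph {..<n} E" "card E = m" and b: "\<forall>v<n. b v > 0" for n m E b
  proof (intro conjI allI impI)
    have M: "machines ?A n m = num_machines n m" "local_memory ?A n m = memory n"
      "rounds ?A n m = 7 * length (params (size_exp n m)) + 5" by (simp_all add: bmatch_algorithm_def)
    have LL0: "loglog_trunc (avg_degree n m) \<ge> 0"
    proof -
      have "0 \<le> real (7 * length (params (size_exp n m)) + 5)" by simp
      also have "\<dots> \<le> 474 * loglog_trunc (avg_degree n m)" using n by (rule rounds_bound)
      finally show ?thesis by simp
    qed
    have "real (rounds ?A n m) \<le> 474 * loglog_trunc (avg_degree n m)" unfolding M using n by (rule rounds_bound)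
    also have "\<dots> \<le> C * loglog_trunc (avg_degree n m)" using LL0 by (intro mult_right_mono) (auto simp: C_def)
    finally show "real (rounds ?A n m) \<le> C * loglog_trunc (avg_degree n m)" .
    have mem: "memory n \<le> 2 ^ 261 * n" using n by (simp add: memory_def)
    then have "real (memory n) \<le> real (2 ^ 261 * n)" by (simp only: of_nat_le_iff)
    also have "\<dots> \<le> C * real n" by (simp add: C_def)
    finally show "real (local_memory ?A n m) \<le> C * real n * log_trunc (real n) ^ 0" by (simp add: M)
    have "global_memory ?A n m \<le> num_machines n m * (2 ^ 261 * n)"
      unfolding global_memory_def M using mem by (rule mult_left_mono) simp
    also have "\<dots> = 2 ^ 261 * (num_machines n m * n)" by simp
    also have "\<dots> \<le> 2 ^ 261 * (2 ^ 16 * (m + n))" using num_machines_le[OF n, of m] by (rule mult_left_mono) simp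
    finally have "real (global_memory ?A n m) \<le> real (2 ^ 261 * (2 ^ 16 * (m + n)))" by (simp only: of_nat_le_iff)
    also have "\<dots> \<le> C * real (m + n)" by (simp add: C_def)
    finally show "real (global_memory ?A n m) \<le> C * real (m + n)" .
    show "\<exists>D. input_distribution (machines ?A n m) (local_memory ?A n m) {..<n} E b D"
      unfolding M using n E by (rule distribution_exists)
    fix D assume D: "input_distribution (machines ?A n m) (local_memory ?A n m) {..<n} E b D"
    interpret simulation n m E b D
      by unfold_locales (use n E b D in \<open>auto simp: M\<close>)
    show "obeys_limits 300 ?A n m D" using simulation by blast
    show "measure_pmf.prob (mpc_output ?A n m D) {M. approx_b_matching (1 / 26112) {..<n} E b M} \<ge> 1 / 52224"
      by (rule output_approx)
  qed
  \<comment> \<open>The witness 0 for the exponent means that local memory is O(n), without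
    logarithmic factors.\<close>
  show ?thesis
    by (rule exI[of _ ?A], rule exI[of _ C], rule exI[of _ 0], rule exI[of _ 300],
        rule exI[of _ "1 / 26112"], rule exI[of _ "1 / 52224"], intro conjI[OF C0 conjI[OF _ conjI]] allI impI,
        simp, simp, elim conjE, rule main; assumption)
qed

end
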